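(* Let $a,b,c>0$ be constants, $q_n\to\infty$ with $q_n\le\log n$, $d=d_n\ge2$, $R=R_n$ with $R^4/(R^2+d/n)=cq_n$, $\alpha=aq_n/n$, $\beta=bq_n/n$, and $(\mathbf{y},\boldsymbol\mu,\mathbf{A},\{\mathbf{x}_i\})\sim\mathrm{CSBM}(n,d,\alpha,\beta,R)$. For any sequence of estimators $\hat{\mathbf{y}}=\hat{\mathbf{y}}_n(\mathbf{A},\{\mathbf{x}_i\}_{i=1}^n)\in\{\pm1\}^n$, $\liminf_{n\to\infty}q_n^{-1}\log\mathbb{E}\mathcal{M}(\hat{\mathbf{y}},\mathbf{y})\ge-I^*(a,b,c)$, where $I^*(a,b,c)=[(\sqrt a-\sqrt b)^2+c]/2$.
   Context: $\mathrm{SBM}(\mathbf{y},\alpha,\beta)$: symmetric $\mathbf{A}\in\{0,1\}^{n\times n}$, $A_{ii}=0$, $\{A_{ij}\}_{i<j}$ independent, $\mathbb{P}(A_{ij}=1)=\alpha$ if $y_i=y_j$, $\beta$ otherwise. $\mathrm{GMM}(\boldsymbol\mu,\mathbf{y})$: $\mathbf{x}_i=y_i\boldsymbol\mu+\mathbf{z}_i$, $\mathbf{z}_i$ i.i.d. $N(\mathbf{0},\mathbf{I}_d)$. $\mathrm{CSBM}(n,d,\alpha,\beta,R)$: $\mathbf{y}$ uniform on $\{\pm1\}^n$, $\boldsymbol\mu$ uniform on the radius-$R$ sphere of $\mathbb{R}^d$, independent; conditionally, $\mathbf{A}\sim\mathrm{SBM}(\mathbf{y},\alpha,\beta)$ and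 $\{\mathbf{x}_i\}\sim\mathrm{GMM}(\boldsymbol\mu,\mathbf{y})$ independently. Estimators are measurable functions of the data. $\mathcal{M}(\hat{\mathbf{y}},\mathbf{y})=\frac1n\min_{s=\pm1}|\{i:\hat y_i\ne sy_i\}|$; $\log0=-\infty$. *)

theory Defs
  imports "HOL-Probability.Probability"
begin

(* Vectors in R^d are functions nat => real, extensional on {..<d}.
   Standard Gaussian vector N(0, I_d): product of d standard normals. *)
definition gauss_vec :: "nat \<Rightarrow> (nat \<Rightarrow> real) measure" where
  "gauss_vec d = PiM {..<d} (\<lambda>_. density lborel std_normal_density)"

definition vec_space :: "nat \<Rightarrow> (nat \<Rightarrow> real) measure" where
  "vec_space d = PiM {..<d} (\<lambda>_. borel)"

(* Uniform distribution on the radius-R sphere of R^d, realised as the law of R g/|g|,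
   g ~ N(0, I_d) (rotation invariance). *)
definition sphere_unif :: "nat \<Rightarrow> real \<Rightarrow> (nat \<Rightarrow> real) measure" where
  "sphere_unif d R = distr (gauss_vec d) (vec_space d)
     (\<lambda>g. \<lambda>j\<in>{..<d}. R * g j / sqrt (\<Sum>k<d. (g k)\<^sup>2))"

definition label_dist :: "nat \<Rightarrow> (nat \<Rightarrow> real) measure" where
  "label_dist n = measure_pmf (pmf_of_set (PiE {..<n} (\<lambda>_. {-1, 1})))"

definition edge_dist :: "nat \<Rightarrow> real \<Rightarrow> real \<Rightarrow> (nat \<Rightarrow> real) \<Rightarrow> (nat \<times> nat \<Rightarrow> bool) measure" where
  "edge_dist n \<alpha> \<beta> y = measure_pmf (Pi_pmf {(i,j). i < j \<and> j < n} False
     (\<lambda>(i,j). bernoulli_pmf (if y i = y j then \<alpha> else \<beta>)))"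

definition adj_of :: "(nat \<times> nat \<Rightarrow> bool) \<Rightarrow> (nat \<Rightarrow> nat \<Rightarrow> bool)" where
  "adj_of e = (\<lambda>i j. i \<noteq> j \<and> e (min i j, max i j))"

definition data_space :: "nat \<Rightarrow> nat \<Rightarrow> (nat \<Rightarrow> nat \<Rightarrow> real) measure" where
  "data_space n d = PiM {..<n} (\<lambda>_. vec_space d)"

definition gmm_dist :: "nat \<Rightarrow> nat \<Rightarrow> (nat \<Rightarrow> real) \<Rightarrow> (nat \<Rightarrow> real) \<Rightarrow> (nat \<Rightarrow> nat \<Rightarrow> real) measure" where
  "gmm_dist n d y \<mu> = PiM {..<n} (\<lambda>i. distr (gauss_vec d) (vec_space d)
      (\<lambda>z. \<lambda>j\<in>{..<d}. y i * \<mu> j + z j))"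

definition mismatch :: "nat \<Rightarrow> (nat \<Rightarrow> real) \<Rightarrow> (nat \<Rightarrow> real) \<Rightarrow> real" where
  "mismatch n yh y = (1 / real n) *
     real (min (card {i. i < n \<and> yh i \<noteq> y i}) (card {i. i < n \<and> yh i \<noteq> - y i}))"

(* E M(yhat(A, X), y) under CSBM(n, d, alpha, beta, R), written hierarchically:
   y, then mu, then (A, X) conditionally independent. *)
definition csbm_exp_mismatch ::
  "nat \<Rightarrow> nat \<Rightarrow> real \<Rightarrow> real \<Rightarrow> real \<Rightarrow>
   ((nat \<Rightarrow> nat \<Rightarrow> bool) \<Rightarrow> (nat \<Rightarrow> nat \<Rightarrow> real) \<Rightarrow> (nat \<Rightarrow> real)) \<Rightarrow> real" where
  "csbm_exp_mismatch n d \<alpha> \<beta> R est = enn2real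
     (\<integral>\<^sup>+ y. \<integral>\<^sup>+ \<mu>. \<integral>\<^sup>+ e. \<integral>\<^sup>+ X.
        ennreal (mismatch n (est (adj_of e) X) y)
      \<partial>gmm_dist n d y \<mu> \<partial>edge_dist n \<alpha> \<beta> y \<partial>sphere_unif d R \<partial>label_dist n)"

definition elog :: "real \<Rightarrow> ereal" where
  "elog x = (if x = 0 then -\<infinity> else ereal (ln x))"

definition Istar :: "real \<Rightarrow> real \<Rightarrow> real \<Rightarrow> real" where
  "Istar a b c = ((sqrt a - sqrt b)\<^sup>2 + c) / 2"

end

theory Submission
  imports Defs "HOL-Real_Asymp.Real_Asymp"
begin

text \<open>
  An estimator with small misclassification rate predicts most products \<open>y\<^sub>i y\<^sub>k\<close> correctly, and for
  fixed data the prediction of \<open>y\<^sub>i y\<^sub>k\<close> is wrong for \<open>y\<close> or for \<open>y\<close> with the label \<open>i\<close> flipped. So the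
  error is at least a sum of integrals of minima of the marginal likelihoods of such pairs of labelings.

  Let \<open>S = \<Sum>\<^sub>j\<^sub>\<noteq>\<^sub>i y\<^sub>j x\<^sub>j\<close>. The uniform prior of \<open>\<mu>\<close> is invariant under the reflection that fixes \<open>S\<close> and negates
  its orthogonal complement. Reflecting \<open>\<mu>\<close> in one of the two likelihoods makes the
  component of \<open>\<mu>\<close> orthogonal to \<open>S\<close>, about which the data carry no usable information, cancel: what remains is
  a Gaussian testing problem with the squared norm of the component along \<open>S\<close>, which concentrates below
  \<open>(1 + \<delta>) R\<^sup>4 / (R\<^sup>2 + d / n)\<close>, times the edges at \<open>i\<close>, whose geometric mean of likelihoods has mass
  \<open>(sqrt (\<alpha> \<beta>) + sqrt ((1 - \<alpha>) (1 - \<beta>))) ^ (n - 1)\<close>. Under this tilted law the log-likelihood ratio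
  is \<open>o(q)\<close> by a second moment bound averaged over \<open>y\<close>, so the minimum loses only a factor \<open>exp (- o(q))\<close>
  against the geometric mean.
\<close>

section \<open>Finite products of Lebesgue measure\<close>

text \<open>The loss ignores a global sign, so a single label cannot be tested, but products of two
  labels can. The obstacle is the shared random \<mu>: a minimum of two mixtures dominates the
  integral of a minimum only after the two copies of \<mu> are coupled. Equal copies cost
  exp(-R^2/2), and R^2 is far larger than c q when d/n dominates R^2. With the reflected coupling
  the two means of sample i differ only along S, at cost exp(-|p|^2/2), where p is the component of
  \<mu> along S. As <\<mu>,S> is about n R^2 and |S|^2 about n^2 R^2 + n d, |p|^2 is about R^4/(R^2
  + d/n) = c q: this is the origin of that ratio. Each edge at i contributes a Bhattacharyya
  coefficient with logarithm about -(sqrt a - sqrt b)^2 q/(2n). The minimum is compared with the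
  geometric mean by min(A,B) = sqrt(A B) exp(-|z|), z = ln(A/B)/2, and exp(-|z|) \<ge> exp(-t)(1 -
  z^2/t^2). The last bound is linear in z^2, so it can be averaged over labelings even where it is
  negative; the averaged z^2 is O(q), so t = \<delta> q suffices.\<close>

lemma nn_integral_PiM_density:
  fixes g :: "'i \<Rightarrow> 'a \<Rightarrow> ennreal"
  assumes fin: "finite I"
    and sf: "\<And>i. sigma_finite_measure (M i)" "\<And>i. sigma_finite_measure (density (M i) (g i))"
    and g[measurable]: "\<And>i. g i \<in> borel_measurable (M i)"
    and f: "f \<in> borel_measurable (PiM I M)"
  shows "(\<integral>\<^sup>+x. f x \<partial>PiM I (\<lambda>i. density (M i) (g i))) = (\<integral>\<^sup>+x. (\<Prod>i\<in>I. g i (x i)) * f x \<partial>PiM I M)"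
proof -
  interpret M: product_sigma_finite M using sf(1) by unfold_locales (simp add: sigma_finite_measure_def)
  interpret D: product_sigma_finite "\<lambda>i. density (M i) (g i)"
    using sf(2) by (simp add: product_sigma_finite_def)
  have S: "sets (PiM J (\<lambda>i. density (M i) (g i))) = sets (PiM J M)" for J
    by (intro sets_PiM_cong) auto
  show ?thesis
    using fin f
  proof (induction I arbitrary: f rule: finite_induct)
    case empty
    have "PiM {} (\<lambda>i. density (M i) (g i)) = PiM {} M" by (simp add: PiM_empty)
    then show ?case by simp
  next
    case (insert i I)
    note insert.prems[measurable]
    have fm: "f \<in> borel_measurable (PiM (insert i I) (\<lambda>i. density (M i) (g i)))"
      using insert.prems measurable_cong_sets[OF S[of "insert i I"] refl] by blast
    have fu: "(\<lambda>y. f (x(i:=y))) \<in> borel_measurable (M i)" if "x \<in> space (PiM I M)" for x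
      by (rule measurable_compose[OF measurable_fun_upd[where J=I] insert.prems])
        (use that in \<open>auto simp: space_PiM\<close>)
    have pm[measurable]: "(\<lambda>x. \<Prod>j\<in>I. g j (x j)) \<in> borel_measurable (PiM I M)"
      by measurable
    have pm2[measurable]: "(\<lambda>x. \<Prod>j\<in>insert i I. g j (x j)) \<in> borel_measurable (PiM (insert i I) M)"
      by measurable
    have "(\<integral>\<^sup>+x. f x \<partial>PiM (insert i I) (\<lambda>i. density (M i) (g i)))
        = (\<integral>\<^sup>+x. (\<integral>\<^sup>+y. f (x(i:=y)) \<partial>density (M i) (g i)) \<partial>PiM I (\<lambda>i. density (M i) (g i)))"
      by (rule D.product_nn_integral_insert) (use insert fm in auto)
    also have "\<dots> = (\<integral>\<^sup>+x. (\<integral>\<^sup>+y. g i y * f (x(i:=y)) \<partial>M i) \<partial>PiM I (\<lambda>i. density (M i) (g i)))"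
      by (intro nn_integral_cong nn_integral_density g fu) (auto simp: sets_eq_imp_space_eq[OF S])
    also have "\<dots> = (\<integral>\<^sup>+x. (\<Prod>i\<in>I. g i (x i)) * (\<integral>\<^sup>+y. g i y * f (x(i:=y)) \<partial>M i) \<partial>PiM I M)"
      by (rule insert.IH) measurable
    also have "\<dots> = (\<integral>\<^sup>+x. (\<integral>\<^sup>+y. (\<Prod>j\<in>I. g j (x j)) * (g i y * f (x(i:=y))) \<partial>M i) \<partial>PiM I M)"
      by (intro nn_integral_cong nn_integral_cmult[symmetric] borel_measurable_times_ennreal g fu)
    also have "\<dots> = (\<integral>\<^sup>+x. (\<integral>\<^sup>+y. (\<Prod>j\<in>insert i I. g j ((x(i:=y)) j)) * f (x(i:=y)) \<partial>M i) \<partial>PiM I M)"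
    proof (intro nn_integral_cong)
      fix x y
      have "(\<Prod>j\<in>I. g j ((x(i:=y)) j)) = (\<Prod>j\<in>I. g j (x j))"
        using insert.hyps by (intro prod.cong) auto
      then show "(\<Prod>j\<in>I. g j (x j)) * (g i y * f (x(i:=y))) = (\<Prod>j\<in>insert i I. g j ((x(i:=y)) j)) * f (x(i:=y))"
        using insert.hyps by (simp add: mult_ac)
    qed
    also have "\<dots> = (\<integral>\<^sup>+x. (\<Prod>j\<in>insert i I. g j (x j)) * f x \<partial>PiM (insert i I) M)"
      by (rule M.product_nn_integral_insert[symmetric]) (use insert in auto)
    finally show ?case .
  qed
qed

interpretation lebesgue_prod: product_sigma_finite "\<lambda>_::'i. lborel :: real measure"
  by (simp add: product_sigma_finite_def lborel.sigma_finite_measure_axioms)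

lemma nn_integral_PiM_lborel_translate:
  fixes v :: "'i \<Rightarrow> real"
  assumes fin: "finite I" and f: "f \<in> borel_measurable (PiM I (\<lambda>_. borel))"
  shows "(\<integral>\<^sup>+x. f (\<lambda>k\<in>I. x k + v k) \<partial>PiM I (\<lambda>_. lborel)) = (\<integral>\<^sup>+x. f x \<partial>PiM I (\<lambda>_. lborel))"
proof -
  have S: "sets (PiM J (\<lambda>_::'i. lborel)) = sets (PiM J (\<lambda>_. borel :: real measure))" for J
    by (intro sets_PiM_cong) auto
  note [measurable_cong] = S
  show ?thesis
    using fin f
  proof (induction I arbitrary: f rule: finite_induct)
    case empty
    then show ?case by (intro nn_integral_cong) (auto simp: space_PiM)
  next
    case (insert i I)
    note insert.prems[measurable]
    have m': "(\<lambda>y. f (x(i:=y))) \<in> borel_measurable borel" if "x \<in> extensional I" for x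
      by (rule measurable_compose[OF measurable_fun_upd[where J=I] insert.prems])
        (use that in \<open>auto simp: space_PiM PiE_def\<close>)
    have "(\<integral>\<^sup>+x. f (\<lambda>k\<in>insert i I. x k + v k) \<partial>PiM (insert i I) (\<lambda>_. lborel))
      = (\<integral>\<^sup>+x. \<integral>\<^sup>+y. f (\<lambda>k\<in>insert i I. (x(i:=y)) k + v k) \<partial>lborel \<partial>PiM I (\<lambda>_. lborel))"
      using insert by (intro lebesgue_prod.product_nn_integral_insert) auto
    also have "\<dots> = (\<integral>\<^sup>+x. \<integral>\<^sup>+y. f ((\<lambda>k\<in>I. x k + v k)(i:= v i + 1 * y)) \<partial>lborel \<partial>PiM I (\<lambda>_. lborel))"
      using insert.hyps by (intro nn_integral_cong arg_cong[where f=f]) (auto simp: fun_eq_iff)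
    also have "\<dots> = (\<integral>\<^sup>+x. \<integral>\<^sup>+y. f ((\<lambda>k\<in>I. x k + v k)(i:= y)) \<partial>lborel \<partial>PiM I (\<lambda>_. lborel))"
    proof (rule nn_integral_cong)
      fix x
      have *: "(\<lambda>y. f ((\<lambda>k\<in>I. x k + v k)(i:= y))) \<in> borel_measurable borel"
        by (rule m') auto
      from nn_integral_real_affine[OF *, of 1 "v i"]
      show "(\<integral>\<^sup>+y. f ((\<lambda>k\<in>I. x k + v k)(i:= v i + 1 * y)) \<partial>lborel) = (\<integral>\<^sup>+y. f ((\<lambda>k\<in>I. x k + v k)(i:= y)) \<partial>lborel)"
        by simp
    qed
    also have "\<dots> = (\<integral>\<^sup>+x. \<integral>\<^sup>+y. f (x(i:= y)) \<partial>lborel \<partial>PiM I (\<lambda>_. lborel))"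
      by (rule insert.IH) measurable
    also have "\<dots> = (\<integral>\<^sup>+x. f x \<partial>PiM (insert i I) (\<lambda>_. lborel))"
      using insert by (intro lebesgue_prod.product_nn_integral_insert[symmetric]) auto
    finally show ?case .
  qed
qed

lemma sets_PiM_lborel [measurable_cong]:
  "sets (PiM J (\<lambda>_. lborel)) = sets (PiM J (\<lambda>_. borel :: real measure))"
  by (intro sets_PiM_cong) auto

text \<open>In the coordinates \<open>(p, x')\<close>, where \<open>p = \<langle>x, w\<rangle>\<close> replaces one coordinate and \<open>x'\<close> collects the
  others, the reflection is \<open>(p, x') \<mapsto> (- p, x' - 2 p w')\<close>: a sign change and a translation.\<close>

lemma nn_integral_PiM_lborel_reflect:
  fixes w :: "'i \<Rightarrow> real"
  assumes fin: "finite I" and w: "(\<Sum>k\<in>I. (w k)\<^sup>2) = 1"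
    and f[measurable]: "f \<in> borel_measurable (PiM I (\<lambda>_. borel))"
  shows "(\<integral>\<^sup>+x. f (\<lambda>k\<in>I. x k - 2 * (\<Sum>j\<in>I. x j * w j) * w k) \<partial>PiM I (\<lambda>_. lborel))
    = (\<integral>\<^sup>+x. f x \<partial>PiM I (\<lambda>_. lborel))"
proof -
  \<comment> \<open>Coordinate k is the one traded for p, so w k must be nonzero; |w| = 1 provides
    one.\<close>
  obtain k where k: "k \<in> I" "w k \<noteq> 0"
    using w by (metis (no_types, lifting) power_zero_numeral sum.neutral zero_neq_one)
  define J where "J = I - {k}"
  have J: "finite J" "k \<notin> J" "I = insert k J" using fin k by (auto simp: J_def)
  have f'[measurable]: "f \<in> borel_measurable (PiM (insert k J) (\<lambda>_. borel))" using f J by simp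
  define r where "r x = (\<Sum>j\<in>J. x j * w j)" for x :: "'i \<Rightarrow> real"
  have r[measurable]: "r \<in> borel_measurable (PiM J (\<lambda>_. borel))" unfolding r_def by measurable
  have wJ: "(\<Sum>j\<in>J. (w j)\<^sup>2) = 1 - (w k)\<^sup>2" using w J by simp
  define h where "h x p = f (x(k := (p - r x) / w k))" for x p
  have hm[measurable]: "(\<lambda>(x,p). h x p) \<in> borel_measurable (PiM J (\<lambda>_. borel) \<Otimes>\<^sub>M borel)"
    unfolding h_def by measurable
  interpret J: finite_product_sigma_finite "\<lambda>_. lborel :: real measure" J
    by standard (use J in auto)
  interpret P: pair_sigma_finite "PiM J (\<lambda>_. lborel :: real measure)" "lborel :: real measure"
    by standard
  have fu: "(\<lambda>y. f (x(k:=y))) \<in> borel_measurable borel" if "x \<in> space (PiM J (\<lambda>_. lborel))" for x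
    by (rule measurable_compose[OF measurable_fun_upd[where J=J] f'])
       (use that in \<open>auto simp: space_PiM\<close>)
  have chg: "(\<integral>\<^sup>+y. F y \<partial>lborel) = ennreal \<bar>1 / w k\<bar> * (\<integral>\<^sup>+p. F ((p - r x) / w k) \<partial>lborel)"
    if "F \<in> borel_measurable borel" for F :: "real \<Rightarrow> ennreal" and x
    using nn_integral_real_affine[OF that, of "1 / w k" "- r x / w k"] k
    by (simp add: diff_divide_distrib)
  have full: "(\<integral>\<^sup>+x. f x \<partial>PiM I (\<lambda>_. lborel)) = ennreal \<bar>1 / w k\<bar> * (\<integral>\<^sup>+x. \<integral>\<^sup>+p. h x p \<partial>lborel \<partial>PiM J (\<lambda>_. lborel))"
  proof -
    have "(\<integral>\<^sup>+x. f x \<partial>PiM I (\<lambda>_. lborel)) = (\<integral>\<^sup>+x. \<integral>\<^sup>+y. f (x(k:=y)) \<partial>lborel \<partial>PiM J (\<lambda>_. lborel))"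
      unfolding J(3) by (rule lebesgue_prod.product_nn_integral_insert) (use J in auto)
    also have "\<dots> = (\<integral>\<^sup>+x. ennreal \<bar>1 / w k\<bar> * (\<integral>\<^sup>+p. h x p \<partial>lborel) \<partial>PiM J (\<lambda>_. lborel))"
      unfolding h_def by (intro nn_integral_cong chg fu)
    also have "\<dots> = ennreal \<bar>1 / w k\<bar> * (\<integral>\<^sup>+x. \<integral>\<^sup>+p. h x p \<partial>lborel \<partial>PiM J (\<lambda>_. lborel))"
      by (rule nn_integral_cmult) measurable
    finally show ?thesis .
  qed
  define H where "H x = (\<lambda>k\<in>I. x k - 2 * (\<Sum>j\<in>I. x j * w j) * w k)" for x :: "'i \<Rightarrow> real"
  have Hm[measurable]: "H \<in> measurable (PiM (insert k J) (\<lambda>_. borel)) (PiM (insert k J) (\<lambda>_. borel))"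
    unfolding H_def J(3) by measurable
  have fHm: "(\<lambda>y. f (H (x(k:=y)))) \<in> borel_measurable borel" if "x \<in> space (PiM J (\<lambda>_. lborel))" for x
    by (rule measurable_compose[OF measurable_fun_upd[where J=J] measurable_compose[OF Hm f']])
       (use that in \<open>auto simp: space_PiM\<close>)
  have ipk: "(\<Sum>j\<in>I. (x(k := y)) j * w j) = r x + y * w k" for x y
  proof -
    have "(\<Sum>j\<in>J. (x(k := y)) j * w j) = r x"
      unfolding r_def using J(2) by (intro sum.cong) auto
    then show ?thesis using J by simp
  qed
  have Hh: "f (H (x(k := (p - r x) / w k))) = h (\<lambda>j\<in>J. x j + (- 2 * p * w j)) (- p)" for x p
  proof -
    have "r (\<lambda>j\<in>J. x j + (- 2 * p * w j)) = r x - 2 * p * (\<Sum>j\<in>J. (w j)\<^sup>2)"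
      unfolding r_def by (simp add: algebra_simps sum_subtractf sum_distrib_left power2_eq_square)
    then have e: "r (\<lambda>j\<in>J. x j + (- 2 * p * w j)) = r x - 2 * p * (1 - (w k)\<^sup>2)"
      by (simp add: wJ)
    have "H (x(k := (p - r x) / w k)) = (\<lambda>j\<in>J. x j + (- 2 * p * w j))(k := (- p - r (\<lambda>j\<in>J. x j + (- 2 * p * w j))) / w k)"
      unfolding e H_def ipk using J(2,3) k(2)
      by (auto simp: fun_eq_iff restrict_def field_simps power2_eq_square)
    then show ?thesis by (simp add: h_def)
  qed
  have "(\<integral>\<^sup>+x. f (H x) \<partial>PiM I (\<lambda>_. lborel)) = (\<integral>\<^sup>+x. \<integral>\<^sup>+y. f (H (x(k:=y))) \<partial>lborel \<partial>PiM J (\<lambda>_. lborel))"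
    unfolding J(3) by (rule lebesgue_prod.product_nn_integral_insert) (use J in auto)
  also have "\<dots> = (\<integral>\<^sup>+x. ennreal \<bar>1 / w k\<bar> * (\<integral>\<^sup>+p. f (H (x(k := (p - r x) / w k))) \<partial>lborel) \<partial>PiM J (\<lambda>_. lborel))"
    by (intro nn_integral_cong chg fHm)
  also have "\<dots> = (\<integral>\<^sup>+x. ennreal \<bar>1 / w k\<bar> * (\<integral>\<^sup>+p. h (\<lambda>j\<in>J. x j + (- 2 * p * w j)) (- p) \<partial>lborel) \<partial>PiM J (\<lambda>_. lborel))"
    unfolding Hh ..
  also have "\<dots> = ennreal \<bar>1 / w k\<bar> * (\<integral>\<^sup>+x. \<integral>\<^sup>+p. h (\<lambda>j\<in>J. x j + (- 2 * p * w j)) (- p) \<partial>lborel \<partial>PiM J (\<lambda>_. lborel))"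
    by (rule nn_integral_cmult) measurable
  \<comment> \<open>The shift of x' depends on p alone, so translation invariance applies once x' is
    the inner variable; the sign change of p follows after that.\<close>
  also have "(\<integral>\<^sup>+x. \<integral>\<^sup>+p. h (\<lambda>j\<in>J. x j + (- 2 * p * w j)) (- p) \<partial>lborel \<partial>PiM J (\<lambda>_. lborel))
     = (\<integral>\<^sup>+p. \<integral>\<^sup>+x. h (\<lambda>j\<in>J. x j + (- 2 * p * w j)) (- p) \<partial>PiM J (\<lambda>_. lborel) \<partial>lborel)"
    by (rule P.Fubini'[symmetric]) measurable
  also have "\<dots> = (\<integral>\<^sup>+p. \<integral>\<^sup>+x. h x (- p) \<partial>PiM J (\<lambda>_. lborel) \<partial>lborel)"
    by (intro nn_integral_cong nn_integral_PiM_lborel_translate J) measurable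
  also have "\<dots> = (\<integral>\<^sup>+p. \<integral>\<^sup>+x. h x p \<partial>PiM J (\<lambda>_. lborel) \<partial>lborel)"
    by (subst (2) nn_integral_real_affine[where c="-1" and t=0]) simp_all
  also have "\<dots> = (\<integral>\<^sup>+x. \<integral>\<^sup>+p. h x p \<partial>lborel \<partial>PiM J (\<lambda>_. lborel))"
    by (rule P.Fubini') measurable
  finally show ?thesis unfolding full H_def .
qed

section \<open>Standard Gaussian vectors\<close>

abbreviation "std_gauss \<equiv> density lborel (\<lambda>x. ennreal (std_normal_density x))"

interpretation std_gauss: prob_space std_gauss
  by (rule prob_space_normal_density) simp

interpretation std_gauss_prod: product_prob_space "\<lambda>_::'i. std_gauss" UNIV
  by unfold_locales

interpretation gauss_vec: prob_space "gauss_vec d"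
  unfolding gauss_vec_def by (rule prob_space_PiM) unfold_locales

interpretation gauss_vec_prod: product_sigma_finite "\<lambda>_::'i. gauss_vec d" for d
  by (simp add: product_sigma_finite_def gauss_vec.sigma_finite_measure_axioms)

lemma sets_PiM_std_gauss [measurable_cong]: "sets (PiM I (\<lambda>_. std_gauss)) = sets (PiM I (\<lambda>_. borel))"
  by (intro sets_PiM_cong) auto

lemma sets_gauss_vec [measurable_cong]: "sets (gauss_vec d) = sets (vec_space d)"
  unfolding gauss_vec_def vec_space_def by (rule sets_PiM_std_gauss)

lemma vec_space_component:
  "f \<in> measurable M (vec_space d) \<Longrightarrow> k < d \<Longrightarrow> (\<lambda>x. f x k) \<in> borel_measurable M"
  using measurable_compose[OF _ measurable_component_singleton[of k "{..<d}" "\<lambda>_. borel"], of f M]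
  by (simp add: vec_space_def)

lemma vec_space_component_ident [measurable (raw)]: "k < d \<Longrightarrow> (\<lambda>x. x k) \<in> borel_measurable (vec_space d)"
  by (rule vec_space_component) auto

lemma vec_space_lambda [measurable (raw)]:
  "(\<And>k. k < d \<Longrightarrow> (\<lambda>x. f x k) \<in> borel_measurable M) \<Longrightarrow> (\<lambda>x. \<lambda>k\<in>{..<d}. f x k) \<in> measurable M (vec_space d)"
  unfolding vec_space_def by (intro measurable_restrict) auto

lemma space_vec_space: "space (vec_space d) = extensional {..<d}"
  by (auto simp: vec_space_def space_PiM PiE_def)

text \<open>Only coordinates below d enter, so arguments need not be extensional and every
  \<open>restrict\<close> inside an inner product simplifies away.\<close>

definition ip :: "nat \<Rightarrow> (nat \<Rightarrow> real) \<Rightarrow> (nat \<Rightarrow> real) \<Rightarrow> real" where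
  "ip d x y = (\<Sum>k<d. x k * y k)"

lemma ip_measurable [measurable]:
  assumes [measurable]: "f \<in> measurable M (vec_space d)" "g \<in> measurable M (vec_space d)"
  shows "(\<lambda>x. ip d (f x) (g x)) \<in> borel_measurable M"
  unfolding ip_def by (intro borel_measurable_sum borel_measurable_times vec_space_component[OF assms(1)] vec_space_component[OF assms(2)]) auto

lemma ip_commute: "ip d x y = ip d y x"
  by (simp add: ip_def mult.commute)

lemma ip_restrict [simp]: "ip d (restrict x {..<d}) y = ip d x y" "ip d x (restrict y {..<d}) = ip d x y"
  by (simp_all add: ip_def)

lemma ip_linear:
  "ip d (\<lambda>k. x k + y k) z = ip d x z + ip d y z"
  "ip d z (\<lambda>k. x k + y k) = ip d z x + ip d z y"
  "ip d (\<lambda>k. x k - y k) z = ip d x z - ip d y z"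
  "ip d z (\<lambda>k. x k - y k) = ip d z x - ip d z y"
  "ip d (\<lambda>k. c * x k) z = c * ip d x z"
  "ip d z (\<lambda>k. c * x k) = c * ip d z x"
  "ip d (\<lambda>k. - x k) z = - ip d x z"
  "ip d z (\<lambda>k. - x k) = - ip d z x"
  by (simp_all add: ip_def algebra_simps sum.distrib sum_subtractf sum_distrib_left sum_negf)

lemma ip_self_nonneg: "0 \<le> ip d x x"
  by (simp add: ip_def sum_nonneg)

lemma ip_self_eq_0_imp: "ip d x x = 0 \<Longrightarrow> k < d \<Longrightarrow> x k = 0"
  by (simp add: ip_def sum_nonneg_eq_0_iff)

lemma ip_self_eq_0_left: "ip d x x = 0 \<Longrightarrow> ip d x y = 0"
  unfolding ip_def[of d x y] by (intro sum.neutral) (auto dest: ip_self_eq_0_imp)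

section \<open>Translations and reflections of the standard Gaussian law\<close>

lemma nn_integral_gauss_vec:
  assumes f: "f \<in> borel_measurable (vec_space d)"
  shows "(\<integral>\<^sup>+x. f x \<partial>gauss_vec d)
    = (\<integral>\<^sup>+x. ennreal ((1 / sqrt (2 * pi)) ^ d * exp (- ip d x x / 2)) * f x \<partial>PiM {..<d} (\<lambda>_. lborel))"
proof -
  have "(\<integral>\<^sup>+x. f x \<partial>gauss_vec d)
    = (\<integral>\<^sup>+x. (\<Prod>k<d. ennreal (std_normal_density (x k))) * f x \<partial>PiM {..<d} (\<lambda>_. lborel))"
    unfolding gauss_vec_def
    by (rule nn_integral_PiM_density)
      (use f in \<open>auto simp: lborel.sigma_finite_measure_axioms std_gauss.sigma_finite_measure_axioms
         vec_space_def cong: measurable_cong_sets\<close>)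
  also have "\<dots> = (\<integral>\<^sup>+x. ennreal ((1 / sqrt (2 * pi)) ^ d * exp (- ip d x x / 2)) * f x \<partial>PiM {..<d} (\<lambda>_. lborel))"
  proof (intro nn_integral_cong arg_cong2[where f="(*)"] refl)
    fix x :: "nat \<Rightarrow> real"
    have "(\<Prod>k<d. std_normal_density (x k)) = (1 / sqrt (2 * pi)) ^ d * exp (- ip d x x / 2)"
      unfolding std_normal_density_def prod.distrib ip_def
      by (simp add: exp_sum[symmetric] sum_negf[symmetric] sum_divide_distrib power2_eq_square)
    then show "(\<Prod>k<d. ennreal (std_normal_density (x k))) = ennreal ((1 / sqrt (2 * pi)) ^ d * exp (- ip d x x / 2))"
      by (simp add: prod_ennreal)
  qed
  finally show ?thesis .
qed

text \<open>Cameron-Martin formula: Lebesgue measure is translation invariant, and completing the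
  square in the Gaussian density leaves the exponential weight.\<close>

lemma nn_integral_gauss_vec_shift:
  assumes f[measurable]: "f \<in> borel_measurable (vec_space d)"
  shows "(\<integral>\<^sup>+z. f (\<lambda>k\<in>{..<d}. v k + z k) \<partial>gauss_vec d)
    = (\<integral>\<^sup>+x. ennreal (exp (ip d v x - ip d v v / 2)) * f x \<partial>gauss_vec d)"
proof -
  define v' where "v' = restrict v {..<d}"
  have v': "v' \<in> space (vec_space d)" by (simp add: v'_def space_vec_space)
  have ipv[measurable]: "(\<lambda>x. ip d v x) \<in> borel_measurable (vec_space d)"
    using ip_measurable[OF measurable_const[OF v'] measurable_ident_sets[OF refl]] by (simp add: v'_def)
  let ?C = "(1 / sqrt (2 * pi)) ^ d"
  let ?F = "\<lambda>x. ennreal (?C * exp (- ip d x x / 2)) * (ennreal (exp (ip d v x - ip d v v / 2)) * f x)"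
  have Fm: "?F \<in> borel_measurable (PiM {..<d} (\<lambda>_. borel))"
    unfolding vec_space_def[symmetric] by measurable
  have "(\<integral>\<^sup>+x. ennreal (exp (ip d v x - ip d v v / 2)) * f x \<partial>gauss_vec d) = (\<integral>\<^sup>+x. ?F x \<partial>PiM {..<d} (\<lambda>_. lborel))"
    by (rule nn_integral_gauss_vec) measurable
  also have "\<dots> = (\<integral>\<^sup>+x. ?F (\<lambda>k\<in>{..<d}. x k + v k) \<partial>PiM {..<d} (\<lambda>_. lborel))"
    by (rule nn_integral_PiM_lborel_translate[symmetric, OF _ Fm]) simp
  also have "\<dots> = (\<integral>\<^sup>+x. ennreal (?C * exp (- ip d x x / 2)) * f (\<lambda>k\<in>{..<d}. v k + x k) \<partial>PiM {..<d} (\<lambda>_. lborel))"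
  proof (intro nn_integral_cong)
    fix x :: "nat \<Rightarrow> real"
    let ?x = "\<lambda>k\<in>{..<d}. x k + v k"
    have "- ip d ?x ?x / 2 + (ip d v ?x - ip d v v / 2) = - ip d x x / 2"
      by (simp add: ip_linear ip_commute[of d x v] field_simps)
    then have "exp (- ip d ?x ?x / 2) * exp (ip d v ?x - ip d v v / 2) = exp (- ip d x x / 2)"
      by (simp add: exp_add[symmetric])
    then have "ennreal (?C * exp (- ip d ?x ?x / 2)) * ennreal (exp (ip d v ?x - ip d v v / 2)) = ennreal (?C * exp (- ip d x x / 2))"
      by (subst ennreal_mult'[symmetric]) (simp_all add: mult.assoc)
    then show "?F ?x = ennreal (?C * exp (- ip d x x / 2)) * f (\<lambda>k\<in>{..<d}. v k + x k)"
      by (simp add: mult.assoc[symmetric] add.commute)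
  qed
  also have "\<dots> = (\<integral>\<^sup>+z. f (\<lambda>k\<in>{..<d}. v k + z k) \<partial>gauss_vec d)"
    by (rule nn_integral_gauss_vec[symmetric]) measurable
  finally show ?thesis by simp
qed

text \<open>The isometry that fixes the line through S and negates its orthogonal complement. For S
  = 0 the quotient is 0 by convention and the map is x -> -x, still an isometry.\<close>

definition refl_axis :: "nat \<Rightarrow> (nat \<Rightarrow> real) \<Rightarrow> (nat \<Rightarrow> real) \<Rightarrow> nat \<Rightarrow> real" where
  "refl_axis d S x = (\<lambda>k\<in>{..<d}. 2 * (ip d x S / ip d S S) * S k - x k)"

lemma refl_axis_measurable [measurable]:
  assumes [measurable]: "f \<in> measurable M (vec_space d)" "g \<in> measurable M (vec_space d)"
  shows "(\<lambda>x. refl_axis d (f x) (g x)) \<in> measurable M (vec_space d)"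
  unfolding refl_axis_def
  by (intro vec_space_lambda borel_measurable_diff borel_measurable_times borel_measurable_divide borel_measurable_const
     ip_measurable assms vec_space_component[OF assms(1)] vec_space_component[OF assms(2)])

lemma ip_refl_axis_axis: "ip d (refl_axis d S x) S = ip d x S"
proof (cases "ip d S S = 0")
  case True
  then have "ip d x S = 0" using ip_self_eq_0_left ip_commute by metis
  then show ?thesis by (simp add: refl_axis_def ip_linear)
next
  case False
  define c where "c = 2 * (ip d x S / ip d S S)"
  have "c * ip d S S = 2 * ip d x S" using False by (simp add: c_def)
  moreover have "refl_axis d S x = (\<lambda>k\<in>{..<d}. c * S k - x k)" by (simp add: refl_axis_def c_def)
  ultimately show ?thesis by (simp add: ip_linear)
qed

lemma ip_refl_axis_refl_axis: "ip d (refl_axis d S x) (refl_axis d S x) = ip d x x"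
proof -
  define c where "c = 2 * (ip d x S / ip d S S)"
  have r: "refl_axis d S x = (\<lambda>k\<in>{..<d}. c * S k - x k)" by (simp add: refl_axis_def c_def)
  have "ip d (refl_axis d S x) (refl_axis d S x) = c * ip d (refl_axis d S x) S - ip d (refl_axis d S x) x"
    by (subst (2) r) (simp add: ip_linear)
  also have "\<dots> = c * ip d x S - (c * ip d S x - ip d x x)"
    unfolding ip_refl_axis_axis by (simp add: r ip_linear)
  finally show ?thesis by (simp add: ip_commute[of d S x])
qed

lemma nn_integral_gauss_vec_uminus:
  assumes f[measurable]: "f \<in> borel_measurable (vec_space d)"
  shows "(\<integral>\<^sup>+x. f (\<lambda>k\<in>{..<d}. - x k) \<partial>gauss_vec d) = (\<integral>\<^sup>+x. f x \<partial>gauss_vec d)"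
proof -
  have 1: "distr std_gauss borel uminus = std_gauss"
  proof -
    have "distr std_gauss borel uminus = density (distr lborel borel uminus) (\<lambda>x. ennreal (std_normal_density x))"
      by (subst density_distr) (auto simp: normal_density_def)
    then show ?thesis by (simp add: lborel_distr_uminus)
  qed
  have 2: "distr std_gauss std_gauss uminus = std_gauss"
    using 1 by (metis distr_cong sets_density sets_lborel)
  have "distr (gauss_vec d) (gauss_vec d) (compose {..<d} uminus) = gauss_vec d"
    unfolding gauss_vec_def
    by (subst distr_PiM_finite_prob_space'[where M'="\<lambda>_. std_gauss"])
      (simp_all add: 2 std_gauss.prob_space_axioms)
  then have "(\<integral>\<^sup>+x. f x \<partial>gauss_vec d) = (\<integral>\<^sup>+x. f x \<partial>distr (gauss_vec d) (gauss_vec d) (compose {..<d} uminus))"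
    by simp
  also have "\<dots> = (\<integral>\<^sup>+x. f (compose {..<d} uminus x) \<partial>gauss_vec d)"
    unfolding compose_def by (intro nn_integral_distr) measurable
  finally show ?thesis by (simp add: compose_def)
qed

text \<open>\<open>refl_axis\<close> is minus the Householder reflection in the hyperplane
  orthogonal to S. The latter preserves Lebesgue measure and the norm, hence the Gaussian law, and
  so does the sign change; for S = 0 only the sign change remains.\<close>

lemma nn_integral_gauss_vec_refl_axis:
  assumes f[measurable]: "f \<in> borel_measurable (vec_space d)"
  shows "(\<integral>\<^sup>+x. f (refl_axis d S x) \<partial>gauss_vec d) = (\<integral>\<^sup>+x. f x \<partial>gauss_vec d)"
proof (cases "ip d S S = 0")
  case True
  then have "refl_axis d S = (\<lambda>x. \<lambda>k\<in>{..<d}. - x k)" by (simp add: refl_axis_def fun_eq_iff)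
  then show ?thesis by (simp add: nn_integral_gauss_vec_uminus)
next
  case False
  then have pos: "0 < ip d S S" using ip_self_nonneg[of d S] by simp
  define w where "w k = S k / sqrt (ip d S S)" for k
  define H where "H x = (\<lambda>k\<in>{..<d}. x k - 2 * (\<Sum>j<d. x j * w j) * w k)" for x
  have w1: "(\<Sum>k<d. (w k)\<^sup>2) = 1"
    using pos by (simp add: w_def power_divide sum_divide_distrib[symmetric])
      (simp add: ip_def power2_eq_square)
  have Heq: "H x = (\<lambda>k\<in>{..<d}. - refl_axis d S x k)" for x
  proof -
    have "(\<Sum>j<d. x j * w j) = ip d x S / sqrt (ip d S S)"
      by (simp add: w_def ip_def sum_divide_distrib)
    moreover have "ip d x S / sqrt (ip d S S) * (S k / sqrt (ip d S S)) = ip d x S / ip d S S * S k" for k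
      using pos by simp
    ultimately show ?thesis
      by (auto simp: H_def refl_axis_def fun_eq_iff w_def)
  qed
  have Hm[measurable]: "H \<in> measurable (vec_space d) (vec_space d)"
    unfolding H_def w_def by measurable
  have ipH: "ip d (H x) (H x) = ip d x x" for x
    unfolding Heq by (simp add: ip_linear ip_refl_axis_refl_axis)
  have main: "(\<integral>\<^sup>+x. f (H x) \<partial>gauss_vec d) = (\<integral>\<^sup>+x. f x \<partial>gauss_vec d)"
    if f[measurable]: "f \<in> borel_measurable (vec_space d)" for f
  proof -
    let ?F = "\<lambda>x. ennreal ((1 / sqrt (2 * pi)) ^ d * exp (- ip d x x / 2)) * f x"
    have Fm: "?F \<in> borel_measurable (PiM {..<d} (\<lambda>_. borel))"
      unfolding vec_space_def[symmetric] by measurable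
    have "(\<integral>\<^sup>+x. f (H x) \<partial>gauss_vec d) = (\<integral>\<^sup>+x. ?F (H x) \<partial>PiM {..<d} (\<lambda>_. lborel))"
      unfolding ipH by (rule nn_integral_gauss_vec) measurable
    also have "\<dots> = (\<integral>\<^sup>+x. ?F x \<partial>PiM {..<d} (\<lambda>_. lborel))"
      unfolding H_def by (rule nn_integral_PiM_lborel_reflect[OF _ w1 Fm]) simp
    also have "\<dots> = (\<integral>\<^sup>+x. f x \<partial>gauss_vec d)"
      by (rule nn_integral_gauss_vec[symmetric]) measurable
    finally show ?thesis .
  qed
  have rH: "refl_axis d S x = (\<lambda>k\<in>{..<d}. - H x k)" for x
    unfolding Heq by (auto simp: refl_axis_def fun_eq_iff)
  have [measurable]: "(\<lambda>x. (\<lambda>k\<in>{..<d}. - x k)) \<in> measurable (vec_space d) (vec_space d)"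
    by measurable
  have "(\<integral>\<^sup>+x. f (refl_axis d S x) \<partial>gauss_vec d) = (\<integral>\<^sup>+x. f (\<lambda>k\<in>{..<d}. - x k) \<partial>gauss_vec d)"
    unfolding rH by (rule main[of "\<lambda>x. f (\<lambda>k\<in>{..<d}. - x k)"]) measurable
  then show ?thesis by (simp add: nn_integral_gauss_vec_uminus)
qed

section \<open>The uniform law on the sphere\<close>

definition sphere_proj :: "nat \<Rightarrow> real \<Rightarrow> (nat \<Rightarrow> real) \<Rightarrow> nat \<Rightarrow> real" where
  "sphere_proj d R g = (\<lambda>j\<in>{..<d}. R / sqrt (ip d g g) * g j)"

lemma sphere_proj_measurable [measurable]: "sphere_proj d R \<in> measurable (vec_space d) (vec_space d)"
  unfolding sphere_proj_def by measurable

lemma sphere_unif_eq: "sphere_unif d R = distr (gauss_vec d) (vec_space d) (sphere_proj d R)"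
  unfolding sphere_unif_def sphere_proj_def by (simp add: ip_def power2_eq_square)

lemma sets_sphere_unif [measurable_cong]: "sets (sphere_unif d R) = sets (vec_space d)"
  by (simp add: sphere_unif_eq)

interpretation sphere_unif: prob_space "sphere_unif d R"
  unfolding sphere_unif_eq by (rule gauss_vec.prob_space_distr) measurable

text \<open>Division by zero sends g = 0 to the zero vector. Keeping norm 0 as an admissible case
  avoids showing that g is almost surely nonzero; later bounds at a fixed \<mu> accept it.\<close>

lemma AE_sphere_unif_norm: "AE \<mu> in sphere_unif d R. ip d \<mu> \<mu> = 0 \<or> ip d \<mu> \<mu> = R\<^sup>2"
proof -
  have "ip d (sphere_proj d R g) (sphere_proj d R g) = 0 \<or> ip d (sphere_proj d R g) (sphere_proj d R g) = R\<^sup>2" for g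
  proof -
    have "ip d (sphere_proj d R g) (sphere_proj d R g) = (R / sqrt (ip d g g))\<^sup>2 * ip d g g"
      unfolding sphere_proj_def ip_restrict ip_linear by (simp add: power2_eq_square)
    then show ?thesis
      using ip_self_nonneg[of d g] by (cases "ip d g g = 0") (auto simp: power_divide)
  qed
  then show ?thesis
    unfolding sphere_unif_eq by (subst AE_distr_iff) auto
qed

text \<open>A linear isometry commutes with g -> R g / |g|, so invariance is inherited from the
  Gaussian law.\<close>

lemma nn_integral_sphere_unif_refl_axis:
  assumes f[measurable]: "f \<in> borel_measurable (vec_space d)" and S: "S \<in> space (vec_space d)"
  shows "(\<integral>\<^sup>+\<mu>. f (refl_axis d S \<mu>) \<partial>sphere_unif d R) = (\<integral>\<^sup>+\<mu>. f \<mu> \<partial>sphere_unif d R)"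
proof -
  have rm[measurable]: "refl_axis d S \<in> measurable (vec_space d) (vec_space d)"
    using S by measurable
  have comm: "refl_axis d S (sphere_proj d R g) = sphere_proj d R (refl_axis d S g)" for g
  proof -
    have "refl_axis d S (\<lambda>j\<in>{..<d}. c * g j) = (\<lambda>j\<in>{..<d}. c * refl_axis d S g j)" for c
      by (auto simp: refl_axis_def ip_linear fun_eq_iff algebra_simps)
    then show ?thesis unfolding sphere_proj_def ip_refl_axis_refl_axis .
  qed
  have "(\<integral>\<^sup>+\<mu>. f (refl_axis d S \<mu>) \<partial>sphere_unif d R) = (\<integral>\<^sup>+g. f (refl_axis d S (sphere_proj d R g)) \<partial>gauss_vec d)"
    unfolding sphere_unif_eq by (rule nn_integral_distr) measurable
  also have "\<dots> = (\<integral>\<^sup>+g. f (sphere_proj d R g) \<partial>gauss_vec d)"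
    unfolding comm by (rule nn_integral_gauss_vec_refl_axis) measurable
  also have "\<dots> = (\<integral>\<^sup>+\<mu>. f \<mu> \<partial>sphere_unif d R)"
    unfolding sphere_unif_eq by (rule nn_integral_distr[symmetric]) measurable
  finally show ?thesis .
qed

section \<open>Sums of independent Gaussian vectors\<close>

lemma nn_integral_std_gauss_scale:
  assumes f[measurable]: "f \<in> borel_measurable borel" and s: "s \<noteq> 0"
  shows "(\<integral>\<^sup>+x. f (s * x) \<partial>std_gauss) = (\<integral>\<^sup>+u. ennreal (normal_density 0 \<bar>s\<bar> u) * f u \<partial>lborel)"
proof -
  have e: "\<bar>s\<bar> * normal_density 0 \<bar>s\<bar> (s * x) = std_normal_density x" for x
    using s by (simp add: normal_density_def power_mult_distrib real_sqrt_mult)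
  have "(\<integral>\<^sup>+u. ennreal (normal_density 0 \<bar>s\<bar> u) * f u \<partial>lborel)
     = ennreal \<bar>s\<bar> * (\<integral>\<^sup>+x. ennreal (normal_density 0 \<bar>s\<bar> (s * x)) * f (s * x) \<partial>lborel)"
    by (subst nn_integral_real_affine[where c=s and t=0]) (use s in auto)
  also have "\<dots> = (\<integral>\<^sup>+x. ennreal \<bar>s\<bar> * (ennreal (normal_density 0 \<bar>s\<bar> (s * x)) * f (s * x)) \<partial>lborel)"
    by (rule nn_integral_cmult[symmetric]) measurable
  also have "\<dots> = (\<integral>\<^sup>+x. ennreal (std_normal_density x) * f (s * x) \<partial>lborel)"
    unfolding e[symmetric] by (simp add: ennreal_mult mult.assoc)
  also have "\<dots> = (\<integral>\<^sup>+x. f (s * x) \<partial>std_gauss)"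
    by (rule nn_integral_density[symmetric]) measurable
  finally show ?thesis by simp
qed

lemma nn_integral_std_gauss_add:
  assumes f[measurable]: "f \<in> borel_measurable borel" and t: "t \<noteq> 0"
  shows "(\<integral>\<^sup>+x. \<integral>\<^sup>+y. f (s * x + t * y) \<partial>std_gauss \<partial>std_gauss) = (\<integral>\<^sup>+z. f (sqrt (s\<^sup>2 + t\<^sup>2) * z) \<partial>std_gauss)"
proof (cases "s = 0")
  case True
  then show ?thesis
    using t std_gauss.emeasure_space_1
    by (simp add: nn_integral_std_gauss_scale[OF f] real_sqrt_abs)
next
  case False
  let ?n = "\<lambda>s x. ennreal (normal_density 0 \<bar>s\<bar> x)"
  have "(\<integral>\<^sup>+x. \<integral>\<^sup>+y. f (s * x + t * y) \<partial>std_gauss \<partial>std_gauss)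
      = (\<integral>\<^sup>+x. \<integral>\<^sup>+v. ?n t v * f (s * x + v) \<partial>lborel \<partial>std_gauss)"
    by (intro nn_integral_cong nn_integral_std_gauss_scale t) measurable
  also have "\<dots> = (\<integral>\<^sup>+u. ?n s u * (\<integral>\<^sup>+v. ?n t v * f (u + v) \<partial>lborel) \<partial>lborel)"
    by (rule nn_integral_std_gauss_scale[OF _ False]) measurable
  also have "\<dots> = (\<integral>\<^sup>+u. ?n s u * (\<integral>\<^sup>+w. ?n t (w - u) * f w \<partial>lborel) \<partial>lborel)"
  proof (rule nn_integral_cong)
    fix u
    have "(\<integral>\<^sup>+v. ?n t v * f (u + v) \<partial>lborel) = (\<integral>\<^sup>+w. ?n t (w - u) * f w \<partial>lborel)"
      by (subst (2) nn_integral_real_affine[where c=1 and t=u]) simp_all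
    then show "?n s u * (\<integral>\<^sup>+v. ?n t v * f (u + v) \<partial>lborel) = ?n s u * (\<integral>\<^sup>+w. ?n t (w - u) * f w \<partial>lborel)"
      by simp
  qed
  also have "\<dots> = (\<integral>\<^sup>+u. \<integral>\<^sup>+w. ?n s u * (?n t (w - u) * f w) \<partial>lborel \<partial>lborel)"
    by (intro nn_integral_cong nn_integral_cmult[symmetric]) measurable
  also have "\<dots> = (\<integral>\<^sup>+w. \<integral>\<^sup>+u. ?n s u * (?n t (w - u) * f w) \<partial>lborel \<partial>lborel)"
    by (rule lborel_pair.Fubini'[symmetric]) measurable
  also have "\<dots> = (\<integral>\<^sup>+w. (\<integral>\<^sup>+u. ennreal (normal_density 0 \<bar>t\<bar> (w - u) * normal_density 0 \<bar>s\<bar> u) \<partial>lborel) * f w \<partial>lborel)"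
    by (subst nn_integral_multc[symmetric]) (simp_all add: ennreal_mult mult_ac)
  also have "\<dots> = (\<integral>\<^sup>+w. ?n (sqrt (s\<^sup>2 + t\<^sup>2)) w * f w \<partial>lborel)"
    using fun_cong[OF conv_normal_density_zero_mean[of "\<bar>t\<bar>" "\<bar>s\<bar>"]] False t
    by (simp add: add.commute)
  also have "\<dots> = (\<integral>\<^sup>+z. f (sqrt (s\<^sup>2 + t\<^sup>2) * z) \<partial>std_gauss)"
    by (rule nn_integral_std_gauss_scale[symmetric]) (use t in \<open>auto simp: sum_power2_eq_zero_iff\<close>)
  finally show ?thesis .
qed

lemma nn_integral_PiM_std_gauss_add:
  fixes I :: "'i set"
  assumes fin: "finite I" and f: "f \<in> borel_measurable (PiM I (\<lambda>_. borel))" and t: "t \<noteq> 0"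
  shows "(\<integral>\<^sup>+x. \<integral>\<^sup>+y. f (\<lambda>k\<in>I. s * x k + t * y k) \<partial>PiM I (\<lambda>_. std_gauss) \<partial>PiM I (\<lambda>_. std_gauss))
    = (\<integral>\<^sup>+z. f (\<lambda>k\<in>I. sqrt (s\<^sup>2 + t\<^sup>2) * z k) \<partial>PiM I (\<lambda>_. std_gauss))"
  using fin f
proof (induction I arbitrary: f rule: finite_induct)
  case empty
  then show ?case by (simp add: PiM_empty nn_integral_count_space_finite)
next
  case (insert i I)
  note insert.prems[measurable]
  let ?G = "PiM I (\<lambda>_::'i. std_gauss)"
  let ?G' = "PiM (insert i I) (\<lambda>_::'i. std_gauss)"
  let ?r = "sqrt (s\<^sup>2 + t\<^sup>2)"
  interpret I: prob_space ?G by (rule prob_space_PiM) (rule std_gauss.prob_space_axioms)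
  interpret I': prob_space ?G' by (rule prob_space_PiM) (rule std_gauss.prob_space_axioms)
  interpret P: pair_sigma_finite std_gauss ?G by standard
  have fu: "(\<lambda>a. f (w(i:=a))) \<in> borel_measurable borel" if "w \<in> extensional I" for w
    by (rule measurable_compose[OF measurable_fun_upd[where J=I] insert.prems])
       (use that in \<open>auto simp: space_PiM PiE_def\<close>)
  have u: "(\<lambda>k\<in>insert i I. s * (x(i:=a)) k + t * (y(i:=b)) k) = (\<lambda>k\<in>I. s * x k + t * y k)(i := s * a + t * b)"
    for x y :: "'i \<Rightarrow> real" and a b using insert.hyps by (auto simp: fun_eq_iff)
  have u': "(\<lambda>k\<in>insert i I. ?r * (x(i:=a)) k) = (\<lambda>k\<in>I. ?r * x k)(i := ?r * a)"
    for x :: "'i \<Rightarrow> real" and a using insert.hyps by (auto simp: fun_eq_iff)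
  have "(\<integral>\<^sup>+x. \<integral>\<^sup>+y. f (\<lambda>k\<in>insert i I. s * x k + t * y k) \<partial>?G' \<partial>?G')
     = (\<integral>\<^sup>+x. \<integral>\<^sup>+a. \<integral>\<^sup>+y. f (\<lambda>k\<in>insert i I. s * (x(i:=a)) k + t * y k) \<partial>?G' \<partial>std_gauss \<partial>?G)"
    by (rule std_gauss_prod.product_nn_integral_insert) (use insert.hyps in measurable)
  also have "\<dots> = (\<integral>\<^sup>+x. \<integral>\<^sup>+a. \<integral>\<^sup>+y. \<integral>\<^sup>+b. f (\<lambda>k\<in>insert i I. s * (x(i:=a)) k + t * (y(i:=b)) k) \<partial>std_gauss \<partial>?G \<partial>std_gauss \<partial>?G)"
    by (intro nn_integral_cong std_gauss_prod.product_nn_integral_insert) (use insert.hyps in measurable)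
  also have "\<dots> = (\<integral>\<^sup>+x. \<integral>\<^sup>+a. \<integral>\<^sup>+y. \<integral>\<^sup>+b. f ((\<lambda>k\<in>I. s * x k + t * y k)(i := s * a + t * b)) \<partial>std_gauss \<partial>?G \<partial>std_gauss \<partial>?G)"
    unfolding u ..
  also have "\<dots> = (\<integral>\<^sup>+x. \<integral>\<^sup>+y. \<integral>\<^sup>+a. \<integral>\<^sup>+b. f ((\<lambda>k\<in>I. s * x k + t * y k)(i := s * a + t * b)) \<partial>std_gauss \<partial>std_gauss \<partial>?G \<partial>?G)"
    by (intro nn_integral_cong P.Fubini'[symmetric]) measurable
  also have "\<dots> = (\<integral>\<^sup>+x. \<integral>\<^sup>+y. \<integral>\<^sup>+a. f ((\<lambda>k\<in>I. s * x k + t * y k)(i := ?r * a)) \<partial>std_gauss \<partial>?G \<partial>?G)"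
    by (intro nn_integral_cong nn_integral_std_gauss_add[OF fu t]) auto
  also have "\<dots> = (\<integral>\<^sup>+z. \<integral>\<^sup>+a. f ((\<lambda>k\<in>I. ?r * z k)(i := ?r * a)) \<partial>std_gauss \<partial>?G)"
    by (rule insert.IH) measurable
  also have "\<dots> = (\<integral>\<^sup>+z. \<integral>\<^sup>+a. f (\<lambda>k\<in>insert i I. ?r * (z(i:=a)) k) \<partial>std_gauss \<partial>?G)"
    unfolding u' ..
  also have "\<dots> = (\<integral>\<^sup>+z. f (\<lambda>k\<in>insert i I. ?r * z k) \<partial>?G')"
    by (rule std_gauss_prod.product_nn_integral_insert[symmetric]) (use insert.hyps in measurable)
  finally show ?case .
qed

lemma data_component [measurable (raw)]:
  "j \<in> J \<Longrightarrow> k < d \<Longrightarrow> (\<lambda>X. X j k) \<in> borel_measurable (PiM J (\<lambda>_. vec_space d))"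
  by (rule vec_space_component) auto

text \<open>Variances add: the summand with coefficient y i raises the variance by (y i)^2 = 1, so
  the signs leave no trace.\<close>

lemma nn_integral_gauss_vec_signed_sum:
  fixes y :: "'i \<Rightarrow> real"
  assumes fin: "finite J" and y: "\<And>j. j \<in> J \<Longrightarrow> \<bar>y j\<bar> = 1"
    and f: "f \<in> borel_measurable (vec_space d)"
  shows "(\<integral>\<^sup>+X. f (\<lambda>k\<in>{..<d}. \<Sum>j\<in>J. y j * X j k) \<partial>PiM J (\<lambda>_. gauss_vec d))
    = (\<integral>\<^sup>+u. f (\<lambda>k\<in>{..<d}. sqrt (card J) * u k) \<partial>gauss_vec d)"
  using fin y f
proof (induction J arbitrary: f rule: finite_induct)
  case empty
  then show ?case by (simp add: PiM_empty nn_integral_count_space_finite gauss_vec.emeasure_space_1)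
next
  case (insert i J)
  note insert.prems(2)[measurable]
  have "(\<lambda>p. \<lambda>k\<in>{..<d}. fst p k + y i * snd p k) \<in> measurable (vec_space d \<Otimes>\<^sub>M gauss_vec d) (vec_space d)"
    by (intro vec_space_lambda borel_measurable_add borel_measurable_times borel_measurable_const
        vec_space_component[OF measurable_fst] vec_space_component[of snd]) measurable
  then have "(\<lambda>p. f (\<lambda>k\<in>{..<d}. fst p k + y i * snd p k)) \<in> borel_measurable (vec_space d \<Otimes>\<^sub>M gauss_vec d)"
    by measurable
  then have am: "(\<lambda>a. \<integral>\<^sup>+ x. f (\<lambda>k\<in>{..<d}. a k + y i * x k) \<partial>gauss_vec d) \<in> borel_measurable (vec_space d)"
    by (intro gauss_vec.borel_measurable_nn_integral) (simp add: case_prod_beta')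
  have e: "(\<lambda>k\<in>{..<d}. \<Sum>j\<in>insert i J. y j * (X(i:=x)) j k)
     = (\<lambda>k\<in>{..<d}. (\<lambda>k\<in>{..<d}. \<Sum>j\<in>J. y j * X j k) k + y i * x k)" for X and x :: "nat \<Rightarrow> real"
  proof -
    have "(\<Sum>j\<in>J. y j * (X(i:=x)) j k) = (\<Sum>j\<in>J. y j * X j k)" for k
      using insert.hyps by (intro sum.cong) auto
    then show ?thesis using insert.hyps by (auto simp: fun_eq_iff)
  qed
  have "(\<integral>\<^sup>+X. f (\<lambda>k\<in>{..<d}. \<Sum>j\<in>insert i J. y j * X j k) \<partial>PiM (insert i J) (\<lambda>_. gauss_vec d))
     = (\<integral>\<^sup>+X. \<integral>\<^sup>+x. f (\<lambda>k\<in>{..<d}. \<Sum>j\<in>insert i J. y j * (X(i:=x)) j k) \<partial>gauss_vec d \<partial>PiM J (\<lambda>_. gauss_vec d))"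
    by (rule gauss_vec_prod.product_nn_integral_insert) (use insert.hyps in measurable)
  also have "\<dots> = (\<integral>\<^sup>+X. \<integral>\<^sup>+x. f (\<lambda>k\<in>{..<d}. (\<lambda>k\<in>{..<d}. \<Sum>j\<in>J. y j * X j k) k + y i * x k) \<partial>gauss_vec d \<partial>PiM J (\<lambda>_. gauss_vec d))"
    unfolding e ..
  also have "\<dots> = (\<integral>\<^sup>+u. \<integral>\<^sup>+x. f (\<lambda>k\<in>{..<d}. (\<lambda>k\<in>{..<d}. sqrt (card J) * u k) k + y i * x k) \<partial>gauss_vec d \<partial>gauss_vec d)"
    by (rule insert.IH[of "\<lambda>w. \<integral>\<^sup>+x. f (\<lambda>k\<in>{..<d}. w k + y i * x k) \<partial>gauss_vec d"])
      (use insert.prems(1) am in auto)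
  also have "\<dots> = (\<integral>\<^sup>+u. \<integral>\<^sup>+x. f (\<lambda>k\<in>{..<d}. sqrt (card J) * u k + y i * x k) \<partial>gauss_vec d \<partial>gauss_vec d)"
    by (intro nn_integral_cong arg_cong[where f=f]) auto
  also have "\<dots> = (\<integral>\<^sup>+u. f (\<lambda>k\<in>{..<d}. sqrt ((sqrt (card J))\<^sup>2 + (y i)\<^sup>2) * u k) \<partial>gauss_vec d)"
    unfolding gauss_vec_def
    by (rule nn_integral_PiM_std_gauss_add) (use insert.prems(1)[of i] insert.prems(2) in \<open>auto simp: vec_space_def\<close>)
  also have "(sqrt (card J))\<^sup>2 + (y i)\<^sup>2 = card (insert i J)"
    using insert.prems(1)[of i] insert.hyps
    by (simp add: abs_square_eq_1)
  finally show ?case .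
qed

section \<open>Moments and tails of Gaussian vectors\<close>

lemma ip_vec_measurable [measurable]: "(\<lambda>x. ip d v x) \<in> borel_measurable (vec_space d)"
proof -
  have "(\<lambda>x. ip d (restrict v {..<d}) x) \<in> borel_measurable (vec_space d)"
    by (rule ip_measurable) (auto simp: space_vec_space)
  then show ?thesis by simp
qed

lemma ip_vec_measurable' [measurable]: "(\<lambda>x. ip d x v) \<in> borel_measurable (vec_space d)"
  by (subst ip_commute) measurable

lemma ip_self_measurable [measurable]: "(\<lambda>x. ip d x x) \<in> borel_measurable (vec_space d)"
  by (rule ip_measurable) auto

lemma nn_integral_gauss_vec_exp_ip:
  "(\<integral>\<^sup>+x. ennreal (exp (ip d v x)) \<partial>gauss_vec d) = ennreal (exp (ip d v v / 2))"
proof -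
  have "1 = (\<integral>\<^sup>+x. ennreal (exp (ip d v x - ip d v v / 2)) * 1 \<partial>gauss_vec d)"
    using nn_integral_gauss_vec_shift[of "\<lambda>_. 1" d v] gauss_vec.emeasure_space_1 by simp
  then have "ennreal (exp (ip d v v / 2)) = ennreal (exp (ip d v v / 2)) * (\<integral>\<^sup>+x. ennreal (exp (ip d v x - ip d v v / 2)) \<partial>gauss_vec d)"
    by simp
  also have "\<dots> = (\<integral>\<^sup>+x. ennreal (exp (ip d v v / 2)) * ennreal (exp (ip d v x - ip d v v / 2)) \<partial>gauss_vec d)"
    by (rule nn_integral_cmult[symmetric]) measurable
  also have "\<dots> = (\<integral>\<^sup>+x. ennreal (exp (ip d v x)) \<partial>gauss_vec d)"
    by (intro nn_integral_cong) (simp add: ennreal_mult[symmetric] exp_add[symmetric])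
  finally show ?thesis by simp
qed

lemma power2_le_two_exp: "z\<^sup>2 \<le> 2 * (exp z + exp (- z))" for z :: real
proof -
  have "x\<^sup>2 \<le> 2 * exp x" if "0 \<le> x" for x :: real
    using exp_lower_Taylor_quadratic[OF that] that by simp
  from this[of z] this[of "-z"] show ?thesis
    by (cases "0 \<le> z") (simp_all add: add_increasing2 add_increasing algebra_simps)
qed

text \<open>The second moment is read off from the exponential moments at plus and minus the
  normalised m, through z^2 \<le> 2 (exp z + exp(-z)). This gives the crude factor 4 exp(1/2) \<le>
  8 instead of the exact 1, which is enough for Chebyshev bounds.\<close>

lemma nn_integral_gauss_vec_ip_power2_le:
  "(\<integral>\<^sup>+x. ennreal ((ip d m x)\<^sup>2) \<partial>gauss_vec d) \<le> ennreal (8 * ip d m m)"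
proof (cases "ip d m m = 0")
  case True
  then show ?thesis using ip_self_eq_0_left by simp
next
  case False
  then have pos: "0 < ip d m m" using ip_self_nonneg[of d m] by simp
  define v where "v k = (1 / sqrt (ip d m m)) * m k" for k
  have vv: "ip d v v = 1"
    using pos unfolding v_def ip_linear by (simp add: field_simps)
  have mm: "ip d (\<lambda>k. - v k) (\<lambda>k. - v k) = 1" using vv by (simp add: ip_linear)
  have vx: "(ip d m x)\<^sup>2 = ip d m m * (ip d v x)\<^sup>2" for x
    using pos unfolding v_def ip_linear by (simp add: power_divide)
  have "(\<integral>\<^sup>+x. ennreal ((ip d m x)\<^sup>2) \<partial>gauss_vec d)
      \<le> (\<integral>\<^sup>+x. ennreal (2 * ip d m m) * (ennreal (exp (ip d v x)) + ennreal (exp (ip d (\<lambda>k. - v k) x))) \<partial>gauss_vec d)"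
  proof (rule nn_integral_mono)
    fix x
    have "(ip d m x)\<^sup>2 \<le> 2 * ip d m m * (exp (ip d v x) + exp (ip d (\<lambda>k. - v k) x))"
      unfolding vx ip_linear using mult_left_mono[OF power2_le_two_exp[of "ip d v x"], of "ip d m m"] pos
      by (simp add: mult_ac)
    then have "ennreal ((ip d m x)\<^sup>2) \<le> ennreal (2 * ip d m m * (exp (ip d v x) + exp (ip d (\<lambda>k. - v k) x)))"
      by (rule ennreal_leI)
    also have "\<dots> = ennreal (2 * ip d m m) * (ennreal (exp (ip d v x)) + ennreal (exp (ip d (\<lambda>k. - v k) x)))"
      using pos by (simp add: ennreal_mult)
    finally show "ennreal ((ip d m x)\<^sup>2) \<le> \<dots>" .
  qed
  also have "\<dots> = ennreal (2 * ip d m m) * (ennreal (exp (1/2)) + ennreal (exp (1/2)))"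
    by (subst nn_integral_cmult, measurable, subst nn_integral_add)
       (simp_all add: nn_integral_gauss_vec_exp_ip vv mm)
  also have "\<dots> = ennreal (4 * ip d m m * exp (1/2))"
    using pos by (simp add: ennreal_plus[symmetric] ennreal_mult[symmetric] del: ennreal_plus ennreal_mult)
  also have "\<dots> \<le> ennreal (8 * ip d m m)"
  proof -
    have "(exp (1/2::real))\<^sup>2 \<le> 2\<^sup>2" using exp_le by (simp add: power2_eq_square exp_add[symmetric])
    then have "exp (1/2::real) \<le> 2" by (rule power2_le_imp_le) simp
    then show ?thesis using pos by (intro ennreal_leI) simp
  qed
  finally show ?thesis .
qed

text \<open>The weighted density is s times the density of a centred normal law with variance s^2 =
  1 / (1 + 2 l).\<close>

lemma nn_integral_std_gauss_exp_square:
  assumes "0 \<le> l"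
  shows "(\<integral>\<^sup>+x. ennreal (exp (- l * x\<^sup>2)) \<partial>std_gauss) = ennreal (1 / sqrt (1 + 2 * l))"
proof -
  define s where "s = 1 / sqrt (1 + 2 * l)"
  have s: "0 < s" "s\<^sup>2 = 1 / (1 + 2 * l)" using assms by (auto simp: s_def power_divide)
  have e: "std_normal_density x * exp (- l * x\<^sup>2) = s * normal_density 0 s x" for x
  proof -
    have "- x\<^sup>2 / 2 + - l * x\<^sup>2 = - x\<^sup>2 / (2 * s\<^sup>2)"
      using assms unfolding s(2) by (simp add: field_simps)
    then have "exp (- x\<^sup>2 / 2) * exp (- l * x\<^sup>2) = exp (- x\<^sup>2 / (2 * s\<^sup>2))"
      by (simp add: exp_add[symmetric])
    then show ?thesis using s(1) by (simp add: normal_density_def real_sqrt_mult)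
  qed
  have "(\<integral>\<^sup>+x. ennreal (exp (- l * x\<^sup>2)) \<partial>std_gauss) = (\<integral>\<^sup>+x. ennreal (std_normal_density x) * ennreal (exp (- l * x\<^sup>2)) \<partial>lborel)"
    by (rule nn_integral_density) measurable
  also have "\<dots> = (\<integral>\<^sup>+x. ennreal s * ennreal (normal_density 0 s x) \<partial>lborel)"
    using s by (simp add: ennreal_mult[symmetric] e[simplified])
  also have "\<dots> = ennreal s * (\<integral>\<^sup>+x. ennreal (normal_density 0 s x) \<partial>lborel)"
    by (rule nn_integral_cmult) measurable
  also have "(\<integral>\<^sup>+x. ennreal (normal_density 0 s x) \<partial>lborel) = 1"
    using s by (subst nn_integral_eq_integral) auto
  finally show ?thesis by (simp add: s_def)
qed

lemma gauss_vec_norm_lower_tail: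
  assumes \<eta>: "0 < \<eta>" "\<eta> \<le> 1"
  shows "emeasure (gauss_vec d) {u \<in> space (gauss_vec d). ip d u u \<le> (1 - \<eta>) * d - K} \<le> ennreal (exp (- \<eta> * K / 2))"
proof -
  \<comment> \<open>Chernoff bound with exponent l. The dimension enters as d (2 l^2 - l \<eta>),
    which vanishes for l = \<eta>/2, so the tail bound is uniform in d.\<close>
  define l where "l = \<eta> / 2"
  have l: "0 < l" "2 * l \<le> 1" using \<eta> by (auto simp: l_def)
  let ?t = "(1 - \<eta>) * d - K"
  have "(\<integral>\<^sup>+u. ennreal (exp (- l * ip d u u)) \<partial>gauss_vec d) = (\<integral>\<^sup>+u. (\<Prod>k<d. ennreal (exp (- l * (u k)\<^sup>2))) \<partial>gauss_vec d)"
    by (intro nn_integral_cong)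
       (simp add: prod_ennreal exp_sum[symmetric] ip_def sum_distrib_left sum_negf power2_eq_square)
  also have "\<dots> = (\<Prod>k<d. \<integral>\<^sup>+x. ennreal (exp (- l * x\<^sup>2)) \<partial>std_gauss)"
    unfolding gauss_vec_def by (rule std_gauss_prod.product_nn_integral_prod) auto
  also have "\<dots> = ennreal ((1 / sqrt (1 + 2 * l)) ^ d)"
    using l by (subst nn_integral_std_gauss_exp_square) (auto simp: ennreal_power)
  finally have lap: "(\<integral>\<^sup>+u. ennreal (exp (- l * ip d u u)) \<partial>gauss_vec d) = ennreal ((1 / sqrt (1 + 2 * l)) ^ d)" .
  have sq: "1 / sqrt (1 + 2 * l) \<le> exp (- l + 2 * l\<^sup>2)"
  proof -
    have "2 * l - (2 * l)\<^sup>2 \<le> ln (1 + 2 * l)" using l by (intro ln_one_plus_pos_lower_bound) auto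
    then have "l - 2 * l\<^sup>2 \<le> ln (sqrt (1 + 2 * l))" using l by (simp add: ln_sqrt power_mult_distrib)
    then have "exp (l - 2 * l\<^sup>2) \<le> sqrt (1 + 2 * l)" using l by (simp add: ln_ge_iff)
    then have "inverse (sqrt (1 + 2 * l)) \<le> inverse (exp (l - 2 * l\<^sup>2))" using l by (intro le_imp_inverse_le) auto
    then show ?thesis by (simp add: exp_minus[symmetric] divide_inverse)
  qed
  have "emeasure (gauss_vec d) {u \<in> space (gauss_vec d). ip d u u \<le> ?t}
     = (\<integral>\<^sup>+u. indicator {u \<in> space (gauss_vec d). ip d u u \<le> ?t} u \<partial>gauss_vec d)"
    by (rule nn_integral_indicator[symmetric]) measurable
  also have "\<dots> \<le> (\<integral>\<^sup>+u. ennreal (exp (l * ?t)) * ennreal (exp (- l * ip d u u)) \<partial>gauss_vec d)"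
  proof (rule nn_integral_mono)
    fix u
    show "indicator {u \<in> space (gauss_vec d). ip d u u \<le> ?t} u \<le> ennreal (exp (l * ?t)) * ennreal (exp (- l * ip d u u))"
    proof (cases "ip d u u \<le> ?t")
      case True
      then have "l * ip d u u \<le> l * ?t" using l by (intro mult_left_mono) auto
      then have "ennreal 1 \<le> ennreal (exp (l * ?t) * exp (- l * ip d u u))"
        by (intro ennreal_leI) (simp add: exp_add[symmetric])
      then show ?thesis by (simp add: ennreal_mult indicator_def)
    qed simp
  qed
  also have "\<dots> = ennreal (exp (l * ?t)) * ennreal ((1 / sqrt (1 + 2 * l)) ^ d)"
    unfolding lap[symmetric] by (rule nn_integral_cmult) measurable
  also have "\<dots> = ennreal (exp (l * ?t) * (1 / sqrt (1 + 2 * l)) ^ d)"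
    by (rule ennreal_mult'[symmetric]) simp
  also have "\<dots> \<le> ennreal (exp (l * ?t) * (exp (- l + 2 * l\<^sup>2)) ^ d)"
    using sq l by (intro ennreal_leI mult_left_mono power_mono) auto
  also have "exp (l * ?t) * (exp (- l + 2 * l\<^sup>2)) ^ d = exp (- \<eta> * K / 2)"
    unfolding exp_of_nat_mult[symmetric] exp_add[symmetric]
    by (simp add: l_def algebra_simps power2_eq_square)
  finally show ?thesis .
qed

text \<open>Deterministic core of the concentration of |p|^2. With w = s \<mu> + u, the letters
  stand for r = |\<mu>|^2, g = <\<mu>,u>, U = |u|^2, D = d and s = sqrt N for N samples; the
  conclusion is <\<mu>,w>^2 \<le> v0 |w|^2.\<close>

lemma tilted_projection_bound:
  fixes r s g U v0 \<eta> D :: real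
  assumes \<eta>: "0 < \<eta>" "\<eta> < 1" and s: "0 < s" and r: "0 < r" and v0: "0 \<le> v0"
    and big: "1024 \<le> \<eta>\<^sup>2 * (s\<^sup>2 * r)"
    and v: "s\<^sup>2 * r\<^sup>2 * (1 + \<eta>)\<^sup>2 \<le> v0 * ((1 - \<eta>) * (D + s\<^sup>2 * r))"
    and g: "g\<^sup>2 \<le> 64 * r" and U: "(1 - \<eta>) * D - 6 / \<eta> \<le> U"
  shows "(g + s * r)\<^sup>2 \<le> v0 * (U + 2 * s * g + s\<^sup>2 * r)"
proof -
  \<comment> \<open>In terms of p = sqrt r, \<open>big\<close> reads 32 \<le> \<eta> s p. Then |g|
    \<le> 8 p is at most \<eta> s r, the cross term 2 s g is at most half of \<eta> s^2 r in size,
    and 6/\<eta> is at most the other half.\<close>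
  define p where "p = sqrt r"
  have p: "0 < p" "r = p\<^sup>2" using r by (auto simp: p_def)
  have "32\<^sup>2 \<le> (\<eta> * (s * p))\<^sup>2" using big by (simp add: p power_mult_distrib)
  then have b: "32 \<le> \<eta> * (s * p)" using \<eta> s p by (elim power2_le_imp_le) simp
  have "\<bar>g\<bar>\<^sup>2 \<le> (8 * p)\<^sup>2" using g p(2) by (simp add: power_mult_distrib)
  then have "\<bar>g\<bar> \<le> 8 * p" by (rule power2_le_imp_le) (use p in simp)
  then have g1: "- (8 * p) \<le> g" "g \<le> 8 * p" by auto
  have "8 * p \<le> \<eta> * (s * p) * p" using b p by (intro mult_right_mono) auto
  also have "\<eta> * (s * p) * p = \<eta> * (s * r)" by (simp add: p power2_eq_square)
  finally have gs: "\<bar>g\<bar> \<le> \<eta> * (s * r)" using g1 by linarith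
  have "\<bar>g + s * r\<bar> \<le> s * r * (1 + \<eta>)" using gs abs_triangle_ineq[of g "s * r"] s r by (simp add: algebra_simps)
  then have "(g + s * r)\<^sup>2 \<le> (s * r * (1 + \<eta>))\<^sup>2" by (metis abs_ge_zero power2_abs power_mono)
  also have "\<dots> \<le> v0 * ((1 - \<eta>) * (D + s\<^sup>2 * r))" using v by (simp add: power_mult_distrib)
  also have "\<dots> \<le> v0 * (U + 2 * s * g + s\<^sup>2 * r)"
  proof (intro mult_left_mono v0)
    have "32 * (s * p) \<le> \<eta> * (s * p) * (s * p)" using b s p by (intro mult_right_mono) auto
    then have 1: "16 * (s * p) \<le> \<eta> * (s\<^sup>2 * r) / 2" by (simp add: p power2_eq_square mult_ac)
    have "s * g \<ge> s * (- (8 * p))" using g1 s by (intro mult_left_mono) auto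
    then have 2: "- (16 * (s * p)) \<le> 2 * s * g" by (simp add: mult_ac)
    have "12 \<le> \<eta> * (\<eta> * (s\<^sup>2 * r))" using big by (simp add: power2_eq_square mult_ac)
    then have "6 / \<eta> \<le> \<eta> * (s\<^sup>2 * r) / 2" using \<eta> by (simp add: field_simps)
    then show "(1 - \<eta>) * (D + s\<^sup>2 * r) \<le> U + 2 * s * g + s\<^sup>2 * r"
      using 1 2 U by (simp add: algebra_simps)
  qed
  finally show ?thesis .
qed

lemma gauss_vec_projection_prob:
  fixes s v0 \<eta> :: real
  assumes \<eta>: "0 < \<eta>" "\<eta> < 1" and s: "0 < s" and v0: "0 \<le> v0"
    and big: "ip d \<mu> \<mu> \<noteq> 0 \<Longrightarrow> 1024 \<le> \<eta>\<^sup>2 * (s\<^sup>2 * ip d \<mu> \<mu>)"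
    and v: "s\<^sup>2 * (ip d \<mu> \<mu>)\<^sup>2 * (1 + \<eta>)\<^sup>2 \<le> v0 * ((1 - \<eta>) * (d + s\<^sup>2 * ip d \<mu> \<mu>))"
  shows "ennreal (1/2) \<le> emeasure (gauss_vec d) {u \<in> space (gauss_vec d).
     (ip d \<mu> (\<lambda>k. s * \<mu> k + u k))\<^sup>2 \<le> v0 * ip d (\<lambda>k. s * \<mu> k + u k) (\<lambda>k. s * \<mu> k + u k)}" (is "_ \<le> emeasure _ ?G")
proof (cases "ip d \<mu> \<mu> = 0")
  case True
  then have "?G = space (gauss_vec d)"
    using v0 ip_self_eq_0_left[OF True] ip_self_nonneg by auto
  then show ?thesis
    using gauss_vec.emeasure_space_1[of d] ennreal_leI[of "1/2" 1] by simp
next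
  case False
  define r where "r = ip d \<mu> \<mu>"
  have r: "0 < r" using False ip_self_nonneg[of d \<mu>] by (simp add: r_def)
  \<comment> \<open>Each bad event has probability at most 1/8: for \<open>?A\<close> by Chebyshev,
    8 r / (64 r); for \<open>?B\<close> the offset 6/\<eta> makes the Chernoff bound exp(-3).
    Outside both, the deterministic bound applies.\<close>
  let ?A = "{u \<in> space (gauss_vec d). 64 * r < (ip d \<mu> u)\<^sup>2}"
  let ?B = "{u \<in> space (gauss_vec d). ip d u u \<le> (1 - \<eta>) * d - 6 / \<eta>}"
  have e1: "ip d \<mu> (\<lambda>k. s * \<mu> k + u k) = ip d \<mu> u + s * r" for u by (simp add: ip_linear r_def)
  have e2: "ip d (\<lambda>k. s * \<mu> k + u k) (\<lambda>k. s * \<mu> k + u k) = ip d u u + 2 * s * ip d \<mu> u + s\<^sup>2 * r" for u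
    by (simp add: ip_linear r_def ip_commute[of d u \<mu>] power2_eq_square algebra_simps)
  have G: "?G \<in> sets (gauss_vec d)" unfolding e1 e2 by measurable
  have A: "?A \<in> sets (gauss_vec d)" and B: "?B \<in> sets (gauss_vec d)" by measurable
  have sub: "space (gauss_vec d) - ?G \<subseteq> ?A \<union> ?B"
  proof
    fix u assume u: "u \<in> space (gauss_vec d) - ?G"
    show "u \<in> ?A \<union> ?B"
    proof (rule ccontr)
      assume "u \<notin> ?A \<union> ?B"
      then have "(ip d \<mu> u)\<^sup>2 \<le> 64 * r" "(1 - \<eta>) * d - 6 / \<eta> \<le> ip d u u" using u by auto
      from tilted_projection_bound[OF \<eta> s r v0 _ _ this] big[OF False] v u
      show False unfolding e1 e2 by (simp add: r_def)
    qed
  qed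
  have "ennreal (64 * r) * emeasure (gauss_vec d) ?A \<le> (\<integral>\<^sup>+u. ennreal ((ip d \<mu> u)\<^sup>2) \<partial>gauss_vec d)"
  proof -
    have "ennreal (64 * r) * emeasure (gauss_vec d) ?A = (\<integral>\<^sup>+u. ennreal (64 * r) * indicator ?A u \<partial>gauss_vec d)"
      by (rule nn_integral_cmult_indicator[symmetric, OF A])
    also have "\<dots> \<le> (\<integral>\<^sup>+u. ennreal ((ip d \<mu> u)\<^sup>2) \<partial>gauss_vec d)"
      by (intro nn_integral_mono) (auto simp: indicator_def intro!: ennreal_leI)
    finally show ?thesis .
  qed
  also have "\<dots> \<le> ennreal (8 * r)" unfolding r_def by (rule nn_integral_gauss_vec_ip_power2_le)
  finally have "64 * r * gauss_vec.prob d ?A \<le> 8 * r"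
    using r by (simp add: gauss_vec.emeasure_eq_measure ennreal_mult[symmetric] del: ennreal_mult)
  then have pA: "gauss_vec.prob d ?A \<le> 1/8" using r by simp
  have "(2::real)^3 \<le> exp 1 ^ 3" using exp_ge_add_one_self[of 1] by (intro power_mono) auto
  then have "8 \<le> exp (3::real)" by (simp add: exp_of_nat_mult[symmetric])
  then have "exp (- 3::real) \<le> 1/8" by (simp add: exp_minus field_simps)
  then have "emeasure (gauss_vec d) ?B \<le> ennreal (1/8)"
    using gauss_vec_norm_lower_tail[of \<eta> d "6 / \<eta>"] \<eta>
    by (auto intro: order_trans ennreal_leI)
  then have pB: "gauss_vec.prob d ?B \<le> 1/8"
    by (simp add: gauss_vec.emeasure_eq_measure)
  have "gauss_vec.prob d (space (gauss_vec d) - ?G) \<le> gauss_vec.prob d (?A \<union> ?B)"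
    using sub A B by (intro gauss_vec.finite_measure_mono) auto
  also have "\<dots> \<le> gauss_vec.prob d ?A + gauss_vec.prob d ?B"
    using A B by (rule measure_Un_le)
  finally have "1/2 \<le> gauss_vec.prob d ?G"
    using pA pB gauss_vec.prob_compl[OF G] by simp
  then show ?thesis unfolding gauss_vec.emeasure_eq_measure by (rule ennreal_leI)
qed

lemma projection_event_measurable:
  fixes v0 :: real
  shows "(indicator {w. (ip d \<mu> w)\<^sup>2 \<le> v0 * ip d w w} :: _ \<Rightarrow> ennreal) \<in> borel_measurable (vec_space d)"
proof (rule borel_measurable_indicator')
  have 1: "(\<lambda>w. (ip d \<mu> w)\<^sup>2) \<in> borel_measurable (vec_space d)"
    and 2: "(\<lambda>w. v0 * ip d w w) \<in> borel_measurable (vec_space d)" by measurable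
  show "{x \<in> space (vec_space d). x \<in> {w. (ip d \<mu> w)\<^sup>2 \<le> v0 * ip d w w}} \<in> sets (vec_space d)"
    using borel_measurable_le[OF 1 2] by simp
qed

definition signed_sum :: "nat \<Rightarrow> ('i \<Rightarrow> real) \<Rightarrow> 'i set \<Rightarrow> ('i \<Rightarrow> nat \<Rightarrow> real) \<Rightarrow> nat \<Rightarrow> real" where
  "signed_sum d y J X = (\<lambda>k\<in>{..<d}. \<Sum>j\<in>J. y j * X j k)"

text \<open>The exponential weight is the likelihood of the samples in J given \<mu>. So this is the
  probability, under the mixture model itself, that the component of \<mu> along S has squared norm
  at most v0.\<close>

lemma nn_integral_tilted_projection:
  fixes y :: "'i \<Rightarrow> real" and v0 \<eta> :: real
  assumes J: "finite J" "J \<noteq> {}" and y: "\<And>j. j \<in> J \<Longrightarrow> \<bar>y j\<bar> = 1"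
    and \<eta>: "0 < \<eta>" "\<eta> < 1" and v0: "0 \<le> v0"
    and big: "ip d \<mu> \<mu> \<noteq> 0 \<Longrightarrow> 1024 \<le> \<eta>\<^sup>2 * (card J * ip d \<mu> \<mu>)"
    and v: "card J * (ip d \<mu> \<mu>)\<^sup>2 * (1 + \<eta>)\<^sup>2 \<le> v0 * ((1 - \<eta>) * (d + card J * ip d \<mu> \<mu>))"
  shows "ennreal (1/2) \<le> (\<integral>\<^sup>+X. ennreal (exp (ip d \<mu> (signed_sum d y J X) - card J * ip d \<mu> \<mu> / 2))
       * indicator {w. (ip d \<mu> w)\<^sup>2 \<le> v0 * ip d w w} (signed_sum d y J X) \<partial>PiM J (\<lambda>_. gauss_vec d))"
proof -
  define N where "N = real (card J)"
  have N: "0 < N" using J by (simp add: N_def card_gt_0_iff)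
  let ?I = "indicator {w. (ip d \<mu> w)\<^sup>2 \<le> v0 * ip d w w} :: _ \<Rightarrow> ennreal"
  have Im: "?I \<in> borel_measurable (vec_space d)"
    by (rule projection_event_measurable)
  let ?f = "\<lambda>w. ennreal (exp (ip d \<mu> w - N * ip d \<mu> \<mu> / 2)) * ?I w"
  let ?v = "\<lambda>k. sqrt N * \<mu> k"
  have "(\<integral>\<^sup>+X. ?f (signed_sum d y J X) \<partial>PiM J (\<lambda>_. gauss_vec d)) = (\<integral>\<^sup>+u. ?f (\<lambda>k\<in>{..<d}. sqrt N * u k) \<partial>gauss_vec d)"
    unfolding signed_sum_def N_def by (rule nn_integral_gauss_vec_signed_sum[OF J(1) y]) (assumption, intro borel_measurable_times_ennreal Im, measurable)
  \<comment> \<open>The sum is distributed as sqrt N times a standard vector. Both sides of the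
    event are quadratic in w, so the factor sqrt N drops out of it and survives only in the weight,
    as a shift by sqrt N \<mu>.\<close>
  also have "\<dots> = (\<integral>\<^sup>+u. ennreal (exp (ip d ?v u - ip d ?v ?v / 2)) * ?I u \<partial>gauss_vec d)"
  proof (intro nn_integral_cong)
    fix u
    have "(N * (ip d \<mu> u)\<^sup>2 \<le> N * (v0 * ip d u u)) \<longleftrightarrow> (ip d \<mu> u)\<^sup>2 \<le> v0 * ip d u u"
      using N by simp
    moreover have "v0 * (sqrt N * (sqrt N * ip d u u)) = N * (v0 * ip d u u)"
      using N by (simp add: mult.left_commute[of v0] mult.assoc[symmetric])
    ultimately have "?I (\<lambda>k\<in>{..<d}. sqrt N * u k) = ?I u"
      using N unfolding indicator_def mem_Collect_eq ip_restrict ip_linear power_mult_distrib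
      by (simp only: real_sqrt_pow2 less_imp_le)
    moreover have "ip d \<mu> (\<lambda>k\<in>{..<d}. sqrt N * u k) - N * ip d \<mu> \<mu> / 2 = ip d ?v u - ip d ?v ?v / 2"
      using N by (simp add: ip_linear)
    ultimately show "?f (\<lambda>k\<in>{..<d}. sqrt N * u k) = ennreal (exp (ip d ?v u - ip d ?v ?v / 2)) * ?I u"
      by simp
  qed
  also have "\<dots> = (\<integral>\<^sup>+u. ?I (\<lambda>k\<in>{..<d}. ?v k + u k) \<partial>gauss_vec d)"
    by (rule nn_integral_gauss_vec_shift[symmetric, OF Im])
  also have "\<dots> = (\<integral>\<^sup>+u. indicator {u \<in> space (gauss_vec d).
     (ip d \<mu> (\<lambda>k. sqrt N * \<mu> k + u k))\<^sup>2 \<le> v0 * ip d (\<lambda>k. sqrt N * \<mu> k + u k) (\<lambda>k. sqrt N * \<mu> k + u k)} u \<partial>gauss_vec d)"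
    by (intro nn_integral_cong) (simp add: indicator_def)
  also have "\<dots> = emeasure (gauss_vec d) {u \<in> space (gauss_vec d).
     (ip d \<mu> (\<lambda>k. sqrt N * \<mu> k + u k))\<^sup>2 \<le> v0 * ip d (\<lambda>k. sqrt N * \<mu> k + u k) (\<lambda>k. sqrt N * \<mu> k + u k)}"
    unfolding ip_linear by (rule nn_integral_indicator) measurable
  also have "ennreal (1/2) \<le> \<dots>"
    by (rule gauss_vec_projection_prob[OF \<eta> _ v0]) (use N big v in \<open>auto simp: N_def\<close>)
  finally show ?thesis by (simp add: N_def)
qed

section \<open>Likelihoods of the mixture model\<close>

lemma sets_PiM_gauss_vec [measurable_cong]: "sets (PiM J (\<lambda>_. gauss_vec d)) = sets (PiM J (\<lambda>_. vec_space d))"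
  by (intro sets_PiM_cong) (auto simp: sets_gauss_vec)

lemma sets_data_space: "sets (data_space n d) = sets (PiM {..<n} (\<lambda>_. gauss_vec d))"
  by (simp add: data_space_def sets_PiM_gauss_vec)

text \<open>Density of \<open>gmm_dist n d y \<mu>\<close> relative to pure noise for labels of
  absolute value 1, for which every sample mean has squared norm |\<mu>|^2. The common reference
  measure makes different labelings comparable.\<close>

definition lik :: "nat \<Rightarrow> nat \<Rightarrow> (nat \<Rightarrow> real) \<Rightarrow> (nat \<Rightarrow> real) \<Rightarrow> (nat \<Rightarrow> nat \<Rightarrow> real) \<Rightarrow> real" where
  "lik n d y \<mu> X = exp ((\<Sum>j<n. y j * ip d \<mu> (X j)) - n * ip d \<mu> \<mu> / 2)"

definition mix_lik :: "nat \<Rightarrow> nat \<Rightarrow> real \<Rightarrow> (nat \<Rightarrow> real) \<Rightarrow> (nat \<Rightarrow> nat \<Rightarrow> real) \<Rightarrow> ennreal" where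
  "mix_lik n d R y X = (\<integral>\<^sup>+\<mu>. ennreal (lik n d y \<mu> X) \<partial>sphere_unif d R)"

lemma lik_measurable [measurable]:
  assumes [measurable]: "f \<in> measurable M (vec_space d)" "g \<in> measurable M (PiM {..<n} (\<lambda>_. vec_space d))"
  shows "(\<lambda>x. lik n d y (f x) (g x)) \<in> borel_measurable M"
  unfolding lik_def by measurable

lemma signed_sum_measurable [measurable]:
  assumes [measurable]: "g \<in> measurable M (PiM I (\<lambda>_. vec_space d))" and "J \<subseteq> I"
  shows "(\<lambda>x. signed_sum d y J (g x)) \<in> measurable M (vec_space d)"
proof -
  have "(\<lambda>x. g x j) \<in> measurable M (vec_space d)" if "j \<in> J" for j
    by (rule measurable_compose[OF assms(1) measurable_component_singleton]) (use that assms(2) in auto)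
  then show ?thesis unfolding signed_sum_def
    by (intro vec_space_lambda borel_measurable_sum borel_measurable_times borel_measurable_const vec_space_component[where d=d]) auto
qed

lemma nn_integral_gmm_dist:
  assumes y: "\<And>i. i < n \<Longrightarrow> \<bar>y i\<bar> = 1" and f: "f \<in> borel_measurable (data_space n d)"
  shows "(\<integral>\<^sup>+X. f X \<partial>gmm_dist n d y \<mu>) = (\<integral>\<^sup>+X. ennreal (lik n d y \<mu> X) * f X \<partial>PiM {..<n} (\<lambda>_. gauss_vec d))"
proof -
  let ?v = "\<lambda>i k. y i * \<mu> k"
  let ?g = "\<lambda>i x. ennreal (exp (ip d (?v i) x - ip d (?v i) (?v i) / 2))"
  have D: "distr (gauss_vec d) (vec_space d) (\<lambda>z. \<lambda>j\<in>{..<d}. y i * \<mu> j + z j) = density (gauss_vec d) (?g i)" (is "?L i = ?R i") for i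
  proof (rule measure_eqI)
    show "sets (?L i) = sets (?R i)" by (simp add: sets_gauss_vec)
    fix A assume "A \<in> sets (?L i)"
    then have A: "A \<in> sets (vec_space d)" by simp
    have "emeasure (?L i) A = (\<integral>\<^sup>+x. indicator A x \<partial>?L i)"
      using A by simp
    also have "\<dots> = (\<integral>\<^sup>+z. indicator A (\<lambda>j\<in>{..<d}. ?v i j + z j) \<partial>gauss_vec d)"
    proof (rule nn_integral_distr)
      show "(\<lambda>z. \<lambda>j\<in>{..<d}. y i * \<mu> j + z j) \<in> measurable (gauss_vec d) (vec_space d)" by measurable
      show "indicator A \<in> borel_measurable (?L i)" using A by (intro borel_measurable_indicator) simp
    qed
    also have "\<dots> = (\<integral>\<^sup>+x. ?g i x * indicator A x \<partial>gauss_vec d)"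
      using A by (intro nn_integral_gauss_vec_shift) auto
    also have "\<dots> = emeasure (?R i) A"
      using A by (intro emeasure_density[symmetric]) (auto simp: sets_gauss_vec)
    finally show "emeasure (?L i) A = emeasure (?R i) A" .
  qed
  have sf: "sigma_finite_measure (density (gauss_vec d) (?g i))" for i
  proof -
    interpret p: prob_space "?R i"
      unfolding D[symmetric] by (rule gauss_vec.prob_space_distr) measurable
    show ?thesis by unfold_locales
  qed
  have "(\<integral>\<^sup>+X. f X \<partial>gmm_dist n d y \<mu>) = (\<integral>\<^sup>+X. f X \<partial>PiM {..<n} (\<lambda>i. density (gauss_vec d) (?g i)))"
    unfolding gmm_dist_def D ..
  also have "\<dots> = (\<integral>\<^sup>+X. (\<Prod>i<n. ?g i (X i)) * f X \<partial>PiM {..<n} (\<lambda>_. gauss_vec d))"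
    by (rule nn_integral_PiM_density)
       (use f in \<open>auto simp: sf gauss_vec.sigma_finite_measure_axioms measurable_cong_sets[OF sets_data_space refl]\<close>)
  also have "\<dots> = (\<integral>\<^sup>+X. ennreal (lik n d y \<mu> X) * f X \<partial>PiM {..<n} (\<lambda>_. gauss_vec d))"
  proof (intro nn_integral_cong arg_cong2[where f="(*)"] refl)
    fix X :: "nat \<Rightarrow> nat \<Rightarrow> real"
    have "ip d (?v i) (X i) - ip d (?v i) (?v i) / 2 = y i * ip d \<mu> (X i) - ip d \<mu> \<mu> / 2" if "i < n" for i
    proof -
      have "y i * (y i * ip d \<mu> \<mu>) = ip d \<mu> \<mu>"
        using y[OF that] by (auto simp: abs_if split: if_splits)
      then show ?thesis by (simp add: ip_linear)
    qed
    then have "(\<Sum>i<n. ip d (?v i) (X i) - ip d (?v i) (?v i) / 2) = (\<Sum>i<n. y i * ip d \<mu> (X i)) - n * ip d \<mu> \<mu> / 2"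
      by (simp add: sum_subtractf)
    then show "(\<Prod>i<n. ?g i (X i)) = ennreal (lik n d y \<mu> X)"
      by (simp add: prod_ennreal exp_sum[symmetric] lik_def)
  qed
  finally show ?thesis .
qed

text \<open>For every real w, exp(-t) \<le> exp(-|w|) + exp(-t) w^2 / t^2: if |w| > t, the last term
  alone is at least exp(-t). Integrate this with w = c + <p,x>, whose second moment is at most 2 c^2
  + 2 * 8 |p|^2. Where the left side is negative, \<open>ennreal\<close> makes the claim
  trivial.\<close>

lemma nn_integral_exp_abs_affine_ge:
  assumes t: "0 < t"
  shows "ennreal (exp (- t) * (1 - (2 * c\<^sup>2 + 16 * ip d p p) / t\<^sup>2))
    \<le> (\<integral>\<^sup>+x. ennreal (exp (- \<bar>c + ip d p x\<bar>)) \<partial>gauss_vec d)"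
proof -
  let ?A = "\<integral>\<^sup>+x. ennreal (exp (- \<bar>c + ip d p x\<bar>)) \<partial>gauss_vec d"
  define b where "b = exp (- t) / t\<^sup>2"
  have b: "0 \<le> b" using t by (simp add: b_def)
  define q where "q = 2 * c\<^sup>2 + 16 * ip d p p"
  have q: "0 \<le> q" using ip_self_nonneg[of d p] by (simp add: q_def)
  have sq: "(\<integral>\<^sup>+x. ennreal ((c + ip d p x)\<^sup>2) \<partial>gauss_vec d) \<le> ennreal q"
  proof -
    have "(\<integral>\<^sup>+x. ennreal ((c + ip d p x)\<^sup>2) \<partial>gauss_vec d) \<le> (\<integral>\<^sup>+x. ennreal (2 * c\<^sup>2) + 2 * ennreal ((ip d p x)\<^sup>2) \<partial>gauss_vec d)"
    proof (rule nn_integral_mono)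
      fix x
      have "(c + ip d p x)\<^sup>2 \<le> 2 * c\<^sup>2 + 2 * (ip d p x)\<^sup>2"
        using zero_le_power2[of "c - ip d p x"] by (simp add: power2_eq_square algebra_simps)
      then have "ennreal ((c + ip d p x)\<^sup>2) \<le> ennreal (2 * c\<^sup>2 + 2 * (ip d p x)\<^sup>2)" by (rule ennreal_leI)
      then show "ennreal ((c + ip d p x)\<^sup>2) \<le> ennreal (2 * c\<^sup>2) + 2 * ennreal ((ip d p x)\<^sup>2)"
        by (simp add: ennreal_mult)
    qed
    also have "\<dots> = ennreal (2 * c\<^sup>2) + 2 * (\<integral>\<^sup>+x. ennreal ((ip d p x)\<^sup>2) \<partial>gauss_vec d)"
      using gauss_vec.emeasure_space_1[of d]
      by (subst nn_integral_add) (simp_all add: nn_integral_cmult)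
    also have "\<dots> \<le> ennreal (2 * c\<^sup>2) + 2 * ennreal (8 * ip d p p)"
      by (intro add_left_mono mult_left_mono nn_integral_gauss_vec_ip_power2_le) simp
    also have "2 * ennreal (8 * ip d p p) = ennreal (16 * ip d p p)"
      using ennreal_mult''[of "8 * ip d p p" 2] ip_self_nonneg[of d p] by simp
    finally show ?thesis using ip_self_nonneg[of d p] by (simp add: q_def)
  qed
  have "ennreal (exp (- t)) = (\<integral>\<^sup>+x. ennreal (exp (- t)) \<partial>gauss_vec d)"
    using gauss_vec.emeasure_space_1[of d] by simp
  also have "\<dots> \<le> (\<integral>\<^sup>+x. ennreal (exp (- \<bar>c + ip d p x\<bar>)) + ennreal b * ennreal ((c + ip d p x)\<^sup>2) \<partial>gauss_vec d)"
  proof (rule nn_integral_mono)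
    fix x
    let ?w = "c + ip d p x"
    have "exp (- t) \<le> exp (- \<bar>?w\<bar>) + b * ?w\<^sup>2"
    proof (cases "\<bar>?w\<bar> \<le> t")
      case True
      then show ?thesis using b by (intro add_increasing2) auto
    next
      case False
      then have "t\<^sup>2 \<le> ?w\<^sup>2" using t by (metis abs_of_pos linorder_le_cases abs_le_square_iff)
      then have "b * t\<^sup>2 \<le> b * ?w\<^sup>2" using b by (intro mult_left_mono)
      moreover have "b * t\<^sup>2 = exp (- t)" using t by (simp add: b_def)
      ultimately show ?thesis using exp_ge_zero[of "- \<bar>?w\<bar>"] by linarith
    qed
    then have "ennreal (exp (- t)) \<le> ennreal (exp (- \<bar>?w\<bar>) + b * ?w\<^sup>2)" by (rule ennreal_leI)
    then show "ennreal (exp (- t)) \<le> ennreal (exp (- \<bar>?w\<bar>)) + ennreal b * ennreal (?w\<^sup>2)"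
      using b by (simp add: ennreal_mult)
  qed
  also have "\<dots> = ?A + ennreal b * (\<integral>\<^sup>+x. ennreal ((c + ip d p x)\<^sup>2) \<partial>gauss_vec d)"
    by (subst nn_integral_add) (simp_all add: nn_integral_cmult)
  also have "\<dots> \<le> ?A + ennreal b * ennreal q"
    by (intro add_left_mono mult_left_mono sq) simp
  also have "\<dots> = ?A + ennreal (b * q)" using b q by (simp add: ennreal_mult)
  finally have "ennreal (exp (- t)) - ennreal (b * q) \<le> ?A"
    by (subst ennreal_minus_le_iff) (simp add: add.commute)
  moreover have "exp (- t) * (1 - (2 * c\<^sup>2 + 16 * ip d p p) / t\<^sup>2) = exp (- t) - b * q"
    by (simp add: b_def q_def right_diff_distrib)
  ultimately show ?thesis
    using b q by (simp add: ennreal_minus)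
qed

text \<open>Shifting x by s m absorbs the factor exp(s <m,x>) at the price of exp(|m|^2/2), and
  leaves <p,x> unchanged because m is orthogonal to p.\<close>

lemma nn_integral_exp_orthogonal_ge:
  assumes t: "0 < t" and s: "\<bar>s\<bar> = 1" and orth: "ip d m p = 0"
  shows "ennreal (exp (ip d m m / 2) * (exp (- t) * (1 - (2 * c\<^sup>2 + 16 * ip d p p) / t\<^sup>2)))
    \<le> (\<integral>\<^sup>+x. ennreal (exp (s * ip d m x) * exp (- \<bar>c + s * ip d p x\<bar>)) \<partial>gauss_vec d)"
proof -
  let ?m = "\<lambda>k. s * m k" and ?p = "\<lambda>k. s * p k"
  have s2: "s * (s * z) = z" for z using s by (auto simp: abs_if split: if_splits)
  have mm: "ip d ?m ?m = ip d m m" and pp: "ip d ?p ?p = ip d p p" by (simp_all add: ip_linear s2)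
  have pm: "ip d ?p ?m = 0" using orth by (simp add: ip_linear ip_commute[of d p m])
  let ?f = "\<lambda>x. ennreal (exp (- \<bar>c + ip d ?p x\<bar>))"
  have "ennreal (exp (ip d m m / 2) * (exp (- t) * (1 - (2 * c\<^sup>2 + 16 * ip d p p) / t\<^sup>2)))
     = ennreal (exp (ip d m m / 2)) * ennreal (exp (- t) * (1 - (2 * c\<^sup>2 + 16 * ip d ?p ?p) / t\<^sup>2))"
    unfolding pp by (rule ennreal_mult') simp
  also have "\<dots> \<le> ennreal (exp (ip d m m / 2)) * (\<integral>\<^sup>+x. ?f x \<partial>gauss_vec d)"
    by (intro mult_left_mono nn_integral_exp_abs_affine_ge t) simp
  also have "(\<integral>\<^sup>+x. ?f x \<partial>gauss_vec d) = (\<integral>\<^sup>+x. ?f (\<lambda>k\<in>{..<d}. ?m k + x k) \<partial>gauss_vec d)"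
    using pm by (intro nn_integral_cong) (simp add: ip_linear(2))
  also have "\<dots> = (\<integral>\<^sup>+x. ennreal (exp (ip d ?m x - ip d ?m ?m / 2)) * ?f x \<partial>gauss_vec d)"
    by (rule nn_integral_gauss_vec_shift) measurable
  also have "ennreal (exp (ip d m m / 2)) * \<dots> = (\<integral>\<^sup>+x. ennreal (exp (ip d m m / 2)) * (ennreal (exp (ip d ?m x - ip d ?m ?m / 2)) * ?f x) \<partial>gauss_vec d)"
    by (rule nn_integral_cmult[symmetric]) measurable
  also have "\<dots> = (\<integral>\<^sup>+x. ennreal (exp (s * ip d m x) * exp (- \<bar>c + s * ip d p x\<bar>)) \<partial>gauss_vec d)"
  proof (rule nn_integral_cong)
    fix x
    have "exp (ip d m m / 2) * (exp (ip d ?m x - ip d ?m ?m / 2) * exp (- \<bar>c + ip d ?p x\<bar>)) = exp (s * ip d m x) * exp (- \<bar>c + s * ip d p x\<bar>)"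
      unfolding mm by (simp add: ip_linear exp_diff)
    then show "ennreal (exp (ip d m m / 2)) * (ennreal (exp (ip d ?m x - ip d ?m ?m / 2)) * ?f x) = ennreal (exp (s * ip d m x) * exp (- \<bar>c + s * ip d p x\<bar>))"
      by (simp add: ennreal_mult'[symmetric] del: ennreal_mult)
  qed
  finally show ?thesis .
qed

section \<open>Coupling two mixtures by the reflection\<close>

lemma lik_decomp:
  assumes "i < n"
  shows "lik n d y \<mu> X = exp (ip d \<mu> (signed_sum d y ({..<n} - {i}) X) + y i * ip d \<mu> (X i) - n * ip d \<mu> \<mu> / 2)"
proof -
  have "ip d \<mu> (signed_sum d y J X) = (\<Sum>j\<in>J. y j * ip d \<mu> (X j))" for J
    unfolding signed_sum_def ip_restrict unfolding ip_def sum_distrib_left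
    by (subst sum.swap) (simp add: mult_ac)
  then show ?thesis
    using assms by (simp add: lik_def sum.remove[of "{..<n}" i])
qed

lemma signed_sum_cong:
  "(\<And>j. j \<in> J \<Longrightarrow> y j = y' j) \<Longrightarrow> (\<And>j. j \<in> J \<Longrightarrow> X j = X' j) \<Longrightarrow> signed_sum d y J X = signed_sum d y' J X'"
  unfolding signed_sum_def by (intro restrict_ext sum.cong) auto

text \<open>The component \<open>p\<close> of \<open>\<mu>\<close> along \<open>S\<close> is fixed by the reflection and \<open>m = \<mu> - p\<close> is negated; flipping
  the label \<open>s\<close> therefore leaves the factor \<open>exp (s \<langle>m, x\<rangle>)\<close> common to both likelihoods.\<close>

lemma min_reflected_lik_ge:
  fixes P P' s :: real and d :: nat and \<mu> S x :: "nat \<Rightarrow> real"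
  assumes P: "0 < P" "0 < P'"
  defines "p \<equiv> \<lambda>k. ip d \<mu> S / ip d S S * S k"
  shows "sqrt (P * P') * (exp (s * ip d (\<lambda>k. \<mu> k - p k) x) * exp (- \<bar>(ln P - ln P') / 2 + s * ip d p x\<bar>))
     \<le> min (P * exp (s * ip d \<mu> x)) (P' * exp (- s * ip d (refl_axis d S \<mu>) x))"
proof -
  have r: "ip d (refl_axis d S \<mu>) x = 2 * ip d p x - ip d \<mu> x"
    unfolding refl_axis_def p_def by (simp only: ip_restrict ip_linear mult.assoc)
  let ?l = "(ln P - ln P') / 2" and ?m = "ip d (\<lambda>k. \<mu> k - p k) x"
  have m: "?m = ip d \<mu> x - ip d p x" by (simp add: ip_linear)
  have sq: "sqrt (P * P') = exp ((ln P + ln P') / 2)"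
  proof -
    have "ln (sqrt (P * P')) = (ln P + ln P') / 2" using P by (simp add: ln_sqrt ln_mult del: real_sqrt_mult)
    then show ?thesis using P by (metis exp_ln mult_pos_pos real_sqrt_gt_zero)
  qed
  \<comment> \<open>Both arguments of the minimum equal the same factor times exp z and exp(-z)
    respectively, with z half the total log-likelihood ratio; exp(-|z|) lies below both.\<close>
  have a: "P * exp (s * ip d \<mu> x) = sqrt (P * P') * (exp (s * ?m) * exp (?l + s * ip d p x))"
  proof -
    have "sqrt (P * P') * (exp (s * ?m) * exp (?l + s * ip d p x)) = exp (ln P + s * ip d \<mu> x)"
      unfolding sq m exp_add[symmetric] by (rule arg_cong[where f=exp]) (simp add: field_simps)
    then show ?thesis using P by (simp add: exp_add)
  qed
  have b: "P' * exp (- s * ip d (refl_axis d S \<mu>) x) = sqrt (P * P') * (exp (s * ?m) * exp (- (?l + s * ip d p x)))"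
  proof -
    have "sqrt (P * P') * (exp (s * ?m) * exp (- (?l + s * ip d p x))) = exp (ln P' + - s * ip d (refl_axis d S \<mu>) x)"
      unfolding sq m r exp_add[symmetric] by (rule arg_cong[where f=exp]) (simp add: field_simps)
    then show ?thesis using P by (simp only: exp_add exp_ln)
  qed
  show ?thesis
    unfolding a b using P
    by (intro min.boundedI mult_left_mono) auto
qed

text \<open>P and P' are the graph likelihoods of y and of the flipped labeling. Sample i is
  integrated first, with S fixed, and yields exp(-|p|^2/2) together with the loss for the log ratio;
  the remaining samples then carry exactly their own likelihood, under which |p|^2 \<le> v0 with
  probability at least 1/2.\<close>

lemma nn_integral_min_mix_lik_ge:
  fixes P P' v0 \<eta> t R :: real
  assumes i: "i < n" and n: "2 \<le> n" and y: "\<And>j. j < n \<Longrightarrow> \<bar>y j\<bar> = 1" and P: "0 < P" "0 < P'"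
    and \<eta>: "0 < \<eta>" "\<eta> < 1" and v0: "0 \<le> v0" and t: "0 < t"
    and big: "1024 \<le> \<eta>\<^sup>2 * (real (n - 1) * R\<^sup>2)"
    and v: "real (n - 1) * (R\<^sup>2)\<^sup>2 * (1 + \<eta>)\<^sup>2 \<le> v0 * ((1 - \<eta>) * (d + real (n - 1) * R\<^sup>2))"
  shows "ennreal (1/2 * (sqrt (P * P') * (exp (- v0 / 2 - t) * (1 - ((ln P - ln P')\<^sup>2 / 2 + 16 * v0) / t\<^sup>2))))
    \<le> (\<integral>\<^sup>+X. min (ennreal P * mix_lik n d R y X) (ennreal P' * mix_lik n d R (y(i := - y i)) X) \<partial>PiM {..<n} (\<lambda>_. gauss_vec d))"
proof -
  define J where "J = {..<n} - {i}"
  have J: "finite J" "i \<notin> J" "{..<n} = insert i J" "card J = n - 1" "J \<noteq> {}" "J \<subseteq> {..<n}"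
  proof -
    show c: "card J = n - 1" using i by (simp add: J_def card_Diff_singleton)
    show "J \<noteq> {}" using c n by auto
  qed (use i in \<open>auto simp: J_def\<close>)
  define y' where "y' = y(i := - y i)"
  define l where "l = (ln P - ln P') / 2"
  let ?G = "PiM {..<n} (\<lambda>_. gauss_vec d)" and ?GJ = "PiM J (\<lambda>_. gauss_vec d)"
  let ?pi = "sphere_unif d R"
  define S where "S = (\<lambda>X. signed_sum d y J X)"
  have Sm[measurable]: "S \<in> measurable (PiM {..<n} (\<lambda>_. vec_space d)) (vec_space d)"
    unfolding S_def using J(6) by (intro signed_sum_measurable[where g="\<lambda>x. x"]) auto
  \<comment> \<open>The coupled minimum: the flipped likelihood is evaluated at the reflected \<mu>.
    The reflection depends on the data only through samples other than i, so it stays fixed while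
    sample i is integrated.\<close>
  define K where "K \<mu> X = min (P * lik n d y \<mu> X) (P' * lik n d y' (refl_axis d (S X) \<mu>) X)" for \<mu> X
  have Km[measurable]: "(\<lambda>(\<mu>, X). K \<mu> X) \<in> borel_measurable (vec_space d \<Otimes>\<^sub>M PiM {..<n} (\<lambda>_. vec_space d))"
    unfolding K_def by measurable
  interpret G: prob_space ?G by (rule prob_space_PiM) (rule gauss_vec.prob_space_axioms)
  interpret GJ: prob_space ?GJ by (rule prob_space_PiM) (rule gauss_vec.prob_space_axioms)
  interpret PP: pair_sigma_finite ?pi ?G by standard
  have S_space: "S X \<in> space (vec_space d)" for X by (simp add: S_def signed_sum_def space_vec_space)
  have min_ge: "(\<integral>\<^sup>+\<mu>. ennreal (K \<mu> X) \<partial>?pi) \<le> min (ennreal P * mix_lik n d R y X) (ennreal P' * mix_lik n d R y' X)"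
    if X: "X \<in> space ?G" for X
  proof (rule min.boundedI)
    have Xs: "X \<in> space (PiM {..<n} (\<lambda>_. vec_space d))"
      using X sets_eq_imp_space_eq[OF sets_PiM_gauss_vec] by auto
    have lm: "(\<lambda>\<mu>. ennreal (lik n d z \<mu> X)) \<in> borel_measurable (vec_space d)" for z
      using Xs by measurable
    have lm': "(\<lambda>\<mu>. ennreal (lik n d z \<mu> X)) \<in> borel_measurable ?pi" for z
      using lm by (simp add: measurable_cong_sets[OF sets_sphere_unif refl])
    have mK: "ennreal (K \<mu> X) \<le> ennreal P * ennreal (lik n d y \<mu> X)"
      "ennreal (K \<mu> X) \<le> ennreal P' * ennreal (lik n d y' (refl_axis d (S X) \<mu>) X)" for \<mu>
      using P ennreal_leI[of "K \<mu> X" "P * lik n d y \<mu> X"] ennreal_leI[of "K \<mu> X" "P' * lik n d y' (refl_axis d (S X) \<mu>) X"]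
      by (simp_all only: K_def min.cobounded1 min.cobounded2 ennreal_mult' less_imp_le)
    have "(\<integral>\<^sup>+\<mu>. ennreal (K \<mu> X) \<partial>?pi) \<le> (\<integral>\<^sup>+\<mu>. ennreal P * ennreal (lik n d y \<mu> X) \<partial>?pi)"
      by (intro nn_integral_mono mK)
    also have "\<dots> = ennreal P * mix_lik n d R y X"
      unfolding mix_lik_def by (rule nn_integral_cmult[OF lm'])
    finally show "(\<integral>\<^sup>+\<mu>. ennreal (K \<mu> X) \<partial>?pi) \<le> ennreal P * mix_lik n d R y X" .
    have "(\<integral>\<^sup>+\<mu>. ennreal (K \<mu> X) \<partial>?pi) \<le> (\<integral>\<^sup>+\<mu>. ennreal P' * ennreal (lik n d y' (refl_axis d (S X) \<mu>) X) \<partial>?pi)"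
      by (intro nn_integral_mono mK)
    also have "\<dots> = (\<integral>\<^sup>+\<mu>. ennreal P' * ennreal (lik n d y' \<mu> X) \<partial>?pi)"
      by (rule nn_integral_sphere_unif_refl_axis[where f="\<lambda>\<mu>. ennreal P' * ennreal (lik n d y' \<mu> X)", OF borel_measurable_times_ennreal[OF borel_measurable_const lm] S_space])
    also have "\<dots> = ennreal P' * mix_lik n d R y' X"
      unfolding mix_lik_def by (rule nn_integral_cmult[OF lm'])
    finally show "(\<integral>\<^sup>+\<mu>. ennreal (K \<mu> X) \<partial>?pi) \<le> ennreal P' * mix_lik n d R y' X" .
  qed
  define C where "C = sqrt (P * P') * (exp (- v0 / 2 - t) * (1 - (2 * l\<^sup>2 + 16 * v0) / t\<^sup>2))"
  have fixed: "ennreal (1/2 * C) \<le> (\<integral>\<^sup>+X. ennreal (K \<mu> X) \<partial>?G)"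
    if \<mu>: "\<mu> \<in> space (vec_space d)" and r: "ip d \<mu> \<mu> = 0 \<or> ip d \<mu> \<mu> = R\<^sup>2" for \<mu>
  \<comment> \<open>A negative C becomes 0 under \<open>ennreal\<close>; the other case makes
    \<kappa> nonnegative, as monotonicity of products requires.\<close>
  proof (cases "0 \<le> C")
    case False
    then show ?thesis by (simp add: ennreal_neg)
  next
    case True
    define \<kappa> where "\<kappa> = 1 - (2 * l\<^sup>2 + 16 * v0) / t\<^sup>2"
    have \<kappa>: "0 \<le> \<kappa>"
    proof -
      have "C = sqrt (P * P') * exp (- v0 / 2 - t) * \<kappa>" by (simp add: C_def \<kappa>_def)
      moreover have "0 < sqrt (P * P') * exp (- v0 / 2 - t)" using P by simp
      ultimately show ?thesis using True by (simp only: zero_le_mult_iff) auto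
    qed
    let ?N = "real (card J)"
    let ?r = "ip d \<mu> \<mu>"
    let ?Ind = "indicator {w. (ip d \<mu> w)\<^sup>2 \<le> v0 * ip d w w} :: _ \<Rightarrow> ennreal"
    have N: "real n = ?N + 1" using n J by simp
    have KX[measurable]: "(\<lambda>X. ennreal (K \<mu> X)) \<in> borel_measurable (PiM {..<n} (\<lambda>_. vec_space d))"
      using measurable_Pair2[OF Km \<mu>] by simp
    have inner: "ennreal (exp (ip d \<mu> (S X) - ?N * ?r / 2)) * ?Ind (S X) * ennreal C
        \<le> (\<integral>\<^sup>+x. ennreal (K \<mu> (X(i := x))) \<partial>gauss_vec d)" for X
    proof (cases "(ip d \<mu> (S X))\<^sup>2 \<le> v0 * ip d (S X) (S X)")
      case False
      then show ?thesis by simp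
    next
      case good: True
      let ?S = "S X"
      define p where "p = (\<lambda>k. ip d \<mu> ?S / ip d ?S ?S * ?S k)"
      define m where "m = (\<lambda>k. \<mu> k - p k)"
      have ipS: "ip d \<mu> ?S = 0" if "ip d ?S ?S = 0"
        using ip_self_eq_0_left[OF that] ip_commute by metis
      have mup: "ip d \<mu> p = ip d p p"
        using ipS unfolding p_def ip_linear by (cases "ip d ?S ?S = 0") (auto simp: ip_commute[of d ?S \<mu>])
      have orth: "ip d m p = 0" unfolding m_def by (simp add: ip_linear mup)
      have mm: "ip d m m = ?r - ip d p p"
        unfolding m_def by (simp add: ip_linear mup ip_commute[of d p \<mu>])
      \<comment> \<open>|p|^2 = <\<mu>,S>^2 / |S|^2, so this is the good event divided by
        |S|^2.\<close>
      have V: "ip d p p \<le> v0"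
      proof (cases "ip d ?S ?S = 0")
        case True
        then show ?thesis using v0 by (simp add: p_def ip_def)
      next
        case False
        then have pos: "0 < ip d ?S ?S" using ip_self_nonneg[of d ?S] by simp
        have "ip d p p = (ip d \<mu> ?S)\<^sup>2 / ip d ?S ?S"
          using False unfolding p_def ip_linear by (simp add: power2_eq_square)
        then show ?thesis using good pos by (simp add: divide_le_eq)
      qed
      let ?E = "exp (ip d \<mu> ?S - n * ?r / 2) * sqrt (P * P')"
      have Kge: "?E * (exp (y i * ip d m x) * exp (- \<bar>l + y i * ip d p x\<bar>)) \<le> K \<mu> (X(i := x))" for x
      proof -
        have Si: "S (X(i := x)) = S X" "signed_sum d y' J (X(i := x)) = S X" "signed_sum d y J (X(i := x)) = S X"
          unfolding S_def y'_def using J(2) by (auto intro!: signed_sum_cong)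
        have 1: "lik n d y \<mu> (X(i := x)) = exp (ip d \<mu> ?S - n * ?r / 2) * exp (y i * ip d \<mu> x)"
          unfolding lik_decomp[OF i] J_def[symmetric] Si exp_add[symmetric] by simp
        have 2: "lik n d y' (refl_axis d ?S \<mu>) (X(i := x)) = exp (ip d \<mu> ?S - n * ?r / 2) * exp (- y i * ip d (refl_axis d ?S \<mu>) x)"
          unfolding lik_decomp[OF i] J_def[symmetric] Si exp_add[symmetric] ip_refl_axis_refl_axis ip_refl_axis_axis
          by (simp add: y'_def)
        have "exp (ip d \<mu> ?S - n * ?r / 2) * (sqrt (P * P') * (exp (y i * ip d m x) * exp (- \<bar>l + y i * ip d p x\<bar>)))
          \<le> exp (ip d \<mu> ?S - n * ?r / 2) * min (P * exp (y i * ip d \<mu> x)) (P' * exp (- y i * ip d (refl_axis d ?S \<mu>) x))"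
          unfolding m_def p_def l_def by (intro mult_left_mono min_reflected_lik_ge P) simp
        also have "\<dots> = K \<mu> (X(i := x))"
          unfolding K_def Si 1 2 by (simp add: min_mult_distrib_left mult_ac)
        finally show ?thesis by (simp add: mult_ac)
      qed
      have "exp (ip d \<mu> ?S - ?N * ?r / 2) * C \<le> ?E * (exp (ip d m m / 2) * (exp (- t) * (1 - (2 * l\<^sup>2 + 16 * ip d p p) / t\<^sup>2)))"
      proof -
        have k: "\<kappa> \<le> 1 - (2 * l\<^sup>2 + 16 * ip d p p) / t\<^sup>2"
          unfolding \<kappa>_def using V t by (intro diff_left_mono divide_right_mono) auto
        \<comment> \<open>By Pythagoras n |\<mu>|^2 = N |\<mu>|^2 + |m|^2 + |p|^2. The part |m|^2 is
          paid back by exp(|m|^2/2), and -|p|^2/2 \<ge> -v0/2 remains.\<close>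
        have e: "exp (ip d \<mu> ?S - ?N * ?r / 2) * exp (- v0 / 2 - t) \<le> exp (ip d \<mu> ?S - n * ?r / 2) * (exp (ip d m m / 2) * exp (- t))"
          unfolding exp_add[symmetric] mm N using V by (simp add: field_simps)
        have "(exp (ip d \<mu> ?S - ?N * ?r / 2) * exp (- v0 / 2 - t)) * (sqrt (P * P') * \<kappa>)
          \<le> (exp (ip d \<mu> ?S - n * ?r / 2) * (exp (ip d m m / 2) * exp (- t))) * (sqrt (P * P') * (1 - (2 * l\<^sup>2 + 16 * ip d p p) / t\<^sup>2))"
          by (rule mult_mono[OF e mult_left_mono[OF k]]) (use \<kappa> P in auto)
        then show ?thesis unfolding C_def \<kappa>_def by (simp only: mult_ac)
      qed
      then have "ennreal (exp (ip d \<mu> ?S - ?N * ?r / 2) * C) \<le> ennreal (?E * (exp (ip d m m / 2) * (exp (- t) * (1 - (2 * l\<^sup>2 + 16 * ip d p p) / t\<^sup>2))))"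
        by (rule ennreal_leI)
      also have "\<dots> = ennreal ?E * ennreal (exp (ip d m m / 2) * (exp (- t) * (1 - (2 * l\<^sup>2 + 16 * ip d p p) / t\<^sup>2)))"
        using P by (intro ennreal_mult') simp
      also have "\<dots> \<le> ennreal ?E * (\<integral>\<^sup>+x. ennreal (exp (y i * ip d m x) * exp (- \<bar>l + y i * ip d p x\<bar>)) \<partial>gauss_vec d)"
        by (intro mult_left_mono nn_integral_exp_orthogonal_ge t y i orth) simp
      also have "\<dots> = (\<integral>\<^sup>+x. ennreal ?E * ennreal (exp (y i * ip d m x) * exp (- \<bar>l + y i * ip d p x\<bar>)) \<partial>gauss_vec d)"
        by (rule nn_integral_cmult[symmetric]) measurable
      also have "\<dots> \<le> (\<integral>\<^sup>+x. ennreal (K \<mu> (X(i := x))) \<partial>gauss_vec d)"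
        using Kge P by (intro nn_integral_mono) (simp add: ennreal_mult'[symmetric] ennreal_leI del: ennreal_mult)
      finally show ?thesis using good by (simp add: ennreal_mult')
    qed
    have SJm[measurable]: "S \<in> measurable (PiM J (\<lambda>_. vec_space d)) (vec_space d)"
      unfolding S_def by (intro signed_sum_measurable[where g="\<lambda>x. x"]) auto
    have Im: "?Ind \<in> borel_measurable (vec_space d)"
      by (rule projection_event_measurable)
    have half: "ennreal (1/2) \<le> (\<integral>\<^sup>+X. ennreal (exp (ip d \<mu> (S X) - ?N * ?r / 2)) * ?Ind (S X) \<partial>?GJ)"
      unfolding S_def
    proof (rule nn_integral_tilted_projection[OF J(1,5) _ \<eta> v0])
      show "\<bar>y j\<bar> = 1" if "j \<in> J" for j using y that J(6) by auto
      show "1024 \<le> \<eta>\<^sup>2 * (?N * ?r)" if "?r \<noteq> 0" using big r that by (auto simp only: J(4))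
      show "?N * ?r\<^sup>2 * (1 + \<eta>)\<^sup>2 \<le> v0 * ((1 - \<eta>) * (d + ?N * ?r))"
        using r
      proof
        assume "?r = 0"
        then show ?thesis using v0 \<eta> by simp
      next
        assume "?r = R\<^sup>2"
        then show ?thesis using v by (simp only: J(4))
      qed
    qed
    have "ennreal (1/2 * C) = ennreal (1/2) * ennreal C" by (rule ennreal_mult') simp
    also have "\<dots> \<le> (\<integral>\<^sup>+X. ennreal (exp (ip d \<mu> (S X) - ?N * ?r / 2)) * ?Ind (S X) \<partial>?GJ) * ennreal C"
      by (intro mult_right_mono half) simp
    also have "\<dots> = (\<integral>\<^sup>+X. ennreal (exp (ip d \<mu> (S X) - ?N * ?r / 2)) * ?Ind (S X) * ennreal C \<partial>?GJ)"
    proof (rule nn_integral_multc[symmetric])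
      have "(\<lambda>w. ennreal (exp (ip d \<mu> w - ?N * ?r / 2)) * ?Ind w) \<in> borel_measurable (vec_space d)"
        by (intro borel_measurable_times_ennreal Im) measurable
      from measurable_compose[OF SJm this]
      show "(\<lambda>X. ennreal (exp (ip d \<mu> (S X) - ?N * ?r / 2)) * ?Ind (S X)) \<in> borel_measurable ?GJ"
        by (simp add: measurable_cong_sets[OF sets_PiM_gauss_vec refl])
    qed
    also have "\<dots> \<le> (\<integral>\<^sup>+X. \<integral>\<^sup>+x. ennreal (K \<mu> (X(i := x))) \<partial>gauss_vec d \<partial>?GJ)"
      by (intro nn_integral_mono inner)
    also have "\<dots> = (\<integral>\<^sup>+X. ennreal (K \<mu> X) \<partial>?G)"
      unfolding J(3)
      by (rule gauss_vec_prod.product_nn_integral_insert[symmetric]) (use J KX in auto)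
    finally show ?thesis .
  qed
  have "ennreal (1/2 * C) = (\<integral>\<^sup>+\<mu>. ennreal (1/2 * C) \<partial>?pi)"
    by (simp add: sphere_unif.emeasure_space_1)
  also have "\<dots> \<le> (\<integral>\<^sup>+\<mu>. \<integral>\<^sup>+X. ennreal (K \<mu> X) \<partial>?G \<partial>?pi)"
  proof (rule nn_integral_mono_AE)
    show "AE \<mu> in ?pi. ennreal (1/2 * C) \<le> (\<integral>\<^sup>+X. ennreal (K \<mu> X) \<partial>?G)"
      using AE_sphere_unif_norm[of d R] AE_space[of ?pi]
    proof eventually_elim
      case (elim \<mu>)
      then show ?case by (intro fixed) (simp_all add: sets_eq_imp_space_eq[OF sets_sphere_unif])
    qed
  qed
  also have "\<dots> = (\<integral>\<^sup>+X. \<integral>\<^sup>+\<mu>. ennreal (K \<mu> X) \<partial>?pi \<partial>?G)"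
    by (rule PP.Fubini'[symmetric]) measurable
  also have "\<dots> \<le> (\<integral>\<^sup>+X. min (ennreal P * mix_lik n d R y X) (ennreal P' * mix_lik n d R y' X) \<partial>?G)"
    by (intro nn_integral_mono min_ge)
  finally have "ennreal (1/2 * C) \<le> \<dots>" .
  moreover have "2 * l\<^sup>2 = (ln P - ln P')\<^sup>2 / 2" by (simp add: l_def power_divide)
  ultimately show ?thesis unfolding C_def y'_def by simp
qed

section \<open>The graph likelihood of a flipped label\<close>

definition labels :: "nat \<Rightarrow> (nat \<Rightarrow> real) set" where
  "labels n = PiE {..<n} (\<lambda>_. {-1, 1})"

definition edges :: "nat \<Rightarrow> (nat \<times> nat) set" where
  "edges n = {(i,j). i < j \<and> j < n}"

text \<open>Configurations are \<open>False\<close> off the edges, as under \<open>Pi_pmf\<close>.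
  The set is finite and carries every \<open>edge_pmf\<close>, so integrals over graphs become
  finite sums.\<close>

definition graphs :: "nat \<Rightarrow> (nat \<times> nat \<Rightarrow> bool) set" where
  "graphs n = PiE_dflt (edges n) False (\<lambda>_. UNIV)"

definition edge_pmf :: "nat \<Rightarrow> real \<Rightarrow> real \<Rightarrow> (nat \<Rightarrow> real) \<Rightarrow> (nat \<times> nat \<Rightarrow> bool) pmf" where
  "edge_pmf n \<alpha> \<beta> y = Pi_pmf (edges n) False (\<lambda>x. bernoulli_pmf (if y (fst x) = y (snd x) then \<alpha> else \<beta>))"

lemma edge_dist_eq: "edge_dist n \<alpha> \<beta> y = measure_pmf (edge_pmf n \<alpha> \<beta> y)"
  by (simp add: edge_dist_def edge_pmf_def edges_def case_prod_unfold)

lemma finite_edges [simp]: "finite (edges n)"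
  by (rule finite_subset[of _ "{..<n} \<times> {..<n}"]) (auto simp: edges_def)

lemma finite_graphs [simp]: "finite (graphs n)"
  unfolding graphs_def by (intro finite_PiE_dflt) auto

lemma finite_labels [simp]: "finite (labels n)"
  unfolding labels_def by (intro finite_PiE) auto

lemma labels_nonempty: "labels n \<noteq> {}"
  by (simp add: labels_def PiE_eq_empty_iff)

lemma labels_abs: "y \<in> labels n \<Longrightarrow> j < n \<Longrightarrow> \<bar>y j\<bar> = 1"
  by (auto simp: labels_def PiE_def Pi_def)

lemma labels_cases: "y \<in> labels n \<Longrightarrow> j < n \<Longrightarrow> y j = 1 \<or> y j = -1"
  by (auto simp: labels_def PiE_def Pi_def)

lemma set_edge_pmf: "set_pmf (edge_pmf n \<alpha> \<beta> y) \<subseteq> graphs n"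
  using set_Pi_pmf_subset[of "edges n" False] by (auto simp: edge_pmf_def graphs_def PiE_dflt_def)

lemma nn_integral_edge_dist:
  "(\<integral>\<^sup>+e. f e \<partial>edge_dist n \<alpha> \<beta> y) = (\<Sum>e\<in>graphs n. ennreal (pmf (edge_pmf n \<alpha> \<beta> y) e) * f e)"
  unfolding edge_dist_eq using set_edge_pmf[of n \<alpha> \<beta> y]
  by (subst nn_integral_measure_pmf_support[of "graphs n"]) (auto simp: mult.commute)

section \<open>Averages over uniform labels\<close>

lemma bij_betw_flip_labels:
  assumes "i < n"
  shows "bij_betw (\<lambda>y. y(i := - y i)) (labels n) (labels n)"
proof (rule bij_betw_byWitness[where f'="\<lambda>y. y(i := - y i)"])
  have "y(i := - y i) \<in> labels n" if "y \<in> labels n" for y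
    using that assms labels_cases[OF that] by (auto simp: labels_def PiE_def Pi_def extensional_def)
  then show "(\<lambda>y. y(i := - y i)) ` labels n \<subseteq> labels n" "(\<lambda>y. y(i := - y i)) ` labels n \<subseteq> labels n" by auto
qed auto

lemma sum_labels_flip:
  "i < n \<Longrightarrow> (\<Sum>y\<in>labels n. F (y(i := - y i))) = (\<Sum>y\<in>labels n. F y)"
  by (rule sum.reindex_bij_betw[OF bij_betw_flip_labels])

lemma sum_labels_orthogonal:
  assumes "i < n" "j < n" "i \<noteq> j"
  shows "(\<Sum>y\<in>labels n. y i * y j) = 0"
proof -
  have "(\<Sum>y\<in>labels n. y i * y j) = (\<Sum>y\<in>labels n. (y(i := - y i)) i * (y(i := - y i)) j)"
    using assms by (rule_tac sum_labels_flip[symmetric])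
  also have "\<dots> = - (\<Sum>y\<in>labels n. y i * y j)"
    using assms by (simp add: sum_negf)
  finally show ?thesis by simp
qed

text \<open>The common sign y i disappears on squaring, and distinct labels are uncorrelated under
  the uniform law, so only the diagonal terms survive.\<close>

lemma sum_labels_square:
  fixes c :: "nat \<Rightarrow> real"
  assumes i: "i < n" and J: "J \<subseteq> {..<n}"
  shows "(\<Sum>y\<in>labels n. (\<Sum>j\<in>J. y i * y j * c j)\<^sup>2) = card (labels n) * (\<Sum>j\<in>J. (c j)\<^sup>2)"
proof -
  have fin: "finite J" using J finite_subset by blast
  have "(\<Sum>y\<in>labels n. (\<Sum>j\<in>J. y i * y j * c j)\<^sup>2) = (\<Sum>y\<in>labels n. \<Sum>j\<in>J. \<Sum>k\<in>J. (y j * y k) * (c j * c k))"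
  proof (rule sum.cong[OF refl])
    fix y assume "y \<in> labels n"
    then have "(y i)\<^sup>2 = 1" using labels_abs i by (simp add: abs_square_eq_1)
    then have "y i * y j * c j * (y i * y k * c k) = (y j * y k) * (c j * c k)" for j k
      by (simp add: power2_eq_square mult_ac)
    then show "(\<Sum>j\<in>J. y i * y j * c j)\<^sup>2 = (\<Sum>j\<in>J. \<Sum>k\<in>J. (y j * y k) * (c j * c k))"
      by (simp only: power2_eq_square sum_product)
  qed
  also have "\<dots> = (\<Sum>j\<in>J. \<Sum>k\<in>J. (\<Sum>y\<in>labels n. y j * y k) * (c j * c k))"
    by (subst sum.swap, rule sum.cong[OF refl], subst sum.swap, simp add: sum_distrib_right)
  also have "\<dots> = (\<Sum>j\<in>J. \<Sum>k\<in>J. if k = j then card (labels n) * (c j)\<^sup>2 else 0)"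
  proof (intro sum.cong refl)
    fix j k assume jk: "j \<in> J" "k \<in> J"
    show "(\<Sum>y\<in>labels n. y j * y k) * (c j * c k) = (if k = j then card (labels n) * (c j)\<^sup>2 else 0)"
    proof (cases "k = j")
      case True
      have "(\<Sum>y\<in>labels n. y j * y j) = (\<Sum>y\<in>labels n. 1)"
        using jk J labels_cases by (intro sum.cong refl) fastforce
      then show ?thesis using True by (simp add: power2_eq_square)
    next
      case False
      then show ?thesis using jk J sum_labels_orthogonal[of j n k] by auto
    qed
  qed
  also have "\<dots> = card (labels n) * (\<Sum>j\<in>J. (c j)\<^sup>2)"
    using fin by (simp add: sum_distrib_left)
  finally show ?thesis .
qed

text \<open>The Bhattacharyya coefficient of the Bernoulli laws with parameters \<alpha> and
  \<beta>.\<close>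

definition tilt_mass :: "real \<Rightarrow> real \<Rightarrow> real" where
  "tilt_mass \<alpha> \<beta> = sqrt (\<alpha> * \<beta>) + sqrt ((1 - \<alpha>) * (1 - \<beta>))"

definition log_ratio :: "real \<Rightarrow> real \<Rightarrow> bool \<Rightarrow> real" where
  "log_ratio \<alpha> \<beta> b = (if b then ln \<alpha> - ln \<beta> else ln (1 - \<alpha>) - ln (1 - \<beta>))"

text \<open>Second moment of \<open>log_ratio\<close> under the normalised geometric mean of the two
  Bernoulli laws.\<close>

definition log_ratio_moment :: "real \<Rightarrow> real \<Rightarrow> real" where
  "log_ratio_moment \<alpha> \<beta> = (sqrt (\<alpha> * \<beta>) * (ln \<alpha> - ln \<beta>)\<^sup>2
     + sqrt ((1 - \<alpha>) * (1 - \<beta>)) * (ln (1 - \<alpha>) - ln (1 - \<beta>))\<^sup>2) / tilt_mass \<alpha> \<beta>"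

lemma sqrt_prod: "(\<And>x. x \<in> A \<Longrightarrow> 0 \<le> f x) \<Longrightarrow> sqrt (prod f A) = (\<Prod>x\<in>A. sqrt (f x))"
  by (induction A rule: infinite_finite_induct) (auto simp: real_sqrt_mult)

section \<open>The edges at the flipped vertex i\<close>

context
  fixes n i :: nat and \<alpha> \<beta> :: real
  assumes i: "i < n" and \<alpha>: "0 < \<alpha>" "\<alpha> < 1" and \<beta>: "0 < \<beta>" "\<beta> < 1"
begin

definition edge_to :: "nat \<Rightarrow> nat \<times> nat" where "edge_to j = (min i j, max i j)"

definition star :: "(nat \<times> nat) set" where "star = edge_to ` ({..<n} - {i})"

lemma inj_edge_to: "inj_on edge_to A"
  by (auto simp: inj_on_def edge_to_def min_def max_def split: if_splits)

lemma star_subset: "star \<subseteq> edges n"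
  using i by (auto simp: star_def edge_to_def edges_def min_def max_def)

lemma finite_star: "finite star" by (simp add: star_def)

lemma card_star: "card star = n - 1"
  unfolding star_def using i by (simp add: card_image[OF inj_edge_to])

lemma not_star: "x \<in> edges n \<Longrightarrow> x \<notin> star \<Longrightarrow> fst x \<noteq> i \<and> snd x \<noteq> i"
proof -
  assume x: "x \<in> edges n" "x \<notin> star"
  have "x = edge_to (snd x)" if "fst x = i" using x that by (auto simp: edges_def edge_to_def)
  moreover have "x = edge_to (fst x)" if "snd x = i" using x that by (auto simp: edges_def edge_to_def)
  moreover have "x \<noteq> edge_to j" if "j < n" "j \<noteq> i" for j using x that by (auto simp: star_def)
  ultimately show "fst x \<noteq> i \<and> snd x \<noteq> i"
    using x(1) i unfolding edges_def by (metis (no_types, lifting) case_prod_unfold mem_Collect_eq order.strict_trans less_irrefl)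
qed

abbreviation eprob :: "(nat \<Rightarrow> real) \<Rightarrow> nat \<times> nat \<Rightarrow> real" where
  "eprob y x \<equiv> if y (fst x) = y (snd x) then \<alpha> else \<beta>"

abbreviation bern :: "real \<Rightarrow> bool \<Rightarrow> real" where
  "bern p b \<equiv> if b then p else 1 - p"

lemma bern_eprob_pos: "0 < bern (eprob y x) b"
  using \<alpha> \<beta> by simp

lemma pmf_edge_pmf:
  assumes "e \<in> graphs n"
  shows "pmf (edge_pmf n \<alpha> \<beta> y) e = (\<Prod>x\<in>edges n. bern (eprob y x) (e x))"
proof -
  have "pmf (bernoulli_pmf p) b = bern p b" if "0 < p" "p < 1" for p b
    using that by (cases b) auto
  then show ?thesis
    unfolding edge_pmf_def using assms \<alpha> \<beta>
    by (subst pmf_Pi) (auto simp: graphs_def PiE_dflt_def intro!: prod.cong)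
qed

lemma pmf_edge_pmf_pos: "e \<in> graphs n \<Longrightarrow> 0 < pmf (edge_pmf n \<alpha> \<beta> y) e"
  unfolding pmf_edge_pmf by (intro prod_pos bern_eprob_pos ballI)

text \<open>The normalised geometric mean of Bernoulli \<alpha> and Bernoulli \<beta> is again
  Bernoulli, with this parameter.\<close>

definition tilted_p :: real where "tilted_p = sqrt (\<alpha> * \<beta>) / tilt_mass \<alpha> \<beta>"

lemma tilt_mass_pos: "0 < tilt_mass \<alpha> \<beta>"
  unfolding tilt_mass_def using \<alpha> \<beta> by (intro add_pos_pos) auto

lemma tilted_p: "0 < tilted_p" "tilted_p < 1" "1 - tilted_p = sqrt ((1 - \<alpha>) * (1 - \<beta>)) / tilt_mass \<alpha> \<beta>"
proof -
  show "0 < tilted_p" unfolding tilted_p_def using tilt_mass_pos \<alpha> \<beta> by simp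
  show e: "1 - tilted_p = sqrt ((1 - \<alpha>) * (1 - \<beta>)) / tilt_mass \<alpha> \<beta>"
    using tilt_mass_pos by (simp add: tilted_p_def tilt_mass_def field_simps)
  have "0 < sqrt ((1 - \<alpha>) * (1 - \<beta>)) / tilt_mass \<alpha> \<beta>" using tilt_mass_pos \<alpha> \<beta> by simp
  then show "tilted_p < 1" using e by linarith
qed

text \<open>The normalised geometric mean of the graph laws of y and of y flipped at i. Off the star
  the two laws agree; on the star the parameter does not depend on y.\<close>

definition tilted_pmf :: "(nat \<Rightarrow> real) \<Rightarrow> (nat \<times> nat \<Rightarrow> bool) pmf" where
  "tilted_pmf y = Pi_pmf (edges n) False (\<lambda>x. bernoulli_pmf (if x \<in> star then tilted_p else eprob y x))"

definition star_pmf :: "(nat \<times> nat \<Rightarrow> bool) pmf" where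
  "star_pmf = Pi_pmf star False (\<lambda>_. bernoulli_pmf tilted_p)"

text \<open>Log-likelihood ratio of y against its flip: flipping i exchanges \<alpha> and \<beta> on
  every edge at i, and y i * y j records which of them came first.\<close>

definition lr :: "(nat \<Rightarrow> real) \<Rightarrow> (nat \<times> nat \<Rightarrow> bool) \<Rightarrow> real" where
  "lr y e = (\<Sum>j\<in>{..<n} - {i}. y i * y j * log_ratio \<alpha> \<beta> (e (edge_to j)))"

lemma eprob_flip:
  assumes "y \<in> labels n" "j < n" "j \<noteq> i"
  shows "eprob y (edge_to j) = (if y i = y j then \<alpha> else \<beta>)"
    "eprob (y(i := - y i)) (edge_to j) = (if y i = y j then \<beta> else \<alpha>)"
  using labels_cases[OF assms(1,2)] labels_cases[OF assms(1) i] assms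
  by (auto simp: edge_to_def min_def max_def)

lemma eprob_flip_outside: "x \<in> edges n \<Longrightarrow> x \<notin> star \<Longrightarrow> eprob (y(i := - y i)) x = eprob y x"
  using not_star[of x] by simp

text \<open>Every edge at i has probabilities \<alpha> and \<beta> under the two labelings, in one
  order or the other. Its geometric mean is symmetric in them and has mass \<open>tilt_mass\<close>,
  once for each of the n - 1 edges.\<close>

lemma sqrt_pmf_edge_flip:
  assumes y: "y \<in> labels n" and e: "e \<in> graphs n"
  shows "sqrt (pmf (edge_pmf n \<alpha> \<beta> y) e * pmf (edge_pmf n \<alpha> \<beta> (y(i := - y i))) e)
    = tilt_mass \<alpha> \<beta> ^ (n - 1) * pmf (tilted_pmf y) e"
proof -
  let ?y = "y(i := - y i)"
  let ?g = "\<lambda>x. sqrt (bern (eprob y x) (e x) * bern (eprob ?y x) (e x))"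
  let ?q = "\<lambda>x. if x \<in> star then tilted_p else eprob y x"
  have split: "prod h (edges n) = prod h star * prod h (edges n - star)" for h :: "_ \<Rightarrow> real"
    using star_subset finite_edges by (metis mult.commute prod.subset_diff)
  have "sqrt (pmf (edge_pmf n \<alpha> \<beta> y) e * pmf (edge_pmf n \<alpha> \<beta> ?y) e) = prod ?g (edges n)"
    unfolding pmf_edge_pmf[OF e] prod.distrib[symmetric]
    by (intro sqrt_prod mult_nonneg_nonneg less_imp_le bern_eprob_pos)
  also have "\<dots> = prod ?g star * prod ?g (edges n - star)" by (rule split)
  also have "prod ?g star = (\<Prod>x\<in>star. tilt_mass \<alpha> \<beta> * bern (?q x) (e x))"
  proof (rule prod.cong[OF refl])
    fix x assume x: "x \<in> star"
    then obtain j where j: "x = edge_to j" "j < n" "j \<noteq> i" by (auto simp: star_def)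
    have "?g x = (if e x then sqrt (\<alpha> * \<beta>) else sqrt ((1 - \<alpha>) * (1 - \<beta>)))"
      unfolding j(1) eprob_flip[OF y j(2,3)] by (simp add: mult.commute)
    also have "\<dots> = tilt_mass \<alpha> \<beta> * bern tilted_p (e x)"
      using tilt_mass_pos by (simp add: tilted_p(3)) (simp add: tilted_p_def)
    finally show "?g x = tilt_mass \<alpha> \<beta> * bern (?q x) (e x)" using x by simp
  qed
  also have "\<dots> = tilt_mass \<alpha> \<beta> ^ (n - 1) * (\<Prod>x\<in>star. bern (?q x) (e x))"
    by (simp add: prod.distrib card_star)
  also have "prod ?g (edges n - star) = (\<Prod>x\<in>edges n - star. bern (?q x) (e x))"
  proof (rule prod.cong[OF refl])
    fix x assume x: "x \<in> edges n - star"
    then have "eprob ?y x = eprob y x" by (intro eprob_flip_outside) auto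
    then show "?g x = bern (?q x) (e x)" using x \<alpha> \<beta> by (simp only:) (simp add: real_sqrt_mult)
  qed
  also have "tilt_mass \<alpha> \<beta> ^ (n - 1) * (\<Prod>x\<in>star. bern (?q x) (e x)) * (\<Prod>x\<in>edges n - star. bern (?q x) (e x))
     = tilt_mass \<alpha> \<beta> ^ (n - 1) * (\<Prod>x\<in>edges n. bern (?q x) (e x))"
    by (subst split[of "\<lambda>x. bern (?q x) (e x)"]) (simp only: mult.assoc)
  also have "(\<Prod>x\<in>edges n. bern (?q x) (e x)) = pmf (tilted_pmf y) e"
  proof -
    have "pmf (bernoulli_pmf p) b = bern p b" if "0 < p" "p < 1" for p b
      using that by (cases b) auto
    then show ?thesis
      unfolding tilted_pmf_def using e \<alpha> \<beta> tilted_p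
      by (subst pmf_Pi) (auto simp: graphs_def PiE_dflt_def intro!: prod.cong)
  qed
  finally show ?thesis .
qed

lemma ln_pmf_edge_flip:
  assumes y: "y \<in> labels n" and e: "e \<in> graphs n"
  shows "ln (pmf (edge_pmf n \<alpha> \<beta> y) e) - ln (pmf (edge_pmf n \<alpha> \<beta> (y(i := - y i))) e) = lr y e"
proof -
  let ?y = "y(i := - y i)"
  let ?h = "\<lambda>x. ln (bern (eprob y x) (e x)) - ln (bern (eprob ?y x) (e x))"
  have "ln (pmf (edge_pmf n \<alpha> \<beta> y) e) - ln (pmf (edge_pmf n \<alpha> \<beta> ?y) e) = sum ?h (edges n)"
    unfolding pmf_edge_pmf[OF e] sum_subtractf
    by (intro arg_cong2[where f="(-)"] ln_prod finite_edges less_imp_neq[OF bern_eprob_pos, symmetric])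
  also have "\<dots> = sum ?h star"
    using star_subset by (intro sum.mono_neutral_right) (auto simp: eprob_flip_outside simp del: fun_upd_apply)
  also have "\<dots> = (\<Sum>j\<in>{..<n} - {i}. ?h (edge_to j))"
    unfolding star_def by (rule sum.reindex_cong[OF inj_edge_to refl refl])
  also have "\<dots> = lr y e"
    unfolding lr_def
  proof (rule sum.cong[OF refl])
    fix j assume "j \<in> {..<n} - {i}"
    then have j: "j < n" "j \<noteq> i" by auto
    show "?h (edge_to j) = y i * y j * log_ratio \<alpha> \<beta> (e (edge_to j))"
      unfolding eprob_flip[OF y j]
      using labels_cases[OF y j(1)] labels_cases[OF y i] by (auto simp: log_ratio_def)
  qed
  finally show ?thesis .
qed

text \<open>The restriction of \<open>tilted_pmf y\<close> to the star is the same law for all y.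
  This is what allows the average over y to be taken inside the expectation.\<close>

lemma expectation_tilted_pmf:
  fixes h :: "(nat \<times> nat \<Rightarrow> bool) \<Rightarrow> real"
  assumes "\<And>e e'. (\<And>x. x \<in> star \<Longrightarrow> e x = e' x) \<Longrightarrow> h e = h e'"
  shows "measure_pmf.expectation (tilted_pmf y) h = measure_pmf.expectation star_pmf h"
proof -
  have "star_pmf = Pi_pmf star False (\<lambda>x. bernoulli_pmf (if x \<in> star then tilted_p else eprob y x))"
    unfolding star_pmf_def by (rule Pi_pmf_cong) auto
  also have "\<dots> = map_pmf (\<lambda>f x. if x \<in> star then f x else False) (tilted_pmf y)"
    unfolding tilted_pmf_def by (rule Pi_pmf_subset) (auto simp: star_subset)
  finally have "measure_pmf.expectation star_pmf h = measure_pmf.expectation (tilted_pmf y) (\<lambda>f. h (\<lambda>x. if x \<in> star then f x else False))"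
    by simp
  also have "(\<lambda>f. h (\<lambda>x. if x \<in> star then f x else False)) = h"
    by (rule ext, rule assms) auto
  finally show ?thesis ..
qed

lemma finite_set_star_pmf: "finite (set_pmf star_pmf)"
  by (rule finite_subset[OF set_Pi_pmf_subset'[OF finite_star, of False "\<lambda>_. bernoulli_pmf tilted_p", folded star_pmf_def]])
    (auto intro!: finite_PiE_dflt finite_star)

lemma expectation_log_ratio_square:
  assumes "j \<in> {..<n} - {i}"
  shows "measure_pmf.expectation star_pmf (\<lambda>e. (log_ratio \<alpha> \<beta> (e (edge_to j)))\<^sup>2) = log_ratio_moment \<alpha> \<beta>"
proof -
  have "edge_to j \<in> star" using assms by (simp add: star_def)
  then have m: "map_pmf (\<lambda>e. e (edge_to j)) star_pmf = bernoulli_pmf tilted_p"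
    unfolding star_pmf_def by (simp add: Pi_pmf_component finite_star)
  have "measure_pmf.expectation star_pmf (\<lambda>e. (log_ratio \<alpha> \<beta> (e (edge_to j)))\<^sup>2)
     = measure_pmf.expectation (bernoulli_pmf tilted_p) (\<lambda>b. (log_ratio \<alpha> \<beta> b)\<^sup>2)"
    unfolding m[symmetric] by simp
  also have "\<dots> = (log_ratio \<alpha> \<beta> True)\<^sup>2 * tilted_p + (log_ratio \<alpha> \<beta> False)\<^sup>2 * (1 - tilted_p)"
    using tilted_p by simp
  also have "\<dots> = log_ratio_moment \<alpha> \<beta>"
    unfolding tilted_p(3) by (simp add: tilted_p_def log_ratio_def log_ratio_moment_def add_divide_distrib mult.commute)
  finally show ?thesis .
qed

text \<open>For a fixed unbalanced y the tilted mean of \<open>lr\<close> can be of order q, as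
  large as the later t. After averaging over y the cross terms vanish and the second moment is just
  n - 1 times that of one edge.\<close>

lemma sum_labels_graphs_tilted:
  fixes w t :: real
  shows "(\<Sum>y\<in>labels n. \<Sum>e\<in>graphs n. sqrt (pmf (edge_pmf n \<alpha> \<beta> y) e * pmf (edge_pmf n \<alpha> \<beta> (y(i := - y i))) e)
       * (1 - ((ln (pmf (edge_pmf n \<alpha> \<beta> y) e) - ln (pmf (edge_pmf n \<alpha> \<beta> (y(i := - y i))) e))\<^sup>2 / 2 + w) / t\<^sup>2))
    = card (labels n) * (tilt_mass \<alpha> \<beta> ^ (n - 1) * (1 - (real (n - 1) * log_ratio_moment \<alpha> \<beta> / 2 + w) / t\<^sup>2))"
proof -
  let ?E = "measure_pmf.expectation star_pmf"
  note [simp] = integrable_measure_pmf_finite[OF finite_set_star_pmf]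
  have A: "(\<Sum>e\<in>graphs n. sqrt (pmf (edge_pmf n \<alpha> \<beta> y) e * pmf (edge_pmf n \<alpha> \<beta> (y(i := - y i))) e)
       * (1 - ((ln (pmf (edge_pmf n \<alpha> \<beta> y) e) - ln (pmf (edge_pmf n \<alpha> \<beta> (y(i := - y i))) e))\<^sup>2 / 2 + w) / t\<^sup>2))
     = tilt_mass \<alpha> \<beta> ^ (n - 1) * ?E (\<lambda>e. 1 - ((lr y e)\<^sup>2 / 2 + w) / t\<^sup>2)" (is "?L = _") if y: "y \<in> labels n" for y
  proof -
    let ?h = "\<lambda>e. 1 - ((lr y e)\<^sup>2 / 2 + w) / t\<^sup>2"
    have "?L = (\<Sum>e\<in>graphs n. tilt_mass \<alpha> \<beta> ^ (n - 1) * (?h e * pmf (tilted_pmf y) e))"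
      by (intro sum.cong refl) (simp only: sqrt_pmf_edge_flip[OF y] ln_pmf_edge_flip[OF y] mult_ac)
    also have "\<dots> = tilt_mass \<alpha> \<beta> ^ (n - 1) * measure_pmf.expectation (tilted_pmf y) ?h"
      unfolding sum_distrib_left[symmetric]
    proof (subst integral_measure_pmf_real[of "graphs n"])
      show "e \<in> graphs n" if "e \<in> set_pmf (tilted_pmf y)" for e
        using that set_Pi_pmf_subset[of "edges n" False] by (auto simp: tilted_pmf_def graphs_def PiE_dflt_def)
    qed simp_all
    also have "measure_pmf.expectation (tilted_pmf y) ?h = ?E ?h"
    proof (rule expectation_tilted_pmf)
      fix e e' :: "nat \<times> nat \<Rightarrow> bool" assume *: "\<And>x. x \<in> star \<Longrightarrow> e x = e' x"
      have "lr y e = lr y e'" unfolding lr_def by (intro sum.cong refl) (simp add: * star_def)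
      then show "?h e = ?h e'" by simp
    qed
    finally show ?thesis .
  qed
  have "(\<Sum>y\<in>labels n. ?E (\<lambda>e. 1 - ((lr y e)\<^sup>2 / 2 + w) / t\<^sup>2)) = ?E (\<lambda>e. \<Sum>y\<in>labels n. 1 - ((lr y e)\<^sup>2 / 2 + w) / t\<^sup>2)"
    by (rule Bochner_Integration.integral_sum[symmetric]) simp
  also have "\<dots> = ?E (\<lambda>e. card (labels n) * (1 - ((\<Sum>j\<in>{..<n} - {i}. (log_ratio \<alpha> \<beta> (e (edge_to j)))\<^sup>2) / 2 + w) / t\<^sup>2))"
  proof (rule Bochner_Integration.integral_cong[OF refl])
    fix e
    have "(\<Sum>y\<in>labels n. (lr y e)\<^sup>2) = card (labels n) * (\<Sum>j\<in>{..<n} - {i}. (log_ratio \<alpha> \<beta> (e (edge_to j)))\<^sup>2)"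
      unfolding lr_def by (rule sum_labels_square[OF i]) auto
    then show "(\<Sum>y\<in>labels n. 1 - ((lr y e)\<^sup>2 / 2 + w) / t\<^sup>2)
      = card (labels n) * (1 - ((\<Sum>j\<in>{..<n} - {i}. (log_ratio \<alpha> \<beta> (e (edge_to j)))\<^sup>2) / 2 + w) / t\<^sup>2)"
      by (simp add: sum_subtractf sum_divide_distrib[symmetric] sum.distrib right_diff_distrib distrib_left)
  qed
  also have "\<dots> = card (labels n) * (1 - ((\<Sum>j\<in>{..<n} - {i}. log_ratio_moment \<alpha> \<beta>) / 2 + w) / t\<^sup>2)"
    by (simp add: expectation_log_ratio_square del: sum_constant)
  also have "(\<Sum>j\<in>{..<n} - {i}. log_ratio_moment \<alpha> \<beta>) = real (n - 1) * log_ratio_moment \<alpha> \<beta>"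
    using i by simp
  finally show ?thesis
    using A by (simp add: sum_distrib_left[symmetric] mult_ac)
qed

end

section \<open>The error of an estimator\<close>

definition pair_mismatch :: "(nat \<Rightarrow> real) \<Rightarrow> (nat \<Rightarrow> real) \<Rightarrow> nat \<Rightarrow> nat \<Rightarrow> real" where
  "pair_mismatch yh y i k = (if yh i * yh k = y i * y k then 0 else 1)"

text \<open>For either global sign, a product of labels can be wrong only if one of its two labels
  is, and each wrong label spoils at most 2 n ordered pairs. Products do not see the global sign, so
  the bound passes to the minimum over signs.\<close>

lemma mismatch_ge_pair_mismatch:
  assumes n: "0 < n" and yh: "\<And>i. i < n \<Longrightarrow> yh i \<in> {-1, 1}" and y: "y \<in> labels n"
  shows "1 / (2 * (real n)\<^sup>2) * (\<Sum>i<n. \<Sum>k<n. pair_mismatch yh y i k) \<le> mismatch n yh y"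
proof -
  have bound: "(\<Sum>i<n. \<Sum>k<n. pair_mismatch yh y i k) \<le> 2 * real n * card {i. i < n \<and> P i}"
    if P: "\<And>i k. i < n \<Longrightarrow> k < n \<Longrightarrow> \<not> P i \<Longrightarrow> \<not> P k \<Longrightarrow> yh i * yh k = y i * y k" for P
  proof -
    have "(\<Sum>i<n. \<Sum>k<n. pair_mismatch yh y i k) \<le> (\<Sum>i<n. \<Sum>k<n. of_bool (P i) + of_bool (P k))"
      by (intro sum_mono) (use P in \<open>auto simp: pair_mismatch_def\<close>)
    also have "\<dots> = 2 * real n * (\<Sum>i<n. of_bool (P i))"
      by (simp add: sum.distrib sum_distrib_left)
    also have "(\<Sum>i<n. of_bool (P i)) = real (card {i. i < n \<and> P i})"
      by (simp add: of_bool_def sum.If_cases Int_def)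
    finally show ?thesis .
  qed
  have "(\<Sum>i<n. \<Sum>k<n. pair_mismatch yh y i k) \<le> 2 * real n * card {i. i < n \<and> yh i \<noteq> y i}"
    by (rule bound) auto
  moreover have "(\<Sum>i<n. \<Sum>k<n. pair_mismatch yh y i k) \<le> 2 * real n * card {i. i < n \<and> yh i \<noteq> - y i}"
    by (rule bound) auto
  ultimately have "(\<Sum>i<n. \<Sum>k<n. pair_mismatch yh y i k)
     \<le> 2 * real n * real (min (card {i. i < n \<and> yh i \<noteq> y i}) (card {i. i < n \<and> yh i \<noteq> - y i}))"
    by (simp add: min_def)
  then have "1 / (2 * (real n)\<^sup>2) * (\<Sum>i<n. \<Sum>k<n. pair_mismatch yh y i k)
     \<le> 1 / (2 * (real n)\<^sup>2) * (2 * real n * real (min (card {i. i < n \<and> yh i \<noteq> y i}) (card {i. i < n \<and> yh i \<noteq> - y i})))"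
    by (intro mult_left_mono) auto
  also have "\<dots> = mismatch n yh y"
    using n by (simp add: mismatch_def power2_eq_square)
  finally show ?thesis .
qed

lemma mismatch_le_1: "mismatch n yh y \<le> 1"
proof -
  have "card {i. i < n \<and> yh i \<noteq> y i} \<le> card {..<n}" by (rule card_mono) auto
  then have "real (min (card {i. i < n \<and> yh i \<noteq> y i}) (card {i. i < n \<and> yh i \<noteq> - y i})) \<le> real n"
    by simp
  then show ?thesis by (cases "n = 0") (simp_all add: mismatch_def divide_le_eq)
qed

text \<open>Truncation at 0 is subadditive. Hence lower bounds of mixed sign can be summed first and
  truncated afterwards.\<close>

lemma ennreal_sum_le: "ennreal (sum f A) \<le> (\<Sum>x\<in>A. ennreal (f x))"
proof (induction A rule: infinite_finite_induct)
  case (insert x A)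
  have "ennreal (f x + sum f A) \<le> ennreal (max 0 (f x) + max 0 (sum f A))"
    by (intro ennreal_leI) auto
  also have "\<dots> = ennreal (f x) + ennreal (sum f A)"
    by (subst ennreal_plus) (auto simp: max_def ennreal_neg)
  also have "\<dots> \<le> ennreal (f x) + (\<Sum>x\<in>A. ennreal (f x))"
    by (intro add_left_mono insert.IH)
  finally show ?case using insert.hyps by simp
qed auto

lemma mix_lik_measurable [measurable]: "mix_lik n d R y \<in> borel_measurable (PiM {..<n} (\<lambda>_. gauss_vec d))"
  unfolding mix_lik_def by (rule sphere_unif.borel_measurable_nn_integral) (simp add: case_prod_beta')

section \<open>From the expected loss to pairs of labels\<close>

context
  fixes n d :: nat and \<alpha> \<beta> R v0 \<eta> t :: real
    and est :: "(nat \<Rightarrow> nat \<Rightarrow> bool) \<Rightarrow> (nat \<Rightarrow> nat \<Rightarrow> real) \<Rightarrow> nat \<Rightarrow> real"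
  assumes n: "2 \<le> n" and \<alpha>: "0 < \<alpha>" "\<alpha> < 1" and \<beta>: "0 < \<beta>" "\<beta> < 1"
    and \<eta>: "0 < \<eta>" "\<eta> < 1" and v0: "0 \<le> v0" and t: "0 < t"
    and big: "1024 \<le> \<eta>\<^sup>2 * (real (n - 1) * R\<^sup>2)"
    and v: "real (n - 1) * (R\<^sup>2)\<^sup>2 * (1 + \<eta>)\<^sup>2 \<le> v0 * ((1 - \<eta>) * (d + real (n - 1) * R\<^sup>2))"
    and est: "\<And>A X i. i < n \<Longrightarrow> est A X i \<in> {-1, 1}"
    and est_m: "\<And>A i. i < n \<Longrightarrow> (\<lambda>X. est A X i) \<in> borel_measurable (data_space n d)"
begin

abbreviation (input) "base \<equiv> PiM {..<n} (\<lambda>_. gauss_vec d)"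

definition err :: "nat \<Rightarrow> nat \<Rightarrow> (nat \<Rightarrow> real) \<Rightarrow> (nat \<times> nat \<Rightarrow> bool) \<Rightarrow> (nat \<Rightarrow> nat \<Rightarrow> real) \<Rightarrow> ennreal" where
  "err i k y e X = ennreal (pair_mismatch (est (adj_of e) X) y i k)"

lemma err_measurable: "i < n \<Longrightarrow> k < n \<Longrightarrow> err i k y e \<in> borel_measurable (data_space n d)"
proof -
  assume "i < n" "k < n"
  note est_m[OF this(1), measurable] est_m[OF this(2), measurable]
  show ?thesis unfolding err_def pair_mismatch_def by measurable
qed

lemma err_measurable_base [measurable]: "i < n \<Longrightarrow> k < n \<Longrightarrow> err i k y e \<in> borel_measurable base"
  using err_measurable by (simp add: measurable_cong_sets[OF sets_data_space refl])

text \<open>For y in \<open>labels n\<close>: the conditional probability given y that the estimated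
  product of labels i and k is wrong, with \<mu> integrated out and the samples taken relative to
  pure noise.\<close>

definition joint_err :: "nat \<Rightarrow> nat \<Rightarrow> (nat \<Rightarrow> real) \<Rightarrow> ennreal" where
  "joint_err i k y = (\<Sum>e\<in>graphs n. \<integral>\<^sup>+X. ennreal (pmf (edge_pmf n \<alpha> \<beta> y) e) * mix_lik n d R y X * err i k y e X \<partial>base)"

text \<open>The expected loss has \<mu> as an outer variable; Fubini moves it inside the integral
  over the samples, where it turns the likelihood into \<open>mix_lik\<close>.\<close>

lemma conditional_mismatch_ge:
  assumes y: "y \<in> labels n"
  shows "ennreal (1 / (2 * (real n)\<^sup>2)) * (\<Sum>i<n. \<Sum>k<n. joint_err i k y)
    \<le> (\<integral>\<^sup>+\<mu>. \<integral>\<^sup>+e. \<integral>\<^sup>+X. ennreal (mismatch n (est (adj_of e) X) y) \<partial>gmm_dist n d y \<mu> \<partial>edge_dist n \<alpha> \<beta> y \<partial>sphere_unif d R)"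
proof -
  let ?c = "1 / (2 * (real n)\<^sup>2)"
  let ?p = "\<lambda>e. ennreal (pmf (edge_pmf n \<alpha> \<beta> y) e)"
  let ?pi = "sphere_unif d R"
  interpret G: prob_space base by (rule prob_space_PiM) (rule gauss_vec.prob_space_axioms)
  interpret PP: pair_sigma_finite ?pi base by standard
  let ?L = "\<lambda>i k e \<mu>. \<integral>\<^sup>+X. ennreal (lik n d y \<mu> X) * err i k y e X \<partial>base"
  have Lm: "?L i k e \<in> borel_measurable ?pi" if "i < n" "k < n" for i k e
    by (rule G.borel_measurable_nn_integral) (use that in \<open>simp add: case_prod_beta'\<close>)
  have X: "ennreal ?c * (\<Sum>i<n. \<Sum>k<n. ?L i k e \<mu>) \<le> (\<integral>\<^sup>+X. ennreal (mismatch n (est (adj_of e) X) y) \<partial>gmm_dist n d y \<mu>)" for e \<mu>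
  proof -
    have sm: "(\<lambda>X. \<Sum>i<n. \<Sum>k<n. err i k y e X) \<in> borel_measurable (data_space n d)"
      by (intro borel_measurable_sum err_measurable) auto
    have sg: "sets (gmm_dist n d y \<mu>) = sets (data_space n d)"
      unfolding gmm_dist_def data_space_def by (intro sets_PiM_cong) auto
    have "ennreal ?c * (\<Sum>i<n. \<Sum>k<n. ?L i k e \<mu>) = ennreal ?c * (\<Sum>i<n. \<Sum>k<n. \<integral>\<^sup>+X. err i k y e X \<partial>gmm_dist n d y \<mu>)"
      using labels_abs[OF y] by (intro arg_cong2[where f="(*)"] refl sum.cong nn_integral_gmm_dist[symmetric] err_measurable) auto
    also have "\<dots> = ennreal ?c * (\<integral>\<^sup>+X. (\<Sum>i<n. \<Sum>k<n. err i k y e X) \<partial>gmm_dist n d y \<mu>)"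
    proof -
      have em: "err i k y e \<in> borel_measurable (gmm_dist n d y \<mu>)" if "i < n" "k < n" for i k
        using err_measurable[OF that] by (simp add: measurable_cong_sets[OF sg refl])
      have "(\<integral>\<^sup>+X. (\<Sum>i<n. \<Sum>k<n. err i k y e X) \<partial>gmm_dist n d y \<mu>) = (\<Sum>i<n. \<integral>\<^sup>+X. (\<Sum>k<n. err i k y e X) \<partial>gmm_dist n d y \<mu>)"
        by (intro nn_integral_sum borel_measurable_sum em) auto
      also have "\<dots> = (\<Sum>i<n. \<Sum>k<n. \<integral>\<^sup>+X. err i k y e X \<partial>gmm_dist n d y \<mu>)"
        by (intro sum.cong refl nn_integral_sum em) auto
      finally show ?thesis by simp
    qed
    also have "\<dots> = (\<integral>\<^sup>+X. ennreal ?c * (\<Sum>i<n. \<Sum>k<n. err i k y e X) \<partial>gmm_dist n d y \<mu>)"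
      using sm by (intro nn_integral_cmult[symmetric]) (simp add: measurable_cong_sets[OF sg refl])
    also have "\<dots> \<le> (\<integral>\<^sup>+X. ennreal (mismatch n (est (adj_of e) X) y) \<partial>gmm_dist n d y \<mu>)"
    proof (rule nn_integral_mono)
      fix X
      have "ennreal ?c * (\<Sum>i<n. \<Sum>k<n. err i k y e X) = ennreal (?c * (\<Sum>i<n. \<Sum>k<n. pair_mismatch (est (adj_of e) X) y i k))"
        unfolding err_def
        by (subst ennreal_mult') (simp_all add: sum_ennreal sum_nonneg pair_mismatch_def)
      also have "\<dots> \<le> ennreal (mismatch n (est (adj_of e) X) y)"
        using n est y by (intro ennreal_leI mismatch_ge_pair_mismatch) auto
      finally show "ennreal ?c * (\<Sum>i<n. \<Sum>k<n. err i k y e X) \<le> \<dots>" .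
    qed
    finally show ?thesis .
  qed
  have swap: "(\<integral>\<^sup>+\<mu>. ?L i k e \<mu> \<partial>?pi) = (\<integral>\<^sup>+X. mix_lik n d R y X * err i k y e X \<partial>base)" if "i < n" "k < n" for i k e
  proof -
    note err_measurable_base[OF that, measurable]
    have "(\<integral>\<^sup>+\<mu>. ?L i k e \<mu> \<partial>?pi) = (\<integral>\<^sup>+X. \<integral>\<^sup>+\<mu>. ennreal (lik n d y \<mu> X) * err i k y e X \<partial>?pi \<partial>base)"
      by (rule PP.Fubini'[symmetric]) measurable
    also have "\<dots> = (\<integral>\<^sup>+X. mix_lik n d R y X * err i k y e X \<partial>base)"
      unfolding mix_lik_def
    proof (intro nn_integral_cong nn_integral_multc)
      fix X assume "X \<in> space base"
      then have Xs: "X \<in> space (PiM {..<n} (\<lambda>_. vec_space d))"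
        using sets_eq_imp_space_eq[OF sets_PiM_gauss_vec] by auto
      have "(\<lambda>\<mu>. ennreal (lik n d y \<mu> X)) \<in> borel_measurable (vec_space d)"
        using Xs by measurable
      then show "(\<lambda>\<mu>. ennreal (lik n d y \<mu> X)) \<in> borel_measurable ?pi"
        by (simp add: measurable_cong_sets[OF sets_sphere_unif refl])
    qed
    finally show ?thesis .
  qed
  have "ennreal ?c * (\<Sum>i<n. \<Sum>k<n. joint_err i k y)
      = ennreal ?c * (\<Sum>i<n. \<Sum>k<n. \<Sum>e\<in>graphs n. ?p e * (\<integral>\<^sup>+\<mu>. ?L i k e \<mu> \<partial>?pi))"
    unfolding joint_err_def
    by (intro arg_cong2[where f="(*)"] refl sum.cong) (simp add: swap mult.assoc nn_integral_cmult)
  also have "\<dots> = (\<Sum>e\<in>graphs n. ?p e * (ennreal ?c * (\<Sum>i<n. \<Sum>k<n. \<integral>\<^sup>+\<mu>. ?L i k e \<mu> \<partial>?pi)))"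
  proof -
    have "(\<Sum>i<n. \<Sum>k<n. \<Sum>e\<in>graphs n. f i k e) = (\<Sum>e\<in>graphs n. \<Sum>i<n. \<Sum>k<n. f i k e)" for f :: "nat \<Rightarrow> nat \<Rightarrow> _ \<Rightarrow> ennreal"
      by (simp add: sum.swap[of _ "graphs n"])
    then show ?thesis by (simp add: sum_distrib_left mult.left_commute)
  qed
  also have "\<dots> = (\<Sum>e\<in>graphs n. ?p e * (\<integral>\<^sup>+\<mu>. ennreal ?c * (\<Sum>i<n. \<Sum>k<n. ?L i k e \<mu>) \<partial>?pi))"
  proof -
    have 0: "(\<integral>\<^sup>+\<mu>. (\<Sum>i<n. \<Sum>k<n. ?L i k e \<mu>) \<partial>?pi) = (\<Sum>i<n. \<integral>\<^sup>+\<mu>. (\<Sum>k<n. ?L i k e \<mu>) \<partial>?pi)" for e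
      by (intro nn_integral_sum borel_measurable_sum Lm) auto
    have 1: "(\<integral>\<^sup>+\<mu>. (\<Sum>i<n. \<Sum>k<n. ?L i k e \<mu>) \<partial>?pi) = (\<Sum>i<n. \<Sum>k<n. \<integral>\<^sup>+\<mu>. ?L i k e \<mu> \<partial>?pi)" for e
      unfolding 0 by (intro sum.cong refl nn_integral_sum Lm) auto
    have 2: "(\<integral>\<^sup>+\<mu>. ennreal ?c * (\<Sum>i<n. \<Sum>k<n. ?L i k e \<mu>) \<partial>?pi) = ennreal ?c * (\<integral>\<^sup>+\<mu>. (\<Sum>i<n. \<Sum>k<n. ?L i k e \<mu>) \<partial>?pi)" for e
      by (intro nn_integral_cmult borel_measurable_sum Lm) auto
    show ?thesis unfolding 2 1 ..
  qed
  also have "\<dots> = (\<integral>\<^sup>+\<mu>. (\<Sum>e\<in>graphs n. ?p e * (ennreal ?c * (\<Sum>i<n. \<Sum>k<n. ?L i k e \<mu>))) \<partial>?pi)"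
  proof -
    have Sm: "(\<lambda>\<mu>. \<Sum>i<n. \<Sum>k<n. ?L i k e \<mu>) \<in> borel_measurable ?pi" for e
      by (intro borel_measurable_sum Lm) auto
    show ?thesis using Sm by (subst nn_integral_sum) (simp_all add: nn_integral_cmult)
  qed
  also have "\<dots> = (\<integral>\<^sup>+\<mu>. \<integral>\<^sup>+e. ennreal ?c * (\<Sum>i<n. \<Sum>k<n. ?L i k e \<mu>) \<partial>edge_dist n \<alpha> \<beta> y \<partial>?pi)"
    unfolding nn_integral_edge_dist ..
  also have "\<dots> \<le> (\<integral>\<^sup>+\<mu>. \<integral>\<^sup>+e. \<integral>\<^sup>+X. ennreal (mismatch n (est (adj_of e) X) y) \<partial>gmm_dist n d y \<mu> \<partial>edge_dist n \<alpha> \<beta> y \<partial>?pi)"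
    by (intro nn_integral_mono X)
  finally show ?thesis .
qed

text \<open>The factors are the probability of the good event for S, the Gaussian cost with the
  slack t, the Bhattacharyya mass of the n - 1 edges at i, and the second-moment correction averaged
  over y.\<close>

definition pair_bound :: real where
  "pair_bound = 1/2 * exp (- v0 / 2 - t) * tilt_mass \<alpha> \<beta> ^ (n - 1)
     * (1 - (real (n - 1) * log_ratio_moment \<alpha> \<beta> / 2 + 16 * v0) / t\<^sup>2)"

text \<open>Given the data, at least one of \<open>y\<close> and \<open>y\<close> with label \<open>i\<close> flipped contradicts the estimated
  product of the labels \<open>i\<close> and \<open>k\<close>.\<close>

lemma joint_err_ge:
  assumes i: "i < n" and k: "k < n" and ik: "i \<noteq> k"
  shows "ennreal (card (labels n) * pair_bound) \<le> 2 * (\<Sum>y\<in>labels n. joint_err i k y)"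
proof -
  let ?f = "\<lambda>y. y(i := - y i)"
  let ?P = "\<lambda>y e. pmf (edge_pmf n \<alpha> \<beta> y) e"
  let ?W = "\<lambda>y e X. ennreal (?P y e) * mix_lik n d R y X"
  have "card (labels n) * pair_bound = 1/2 * exp (- v0 / 2 - t) *
     (\<Sum>y\<in>labels n. \<Sum>e\<in>graphs n. sqrt (?P y e * ?P (?f y) e) * (1 - ((ln (?P y e) - ln (?P (?f y) e))\<^sup>2 / 2 + 16 * v0) / t\<^sup>2))"
    unfolding sum_labels_graphs_tilted[OF i \<alpha> \<beta>] pair_bound_def by (simp only: mult_ac)
  also have "\<dots> = (\<Sum>y\<in>labels n. \<Sum>e\<in>graphs n. 1/2 * (sqrt (?P y e * ?P (?f y) e) * (exp (- v0 / 2 - t) * (1 - ((ln (?P y e) - ln (?P (?f y) e))\<^sup>2 / 2 + 16 * v0) / t\<^sup>2))))"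
    by (simp only: sum_distrib_left mult_ac)
  finally have "ennreal (card (labels n) * pair_bound) = ennreal \<dots>" by (rule arg_cong)
  \<comment> \<open>For atypical y or graphs the summands may be negative; subadditivity of
    truncation permits the exact averaged value on the left.\<close>
  also have "\<dots> \<le> (\<Sum>y\<in>labels n. ennreal (\<Sum>e\<in>graphs n. 1/2 * (sqrt (?P y e * ?P (?f y) e) * (exp (- v0 / 2 - t) * (1 - ((ln (?P y e) - ln (?P (?f y) e))\<^sup>2 / 2 + 16 * v0) / t\<^sup>2)))))"
    by (rule ennreal_sum_le)
  also have "\<dots> \<le> (\<Sum>y\<in>labels n. \<Sum>e\<in>graphs n. ennreal (1/2 * (sqrt (?P y e * ?P (?f y) e) * (exp (- v0 / 2 - t) * (1 - ((ln (?P y e) - ln (?P (?f y) e))\<^sup>2 / 2 + 16 * v0) / t\<^sup>2)))))"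
    by (intro sum_mono ennreal_sum_le)
  also have "\<dots> \<le> (\<Sum>y\<in>labels n. \<Sum>e\<in>graphs n. \<integral>\<^sup>+X. min (?W y e X) (?W (?f y) e X) \<partial>base)"
    by (intro sum_mono nn_integral_min_mix_lik_ge[OF i n _ _ _ \<eta> v0 t big v] pmf_edge_pmf_pos[OF i \<alpha> \<beta>] labels_abs)
  also have "\<dots> \<le> (\<Sum>y\<in>labels n. \<Sum>e\<in>graphs n. \<integral>\<^sup>+X. ?W y e X * err i k y e X + ?W (?f y) e X * err i k (?f y) e X \<partial>base)"
  proof (intro sum_mono nn_integral_mono)
    fix y e X assume y: "y \<in> labels n"
    have "y i * y k \<noteq> 0" using labels_cases[OF y i] labels_cases[OF y k] by auto
    then have "err i k y e X = 1 \<or> err i k (?f y) e X = 1"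
      using ik by (auto simp: err_def pair_mismatch_def)
    then show "min (?W y e X) (?W (?f y) e X) \<le> ?W y e X * err i k y e X + ?W (?f y) e X * err i k (?f y) e X"
      by (auto intro: min.coboundedI1 min.coboundedI2 add_increasing add_increasing2)
  qed
  also have "\<dots> = (\<Sum>y\<in>labels n. joint_err i k y + joint_err i k (?f y))"
    unfolding joint_err_def sum.distrib[symmetric]
    using i k by (intro sum.cong refl nn_integral_add) measurable
  also have "\<dots> = 2 * (\<Sum>y\<in>labels n. joint_err i k y)"
    by (simp add: sum.distrib sum_labels_flip[OF i] mult_2)
  finally show ?thesis .
qed

text \<open>There are n (n - 1) ordered pairs, each with average error at least
  \<open>pair_bound / 2\<close>, since y and its flip share the error. With the prefactor 1/(2 n^2)
  and n - 1 \<ge> n/2 this gives 1/8.\<close>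

lemma csbm_exp_mismatch_ge: "pair_bound / 8 \<le> csbm_exp_mismatch n d \<alpha> \<beta> R est"
proof (cases "0 \<le> pair_bound")
  case False
  moreover have "0 \<le> csbm_exp_mismatch n d \<alpha> \<beta> R est" by (simp add: csbm_exp_mismatch_def)
  ultimately show ?thesis by linarith
next
  case True
  let ?I = "\<lambda>y. \<integral>\<^sup>+\<mu>. \<integral>\<^sup>+e. \<integral>\<^sup>+X. ennreal (mismatch n (est (adj_of e) X) y) \<partial>gmm_dist n d y \<mu> \<partial>edge_dist n \<alpha> \<beta> y \<partial>sphere_unif d R"
  let ?T = "\<integral>\<^sup>+y. ?I y \<partial>label_dist n"
  let ?N = "card (labels n)"
  let ?c = "1 / (2 * (real n)\<^sup>2)"
  have N: "0 < ?N" by (simp add: card_gt_0_iff labels_nonempty)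
  have T: "?T = (\<Sum>y\<in>labels n. ?I y) / ?N"
    unfolding label_dist_def labels_def[symmetric]
    by (rule nn_integral_pmf_of_set[OF labels_nonempty finite_labels])
  \<comment> \<open>Finiteness matters because \<open>enn2real\<close> maps infinity to 0.\<close>
  have "?I y \<le> 1" for y
  proof -
    interpret g: prob_space "gmm_dist n d y \<mu>" for \<mu>
      unfolding gmm_dist_def by (intro prob_space_PiM gauss_vec.prob_space_distr) measurable
    interpret e: prob_space "edge_dist n \<alpha> \<beta> y"
      unfolding edge_dist_eq by (rule prob_space_measure_pmf)
    have "?I y \<le> (\<integral>\<^sup>+\<mu>. \<integral>\<^sup>+e. \<integral>\<^sup>+X. 1 \<partial>gmm_dist n d y \<mu> \<partial>edge_dist n \<alpha> \<beta> y \<partial>sphere_unif d R)"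
      by (intro nn_integral_mono) (simp add: mismatch_le_1)
    also have "\<dots> = 1"
      by (simp add: g.emeasure_space_1 e.emeasure_space_1 sphere_unif.emeasure_space_1)
    finally show ?thesis .
  qed
  then have "?T \<le> (\<integral>\<^sup>+y. 1 \<partial>label_dist n)" by (intro nn_integral_mono)
  also have "\<dots> = 1" by (simp add: label_dist_def)
  finally have fin: "?T < \<infinity>" by (auto simp: less_top[symmetric] top_unique)
  \<comment> \<open>The diagonal k = i is left out: flipping label i does not change y i * y i, so
    it gives no test.\<close>
  have "ennreal (?c * (real n * real (n - 1) * (?N * pair_bound))) = ennreal ?c * ennreal (\<Sum>i<n. \<Sum>k\<in>{..<n} - {i}. ?N * pair_bound)"
    using n by (subst ennreal_mult'[symmetric]) (simp_all add: mult_ac of_nat_diff)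
  also have "\<dots> = ennreal ?c * (\<Sum>i<n. \<Sum>k\<in>{..<n} - {i}. ennreal (?N * pair_bound))"
    using True by (simp only: sum_ennreal sum_nonneg mult_nonneg_nonneg of_nat_0_le_iff)
  also have "\<dots> \<le> ennreal ?c * (\<Sum>i<n. \<Sum>k\<in>{..<n} - {i}. 2 * (\<Sum>y\<in>labels n. joint_err i k y))"
    by (intro mult_left_mono sum_mono joint_err_ge) auto
  also have "\<dots> \<le> ennreal ?c * (\<Sum>i<n. \<Sum>k<n. 2 * (\<Sum>y\<in>labels n. joint_err i k y))"
    by (intro mult_left_mono sum_mono sum_mono2) auto
  also have "\<dots> = 2 * (\<Sum>y\<in>labels n. ennreal ?c * (\<Sum>i<n. \<Sum>k<n. joint_err i k y))"
  proof -
    have "(\<Sum>i<n. \<Sum>k<n. \<Sum>y\<in>labels n. joint_err i k y) = (\<Sum>y\<in>labels n. \<Sum>i<n. \<Sum>k<n. joint_err i k y)"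
      by (simp add: sum.swap[of _ "labels n"])
    then show ?thesis by (simp add: sum_distrib_left[symmetric] mult.left_commute)
  qed
  also have "\<dots> \<le> 2 * (\<Sum>y\<in>labels n. ?I y)"
    by (intro mult_left_mono sum_mono conditional_mismatch_ge) auto
  finally have main: "ennreal (?c * (real n * real (n - 1) * (?N * pair_bound))) \<le> 2 * (\<Sum>y\<in>labels n. ?I y)" .
  have "ennreal (pair_bound / 4) \<le> ennreal (?c * (real n * real (n - 1) * (?N * pair_bound)) / ?N)"
  proof (rule ennreal_leI)
    have "1/4 \<le> ?c * (real n * real (n - 1))"
      using n by (simp add: power2_eq_square field_simps of_nat_diff)
    from mult_right_mono[OF this True] show "pair_bound / 4 \<le> ?c * (real n * real (n - 1) * (?N * pair_bound)) / ?N"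
      using N by (simp add: labels_nonempty)
  qed
  also have "\<dots> = ennreal (?c * (real n * real (n - 1) * (?N * pair_bound))) / ?N"
    using N True by (subst divide_ennreal[symmetric]) (auto simp: ennreal_of_nat_eq_real_of_nat)
  also have "\<dots> \<le> 2 * (\<Sum>y\<in>labels n. ?I y) / ?N"
    by (rule divide_right_mono_ennreal[OF main])
  also have "\<dots> = 2 * ?T" unfolding T by (simp add: ennreal_times_divide)
  also have "\<dots> = ennreal (2 * enn2real ?T)"
    using fin by (simp add: ennreal_mult' ennreal_enn2real)
  finally have "pair_bound / 4 \<le> 2 * enn2real ?T"
    by (subst (asm) ennreal_le_iff) auto
  then show ?thesis by (simp add: csbm_exp_mismatch_def)
qed

end

section \<open>Asymptotics\<close>

text \<open>To first order the logarithm is (sqrt(a b) - (a + b)/2) x. Here x stands for q/n, so n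
  edges yield the graph part of the exponent.\<close>

lemma ln_tilt_mass_asymp:
  assumes "0 < a" "0 < b"
  shows "((\<lambda>x. ln (tilt_mass (a * x) (b * x)) / x) \<longlongrightarrow> - ((sqrt a - sqrt b)\<^sup>2 / 2)) (at_right 0)"
proof -
  define r where "r = sqrt a * sqrt b"
  have r: "0 < r" using assms by (simp add: r_def)
  have ev: "\<forall>\<^sub>F x in at_right 0. ln (tilt_mass (a * x) (b * x)) / x = ln (r * x + sqrt ((1 - a * x) * (1 - b * x))) / x"
    using eventually_at_right_less[of 0]
  proof eventually_elim
    case (elim x)
    then have "sqrt (a * x * (b * x)) = r * x"
      using assms by (simp add: r_def real_sqrt_mult)
    then show ?case by (simp add: tilt_mass_def)
  qed
  have "((\<lambda>x. ln (r * x + sqrt ((1 - a * x) * (1 - b * x))) / x) \<longlongrightarrow> r + (- b - a) / 2) (at_right 0)"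
    using assms r by real_asymp
  moreover have "r + (- b - a) / 2 = - ((sqrt a - sqrt b)\<^sup>2 / 2)"
    using assms by (simp add: r_def power2_diff field_simps)
  ultimately show ?thesis by (simp only: tendsto_cong[OF ev])
qed

text \<open>A present edge has tilted mass about sqrt(a b) x and the constant log ratio ln a - ln b.
  An absent edge has log ratio O(x), which contributes only O(x^2).\<close>

lemma log_ratio_moment_asymp:
  assumes "0 < a" "0 < b"
  shows "((\<lambda>x. log_ratio_moment (a * x) (b * x) / x) \<longlongrightarrow> sqrt a * sqrt b * (ln a - ln b)\<^sup>2) (at_right 0)"
proof -
  define r where "r = sqrt a * sqrt b"
  have r: "0 < r" using assms by (simp add: r_def)
  define l where "l = (ln a - ln b)\<^sup>2"
  have ev: "\<forall>\<^sub>F x in at_right 0. log_ratio_moment (a * x) (b * x) / x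
      = (r * l + sqrt ((1 - a * x) * (1 - b * x)) * ((ln (1 - a * x) - ln (1 - b * x))\<^sup>2 / x)) / (r * x + sqrt ((1 - a * x) * (1 - b * x)))"
    using eventually_at_right_less[of 0]
  proof eventually_elim
    case (elim x)
    then have s: "sqrt (a * x * (b * x)) = r * x"
      using assms by (simp add: r_def real_sqrt_mult)
    have "(ln (a * x) - ln (b * x))\<^sup>2 = l" using elim assms by (simp add: ln_mult l_def)
    then show ?case using elim unfolding log_ratio_moment_def tilt_mass_def s
      by (simp add: add_divide_distrib)
  qed
  have "((\<lambda>x. sqrt ((1 - a * x) * (1 - b * x))) \<longlongrightarrow> 1) (at_right 0)"
    using assms by real_asymp
  moreover have "((\<lambda>x. (ln (1 - a * x) - ln (1 - b * x))\<^sup>2 / x) \<longlongrightarrow> 0) (at_right 0)"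
  proof -
    have "((\<lambda>x. ln (1 - a * x) / x) \<longlongrightarrow> - a) (at_right 0)" "((\<lambda>x. ln (1 - b * x) / x) \<longlongrightarrow> - b) (at_right 0)"
      using assms by (real_asymp, real_asymp)
    then have "((\<lambda>x. (ln (1 - a * x) / x - ln (1 - b * x) / x)\<^sup>2 * x) \<longlongrightarrow> (- a - - b)\<^sup>2 * 0) (at_right 0)"
      by (intro tendsto_intros)
    moreover have ev': "\<forall>\<^sub>F x in at_right 0. (ln (1 - a * x) / x - ln (1 - b * x) / x)\<^sup>2 * x = (ln (1 - a * x) - ln (1 - b * x))\<^sup>2 / x"
      using eventually_at_right_less[of 0]
      by eventually_elim (simp add: diff_divide_distrib[symmetric] power_divide power2_eq_square)
    ultimately show ?thesis by (simp add: tendsto_cong[OF ev'])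
  qed
  ultimately have "((\<lambda>x. (r * l + sqrt ((1 - a * x) * (1 - b * x)) * ((ln (1 - a * x) - ln (1 - b * x))\<^sup>2 / x)) / (r * x + sqrt ((1 - a * x) * (1 - b * x)))) \<longlongrightarrow> (r * l + 1 * 0) / (r * 0 + 1)) (at_right 0)"
    by (intro tendsto_intros) auto
  then show ?thesis by (simp add: tendsto_cong[OF ev] r_def l_def)
qed

text \<open>The loss \<delta> (c/2 + 3) collects \<delta> c/2 from v0 and one \<delta> each from t,
  from the approximation of \<open>tilt_mass\<close>, and from the constant factor 1/32.\<close>

lemma csbm_lower_bound_at:
  fixes a b c \<delta> C q R :: real and n d :: nat
    and est :: "(nat \<Rightarrow> nat \<Rightarrow> bool) \<Rightarrow> (nat \<Rightarrow> nat \<Rightarrow> real) \<Rightarrow> nat \<Rightarrow> real"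
  defines "x \<equiv> q / n"
  assumes abc: "0 < a" "0 < b" "0 < c" and \<delta>: "0 < \<delta>" "\<delta> < 1" and n: "2 \<le> n" and q: "0 < q"
    and ax: "a * x < 1" and bx: "b * x < 1"
    and R: "0 < R" "R ^ 4 / (R\<^sup>2 + real d / real n) = c * q"
    and qbig: "65536 \<le> \<delta>\<^sup>2 * (c * q)" "C + 64 * c \<le> \<delta>\<^sup>2 * q" "ln 32 \<le> \<delta> * q"
    and mass: "- ((sqrt a - sqrt b)\<^sup>2 / 2) - \<delta> \<le> ln (tilt_mass (a * x) (b * x)) / x"
    and moment: "log_ratio_moment (a * x) (b * x) / x \<le> C"
    and est: "\<And>A X i. i < n \<Longrightarrow> est A X i \<in> {-1, 1}"
      "\<And>A i. i < n \<Longrightarrow> (\<lambda>X. est A X i) \<in> borel_measurable (data_space n d)"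
  shows "ereal (- Istar a b c - \<delta> * (c / 2 + 3)) \<le> ereal (1 / q) * elog (csbm_exp_mismatch n d (a * q / n) (b * q / n) R est)"
proof -
  \<comment> \<open>\<eta> = \<delta>/8 is small enough for (1 + \<eta>)^2 \<le> (1 + \<delta>) (1 -
    \<eta>), which is how v0 absorbs the fluctuations of S. It also explains 65536 = 1024 *
    64.\<close>
  define \<eta> where "\<eta> = \<delta> / 8"
  define v0 where "v0 = c * q * (1 + \<delta>)"
  define t where "t = \<delta> * q"
  define N where "N = real (n - 1)"
  have N: "1 \<le> N" "N \<le> n" "N = real n - 1" using n by (auto simp: N_def of_nat_diff)
  have n0: "0 < real n" using n by simp
  have x: "0 < x" "real n * x = q" using q n by (auto simp: x_def)
  let ?\<alpha> = "a * x" and ?\<beta> = "b * x"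
  have \<alpha>: "0 < ?\<alpha>" "?\<alpha> < 1" and \<beta>: "0 < ?\<beta>" "?\<beta> < 1" using abc x ax bx by auto
  have \<eta>: "0 < \<eta>" "\<eta> < 1" using \<delta> by (auto simp: \<eta>_def)
  have v0: "0 \<le> v0" using abc q \<delta> by (simp add: v0_def)
  have t: "0 < t" using q \<delta> by (simp add: t_def)
  have cq: "0 < c * q" using abc q by simp
  have Rpos: "0 < R\<^sup>2" using R(1) by simp
  have dn: "0 \<le> real d / real n" by simp
  have R4: "(R\<^sup>2)\<^sup>2 = c * q * (R\<^sup>2 + real d / real n)"
    using R(2) Rpos dn by (simp add: field_simps add_pos_nonneg)
  \<comment> \<open>The effective ratio c q never exceeds R^2, so c q large already forces R^2
    large.\<close>
  have R2: "c * q \<le> R\<^sup>2"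
  proof -
    have "c * q * R\<^sup>2 \<le> R\<^sup>2 * R\<^sup>2"
      using R4 cq dn by (simp add: power2_eq_square[of "R\<^sup>2"] distrib_left)
    then show ?thesis using Rpos by (rule mult_right_le_imp_le)
  qed
  have big: "1024 \<le> \<eta>\<^sup>2 * (real (n - 1) * R\<^sup>2)"
  proof -
    have "1024 \<le> \<eta>\<^sup>2 * (1 * (c * q))" using qbig(1) by (simp add: \<eta>_def power_divide)
    also have "\<dots> \<le> \<eta>\<^sup>2 * (N * R\<^sup>2)" using R2 N cq by (intro mult_left_mono mult_mono) auto
    finally show ?thesis by (simp only: N_def)
  qed
  have v: "real (n - 1) * (R\<^sup>2)\<^sup>2 * (1 + \<eta>)\<^sup>2 \<le> v0 * ((1 - \<eta>) * (d + real (n - 1) * R\<^sup>2))"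
  proof -
    have e: "(1 + \<eta>)\<^sup>2 \<le> (1 + \<delta>) * (1 - \<eta>)"
    proof -
      have "\<delta> * \<delta> \<le> \<delta>" using \<delta> by (simp add: mult_left_le)
      moreover have "(1 + \<eta>)\<^sup>2 = 1 + \<delta> / 4 + \<delta> * \<delta> / 64"
        by (simp add: \<eta>_def power2_eq_square field_simps)
      moreover have "(1 + \<delta>) * (1 - \<eta>) = 1 + 7 * \<delta> / 8 - \<delta> * \<delta> / 8"
        by (simp add: \<eta>_def field_simps)
      ultimately show ?thesis using \<delta> by linarith
    qed
    \<comment> \<open>S has only n - 1 summands while the hypothesis on R has d/n; N \<le> n moves
      the inequality in the required direction.\<close>
    have "N * (real d / real n) \<le> real n * (real d / real n)" by (rule mult_right_mono[OF N(2) dn])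
    also have "\<dots> = d" using n0 by simp
    finally have "N * (real d / real n) \<le> d" .
    then have "N * (R\<^sup>2 + real d / real n) \<le> d + N * R\<^sup>2" by (simp add: distrib_left)
    then have "c * q * (N * (R\<^sup>2 + real d / real n)) * (1 + \<eta>)\<^sup>2 \<le> c * q * (d + N * R\<^sup>2) * ((1 + \<delta>) * (1 - \<eta>))"
      using cq e N Rpos by (intro mult_mono mult_left_mono) auto
    then show ?thesis unfolding R4 v0_def N_def[symmetric] by (simp only: mult_ac)
  qed
  let ?\<rho> = "tilt_mass ?\<alpha> ?\<beta>"
  let ?M = "log_ratio_moment ?\<alpha> ?\<beta>"
  have \<rho>: "0 < ?\<rho>" unfolding tilt_mass_def using \<alpha> \<beta> by (intro add_pos_pos) auto
  define s where "s = (sqrt a - sqrt b)\<^sup>2 / 2 + \<delta>"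
  have s: "0 \<le> s" using \<delta> by (simp add: s_def)
  \<comment> \<open>Since s \<ge> 0, replacing the n - 1 edges by n only weakens the bound.\<close>
  have pow: "exp (- s * q) \<le> ?\<rho> ^ (n - 1)"
  proof -
    have "- s * x \<le> ln ?\<rho>" using mass x by (simp add: s_def field_simps)
    then have "N * (- s * x) \<le> N * ln ?\<rho>" using N by (intro mult_left_mono) auto
    moreover have "- s * q \<le> N * (- s * x)"
    proof -
      have "N * (s * x) \<le> real n * (s * x)" using N s x by (intro mult_right_mono) auto
      then show ?thesis using x by (simp add: mult_ac flip: x(2))
    qed
    ultimately have "exp (- s * q) \<le> exp (N * ln ?\<rho>)" by simp
    also have "\<dots> = ?\<rho> ^ (n - 1)" using \<rho> by (simp add: N_def exp_of_nat_mult)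
    finally show ?thesis .
  qed
  \<comment> \<open>N times the edge moment is at most C q and 16 v0 \<le> 32 c q. So twice the
    numerator is at most (C + 64 c) q, which \<open>qbig\<close> compares with t^2 = \<delta>^2
    q^2.\<close>
  have half: "1/2 \<le> 1 - (real (n - 1) * ?M / 2 + 16 * v0) / t\<^sup>2"
  proof -
    have M0: "0 \<le> ?M"
      unfolding log_ratio_moment_def using \<rho> \<alpha> \<beta> by (intro divide_nonneg_pos add_nonneg_nonneg mult_nonneg_nonneg) auto
    have "?M \<le> C * x" using moment x by (simp add: field_simps)
    then have "N * ?M \<le> real n * (C * x)" using N M0 by (intro mult_mono) auto
    also have "\<dots> = C * q" using x by (simp add: mult_ac flip: x(2))
    finally have "N * ?M \<le> C * q" .
    moreover have "v0 \<le> 2 * (c * q)" using \<delta> cq mult_left_mono[of "1 + \<delta>" 2 "c * q"] by (simp add: v0_def mult_ac)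
    ultimately have "2 * (N * ?M / 2 + 16 * v0) \<le> (C + 64 * c) * q" by (simp add: algebra_simps)
    also have "\<dots> \<le> \<delta>\<^sup>2 * q * q" using qbig(2) q by (intro mult_right_mono) auto
    also have "\<dots> = t\<^sup>2" by (simp add: t_def power2_eq_square mult_ac)
    finally have "(N * ?M / 2 + 16 * v0) / t\<^sup>2 \<le> 1/2" using t by (simp add: field_simps)
    then show ?thesis unfolding N_def by linarith
  qed
  define E where "E = csbm_exp_mismatch n d ?\<alpha> ?\<beta> R est"
  \<comment> \<open>1/32 is the product of 1/2 from the good event, 1/2 from the second-moment
    factor and 1/8 from the passage to pairs.\<close>
  have "1/32 * exp (- v0 / 2 - t - s * q) = 1/2 * exp (- v0 / 2 - t) * exp (- s * q) * (1/2) / 8"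
    using exp_add[of "- v0 / 2 - t" "- s * q"] by simp
  also have "\<dots> \<le> 1/2 * exp (- v0 / 2 - t) * ?\<rho> ^ (n - 1) * (1 - (real (n - 1) * ?M / 2 + 16 * v0) / t\<^sup>2) / 8"
    using pow half \<rho> by (intro divide_right_mono mult_mono mult_left_mono) auto
  also have "\<dots> \<le> E"
    unfolding E_def
    using csbm_exp_mismatch_ge[OF n \<alpha> \<beta> \<eta> v0 t big v est]
    by (simp only: pair_bound_def[OF n \<alpha> \<beta> \<eta> v0 t big v est])
  finally have E: "1/32 * exp (- v0 / 2 - t - s * q) \<le> E" .
  then have Epos: "0 < E" by (rule less_le_trans[rotated]) simp
  have "ln (1/32 * exp (- v0 / 2 - t - s * q)) \<le> ln E" using E by (intro ln_mono) auto
  moreover have "ln (1/32 * exp (- v0 / 2 - t - s * q)) = - ln 32 + (- v0 / 2 - t - s * q)"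
    by (subst ln_mult) (auto simp: ln_div)
  ultimately have "- (\<delta> * q) + (- v0 / 2 - t - s * q) \<le> ln E" using qbig(3) by linarith
  moreover have "- (\<delta> * q) + (- v0 / 2 - t - s * q) = (- Istar a b c - \<delta> * (c / 2 + 3)) * q"
    by (simp add: v0_def t_def s_def Istar_def field_simps)
  ultimately have "- Istar a b c - \<delta> * (c / 2 + 3) \<le> 1 / q * ln E"
    using q by (simp add: field_simps)
  then show ?thesis
    using Epos by (simp add: elog_def E_def x_def)
qed

theorem theorem4p3:
  fixes a b c :: real and q :: "nat \<Rightarrow> real" and d :: "nat \<Rightarrow> nat" and R :: "nat \<Rightarrow> real"
    and yhat :: "nat \<Rightarrow> (nat \<Rightarrow> nat \<Rightarrow> bool) \<Rightarrow> (nat \<Rightarrow> nat \<Rightarrow> real) \<Rightarrow> (nat \<Rightarrow> real)"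
  assumes "a > 0" and "b > 0" and "c > 0"
    and "filterlim q at_top sequentially"
    and "\<forall>\<^sub>F n in sequentially. q n \<le> ln (real n)"
    and "\<forall>\<^sub>F n in sequentially. d n \<ge> 2"
    and "\<forall>\<^sub>F n in sequentially. R n > 0 \<and>
           R n ^ 4 / ((R n)\<^sup>2 + real (d n) / real n) = c * q n"
    and "\<And>n A X i. i < n \<Longrightarrow> yhat n A X i \<in> {-1, 1}"
    and "\<And>n A i. i < n \<Longrightarrow> (\<lambda>X. yhat n A X i) \<in> borel_measurable (data_space n (d n))"
  shows "liminf (\<lambda>n. ereal (1 / q n) *
            elog (csbm_exp_mismatch n (d n) (a * q n / real n) (b * q n / real n) (R n) (yhat n)))
         \<ge> - ereal (Istar a b c)"
proof -
  have bound: "ereal (- Istar a b c - \<delta> * (c / 2 + 3)) \<le> liminf (\<lambda>n. ereal (1 / q n) *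
      elog (csbm_exp_mismatch n (d n) (a * q n / real n) (b * q n / real n) (R n) (yhat n)))"
    if \<delta>: "0 < \<delta>" "\<delta> < 1" for \<delta>
  proof (rule Liminf_bounded)
    define x where "x = (\<lambda>n. q n / real n)"
    have qpos: "\<forall>\<^sub>F n in sequentially. K \<le> q n" for K
      using assms(4) by (simp add: filterlim_at_top)
    have n2: "\<forall>\<^sub>F n in sequentially. 2 \<le> n" by (rule eventually_ge_at_top)
    \<comment> \<open>The bound q \<le> log n makes the graph sparse: q/n tends to 0, so both edge
      probabilities eventually lie below 1 and the expansions at 0 apply.\<close>
    have x0: "(x \<longlongrightarrow> 0) sequentially"
    proof (rule tendsto_sandwich)
      show "\<forall>\<^sub>F n in sequentially. 0 \<le> x n"
        using qpos[of 0] by eventually_elim (simp add: x_def)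
      show "\<forall>\<^sub>F n in sequentially. x n \<le> ln (real n) / real n"
        using assms(5) by eventually_elim (simp add: x_def divide_right_mono)
      show "(\<lambda>n. ln (real n) / real n) \<longlonglongrightarrow> 0" by real_asymp
    qed simp
    have xr: "filterlim x (at_right 0) sequentially"
    proof -
      have "\<forall>\<^sub>F n in sequentially. 0 < x n"
        using qpos[of 1] n2 by eventually_elim (simp add: x_def)
      then show ?thesis unfolding filterlim_at using x0 by (auto elim: eventually_mono)
    qed
    \<comment> \<open>The limit of the normalised moment plus 1, so that C bounds it
      eventually.\<close>
    define C where "C = sqrt a * sqrt b * (ln a - ln b)\<^sup>2 + 1"
    have mass: "\<forall>\<^sub>F n in sequentially. - ((sqrt a - sqrt b)\<^sup>2 / 2) - \<delta> < ln (tilt_mass (a * x n) (b * x n)) / x n"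
      using filterlim_compose[OF ln_tilt_mass_asymp[OF assms(1,2)] xr] \<delta> by (intro order_tendstoD) auto
    have moment: "\<forall>\<^sub>F n in sequentially. log_ratio_moment (a * x n) (b * x n) / x n < C"
      using filterlim_compose[OF log_ratio_moment_asymp[OF assms(1,2)] xr] by (intro order_tendstoD) (auto simp: C_def)
    have ax: "\<forall>\<^sub>F n in sequentially. a * x n < 1" and bx: "\<forall>\<^sub>F n in sequentially. b * x n < 1"
      using tendsto_mult_left[OF x0, of a] tendsto_mult_left[OF x0, of b] by (auto intro: order_tendstoD)
    show "\<forall>\<^sub>F n in sequentially. ereal (- Istar a b c - \<delta> * (c / 2 + 3)) \<le> ereal (1 / q n) *
      elog (csbm_exp_mismatch n (d n) (a * q n / real n) (b * q n / real n) (R n) (yhat n))"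
      using n2 qpos[of 1] qpos[of "65536 / (\<delta>\<^sup>2 * c)"] qpos[of "(C + 64 * c) / \<delta>\<^sup>2"] qpos[of "ln 32 / \<delta>"]
        assms(7) mass moment ax bx
    proof eventually_elim
      case (elim n)
      show ?case
      proof (rule csbm_lower_bound_at[where C=C])
        show "65536 \<le> \<delta>\<^sup>2 * (c * q n)" using elim(3) \<delta> assms(3) by (simp add: field_simps)
        show "C + 64 * c \<le> \<delta>\<^sup>2 * q n" using elim(4) \<delta> by (simp add: field_simps)
        show "ln 32 \<le> \<delta> * q n" using elim(5) \<delta> by (simp add: field_simps)
      qed (use elim assms(1-3,8,9) \<delta> in \<open>auto simp: x_def\<close>)
    qed
  qed
  show ?thesis
  proof (rule ereal_le_epsilon2)
    fix e :: real assume e: "0 < e"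
    \<comment> \<open>Small enough that the total loss is at most e; the cap 1/2 keeps \<delta>
      below 1.\<close>
    define \<delta> where "\<delta> = min (1/2) (e / (c / 2 + 3))"
    have c3: "0 < c / 2 + 3" using assms(3) by simp
    have \<delta>: "0 < \<delta>" "\<delta> < 1" using e c3 by (auto simp: \<delta>_def min_def)
    have "\<delta> \<le> e / (c / 2 + 3)" by (simp add: \<delta>_def)
    then have "\<delta> * (c / 2 + 3) \<le> e" using c3 by (simp add: pos_le_divide_eq)
    then have "ereal (- Istar a b c - e) \<le> ereal (- Istar a b c - \<delta> * (c / 2 + 3))" by simp
    also note bound[OF \<delta>]
    finally show "- ereal (Istar a b c) \<le> liminf (\<lambda>n. ereal (1 / q n) *
      elog (csbm_exp_mismatch n (d n) (a * q n / real n) (b * q n / real n) (R n) (yhat n))) + ereal e"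
      by (cases "liminf (\<lambda>n. ereal (1 / q n) *
      elog (csbm_exp_mismatch n (d n) (a * q n / real n) (b * q n / real n) (R n) (yhat n)))") auto
  qed
qed

end
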